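(* For any $d\in\mathbb{N}$, any $s\in\mathbb{N}\cup\{\infty\}$ with $s\ge2$ and any $n\in\mathbb{N}$, $$a_n\left(H^s_{\rm mix}([0,1]^d)\hookrightarrow L_2([0,1]^d)\right)\le\left(\frac2n\right)^{c(d)}\quad\text{with}\quad c(d)=\frac{1.2803}{2+\log d}.$$
   Context: $\mathbb{N}=\{1,2,\dots\}$, $\log$ is the natural logarithm. For a compact linear operator $T:X\to Y$ between Hilbert spaces, $a_n(T)=\inf\{\|T-A\| : A:X\to Y\text{ bounded linear},\ \operatorname{rank}(A)<n\}$. For $s\in\mathbb{N}$, $H^s([0,1])=\{f\in L_2([0,1]) : f^{(l)}\in L_2([0,1]),\ 1\le l\le s\}$ (weak derivatives), and $H^\infty([0,1])=\{f\in C^\infty([0,1]) : \sum_{l=0}^\infty\|f^{(l)}\|_{L_2}^2<\infty\}$; both are Hilbert spaces with scalar product $\langle f,g\rangle_s=\sum_{l=0}^s\int_0^1 f^{(l)}(x)\overline{g^{(l)}(x)}\,dx$. $H^s_{\rm mix}([0,1]^d)$ is the $d$th Hilbert space tensor power of $H^s([0,1])$, realized as a space of functions on $[0,1]^d$; for finite $s$ it consists of all $f\in L_2([0,1]^d)$ with $D^\alpha f\in L_2([0,1]^d)$ for all $\alpha\in\{0,\dots,s\}^d$, with scalar product $\sum_{\alpha\in\{0,\dots,s\}^d}\langle D^\alpha f,D^\alpha g\rangle_{L_2}$. The symbol $\hookrightarrow$ denotes the (compact) embedding operator, i.e. the $d$th tensor power of the embedding $H^s([0,1])\hookrightarrow L_2([0,1])$.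 *)

theory Defs
  imports "HOL-Analysis.Analysis" "HOL-Library.Extended_Nat"
begin

text \<open>
  Complex Hilbert spaces of functions are given by representatives: a set of functions together
  with a positive semidefinite sesquilinear form. The Hilbert space proper is the quotient by the
  functions of norm zero, so equality of elements is \<open>heq\<close>, not equality of functions. Functions are
  identified with their restrictions to the domain; values elsewhere are irrelevant.
\<close>

record 'a hspace =
  hcarrier :: "('a \<Rightarrow> complex) set"
  hinner :: "('a \<Rightarrow> complex) \<Rightarrow> ('a \<Rightarrow> complex) \<Rightarrow> complex"

definition hnorm :: "'a hspace \<Rightarrow> ('a \<Rightarrow> complex) \<Rightarrow> real" where
  "hnorm X f = sqrt (Re (hinner X f f))"

definition heq :: "'a hspace \<Rightarrow> ('a \<Rightarrow> complex) \<Rightarrow> ('a \<Rightarrow> complex) \<Rightarrow> bool" where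
  "heq X f g \<longleftrightarrow> hnorm X (\<lambda>x. f x - g x) = 0"

text \<open>
  Linearity is required modulo \<open>heq\<close>; together with boundedness it makes \<open>A\<close> descend to the
  quotients, and every bounded linear operator between the quotients arises in this way.
\<close>

definition bounded_operator ::
    "'a hspace \<Rightarrow> 'b hspace \<Rightarrow> (('a \<Rightarrow> complex) \<Rightarrow> ('b \<Rightarrow> complex)) \<Rightarrow> bool" where
  "bounded_operator X Y A \<longleftrightarrow>
     (\<forall>f\<in>hcarrier X. A f \<in> hcarrier Y) \<and>
     (\<forall>f\<in>hcarrier X. \<forall>g\<in>hcarrier X. \<forall>a b.
        heq Y (A (\<lambda>x. a * f x + b * g x)) (\<lambda>y. a * A f y + b * A g y)) \<and>
     (\<exists>C. \<forall>f\<in>hcarrier X. hnorm Y (A f) \<le> C * hnorm X f)"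

definition operator_norm ::
    "'a hspace \<Rightarrow> 'b hspace \<Rightarrow> (('a \<Rightarrow> complex) \<Rightarrow> ('b \<Rightarrow> complex)) \<Rightarrow> real" where
  "operator_norm X Y A = Sup {hnorm Y (A f) | f. f \<in> hcarrier X \<and> hnorm X f \<le> 1}"

text \<open>
  The range of \<open>A\<close> has dimension less than \<open>n\<close>, i.e. it lies in the linear span of fewer than \<open>n\<close>
  elements. (A cardinality-based dimension would be 0 in the infinite-dimensional case.)
\<close>

definition rank_less ::
    "'a hspace \<Rightarrow> 'b hspace \<Rightarrow> (('a \<Rightarrow> complex) \<Rightarrow> ('b \<Rightarrow> complex)) \<Rightarrow> nat \<Rightarrow> bool" where
  "rank_less X Y A n \<longleftrightarrow>
     (\<exists>B. finite B \<and> card B < n \<and> B \<subseteq> hcarrier Y \<and>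
        (\<forall>f\<in>hcarrier X. \<exists>c. heq Y (A f) (\<lambda>y. \<Sum>b\<in>B. c b * b y)))"

definition approx_number ::
    "'a hspace \<Rightarrow> 'b hspace \<Rightarrow> (('a \<Rightarrow> complex) \<Rightarrow> ('b \<Rightarrow> complex)) \<Rightarrow> nat \<Rightarrow> real" where
  "approx_number X Y T n =
     Inf {operator_norm X Y (\<lambda>f y. T f y - A f y) | A.
            bounded_operator X Y A \<and> rank_less X Y A n}"

definition L2 :: "'a measure \<Rightarrow> 'a hspace" where
  "L2 M = \<lparr>hcarrier = {f \<in> borel_measurable M. integrable M (\<lambda>x. (cmod (f x))\<^sup>2)},
           hinner = (\<lambda>f g. \<integral>x. f x * cnj (g x) \<partial>M)\<rparr>"

definition unit_interval :: "real measure" where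
  "unit_interval = restrict_space lborel {0..1}"

text \<open>Points of the cube are functions on \<open>{..<d}\<close>, extensional in the sense of \<open>PiM\<close>.\<close>

definition unit_cube :: "nat \<Rightarrow> (nat \<Rightarrow> real) measure" where
  "unit_cube d = PiM {..<d} (\<lambda>_. unit_interval)"

definition test_function :: "(real \<Rightarrow> real) \<Rightarrow> bool" where
  "test_function \<phi> \<longleftrightarrow>
     (\<forall>k x. (deriv ^^ k) \<phi> differentiable (at x)) \<and>
     (\<exists>a b. 0 < a \<and> b < 1 \<and> (\<forall>x. x \<notin> {a..b} \<longrightarrow> \<phi> x = 0))"

definition is_weak_deriv :: "nat \<Rightarrow> (real \<Rightarrow> complex) \<Rightarrow> (real \<Rightarrow> complex) \<Rightarrow> bool" where
  "is_weak_deriv l f g \<longleftrightarrow>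
     (\<forall>\<phi>. test_function \<phi> \<longrightarrow>
        (\<integral>x. f x * complex_of_real ((deriv ^^ l) \<phi> x) \<partial>unit_interval) =
        (-1) ^ l * (\<integral>x. g x * complex_of_real (\<phi> x) \<partial>unit_interval))"

definition weak_deriv :: "nat \<Rightarrow> (real \<Rightarrow> complex) \<Rightarrow> (real \<Rightarrow> complex)" where
  "weak_deriv l f = (SOME g. g \<in> hcarrier (L2 unit_interval) \<and> is_weak_deriv l f g)"

definition sobolev_fin :: "nat \<Rightarrow> real hspace" where
  "sobolev_fin s =
     \<lparr>hcarrier = {f \<in> hcarrier (L2 unit_interval).
                   \<forall>l\<in>{1..s}. \<exists>g\<in>hcarrier (L2 unit_interval). is_weak_deriv l f g},
      hinner = (\<lambda>f g. \<Sum>l\<le>s. hinner (L2 unit_interval) (weak_deriv l f) (weak_deriv l g))\<rparr>"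

text \<open>Classical derivatives on the closed interval, one-sided at the endpoints.\<close>

definition iterated_deriv :: "nat \<Rightarrow> (real \<Rightarrow> complex) \<Rightarrow> (real \<Rightarrow> complex)" where
  "iterated_deriv l f = ((\<lambda>h x. vector_derivative h (at x within {0..1})) ^^ l) f"

definition smooth_interval :: "(real \<Rightarrow> complex) \<Rightarrow> bool" where
  "smooth_interval f \<longleftrightarrow>
     (\<forall>l. \<forall>x\<in>{0..1}. iterated_deriv l f differentiable (at x within {0..1}))"

definition sobolev_inf :: "real hspace" where
  "sobolev_inf =
     \<lparr>hcarrier = {f. smooth_interval f \<and>
                   summable (\<lambda>l. (hnorm (L2 unit_interval) (iterated_deriv l f))\<^sup>2)},
      hinner = (\<lambda>f g. \<Sum>l. hinner (L2 unit_interval) (iterated_deriv l f) (iterated_deriv l g))\<rparr>"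

definition sobolev :: "enat \<Rightarrow> real hspace" where
  "sobolev s = (case s of enat k \<Rightarrow> sobolev_fin k | \<infinity> \<Rightarrow> sobolev_inf)"

text \<open>
  The Hilbert space tensor power of \<open>H\<close>, for \<open>d \<ge> 1\<close>. An element of the algebraic tensor power is
  written as a list of elementary tensors \<open>u 0 \<otimes> \<dots> \<otimes> u (d - 1)\<close>, standing for their sum (scalars
  are absorbed into a factor). The inner product is determined by
  \<open>\<langle>u 0 \<otimes> \<dots> \<otimes> u (d - 1), v 0 \<otimes> \<dots> \<otimes> v (d - 1)\<rangle> = \<Prod>i<d. \<langle>u i, v i\<rangle>\<close>.
\<close>

definition tensors :: "nat \<Rightarrow> real hspace \<Rightarrow> (nat \<Rightarrow> real \<Rightarrow> complex) list set" where
  "tensors d H = {R. \<forall>u\<in>set R. \<forall>i<d. u i \<in> hcarrier H}"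

definition tensor_fun :: "nat \<Rightarrow> (nat \<Rightarrow> real \<Rightarrow> complex) list \<Rightarrow> (nat \<Rightarrow> real) \<Rightarrow> complex" where
  "tensor_fun d R x = (\<Sum>u\<leftarrow>R. \<Prod>i<d. u i (x i))"

definition tensor_inner ::
    "nat \<Rightarrow> real hspace \<Rightarrow> (nat \<Rightarrow> real \<Rightarrow> complex) list \<Rightarrow>
     (nat \<Rightarrow> real \<Rightarrow> complex) list \<Rightarrow> complex" where
  "tensor_inner d H R S = (\<Sum>u\<leftarrow>R. \<Sum>v\<leftarrow>S. \<Prod>i<d. hinner H (u i) (v i))"

text \<open>The norm of \<open>R - S\<close>, expanded by sesquilinearity.\<close>

definition tensor_dist ::
    "nat \<Rightarrow> real hspace \<Rightarrow> (nat \<Rightarrow> real \<Rightarrow> complex) list \<Rightarrow>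
     (nat \<Rightarrow> real \<Rightarrow> complex) list \<Rightarrow> real" where
  "tensor_dist d H R S =
     sqrt (Re (tensor_inner d H R R - tensor_inner d H R S
               - tensor_inner d H S R + tensor_inner d H S S))"

text \<open>
  The completion is realized inside \<open>L2 (unit_cube d)\<close>: a Cauchy sequence of algebraic tensors is
  identified with the \<open>L2\<close> limit of the corresponding functions. As the embedding of \<open>H\<close> into
  \<open>L2 unit_interval\<close> is bounded and injective in all uses below, so is its tensor power; hence the
  limit exists, and the inner product does not depend on the chosen sequences.
\<close>

definition tensor_represents ::
    "nat \<Rightarrow> real hspace \<Rightarrow> (nat \<Rightarrow> (nat \<Rightarrow> real \<Rightarrow> complex) list) \<Rightarrow>
     ((nat \<Rightarrow> real) \<Rightarrow> complex) \<Rightarrow> bool" where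
  "tensor_represents d H R f \<longleftrightarrow>
     (\<forall>k. R k \<in> tensors d H) \<and>
     (\<forall>e>0. \<exists>N. \<forall>j\<ge>N. \<forall>k\<ge>N. tensor_dist d H (R j) (R k) < e) \<and>
     (\<lambda>k. hnorm (L2 (unit_cube d)) (\<lambda>x. tensor_fun d (R k) x - f x)) \<longlonglongrightarrow> 0"

definition tensor_rep ::
    "nat \<Rightarrow> real hspace \<Rightarrow> ((nat \<Rightarrow> real) \<Rightarrow> complex) \<Rightarrow>
     nat \<Rightarrow> (nat \<Rightarrow> real \<Rightarrow> complex) list" where
  "tensor_rep d H f = (SOME R. tensor_represents d H R f)"

definition tensor_power :: "nat \<Rightarrow> real hspace \<Rightarrow> (nat \<Rightarrow> real) hspace" where
  "tensor_power d H =
     \<lparr>hcarrier = {f \<in> hcarrier (L2 (unit_cube d)). \<exists>R. tensor_represents d H R f},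
      hinner = (\<lambda>f g. lim (\<lambda>k. tensor_inner d H (tensor_rep d H f k) (tensor_rep d H g k)))\<rparr>"

definition sobolev_mix :: "enat \<Rightarrow> nat \<Rightarrow> (nat \<Rightarrow> real) hspace" where
  "sobolev_mix s d = tensor_power d (sobolev s)"

end

theory Submission
  imports Defs "HOL-Real_Asymp.Real_Asymp"
begin

text \<open>
  The exact singular values are not needed. Let \<open>c n\<close> be the coefficients of \<open>f\<close> with respect to the
  orthonormal Legendre polynomials on \<open>[0, 1]\<close>. In one dimension the quadratic form
  \<open>|f|^2 + |f'|^2 + |f''|^2\<close> dominates a diagonal form \<open>\<Sum>n. w n * |c n|^2\<close> with \<open>w 0 = 1\<close>,
  \<open>w 1 = exp (2 * 1.2803)\<close> and \<open>w n\<close> growing like \<open>n^4\<close>. An inequality between positive semidefinite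
  kernels that are Gram kernels is preserved by taking products, so in \<open>d\<close> dimensions the norm square
  dominates the sum of \<open>(\<Prod>i<d. w (k i)) * |c k|^2\<close> over multi-indices \<open>k\<close>. Truncating the tensor
  Legendre expansion to the \<open>k\<close> with \<open>(\<Prod>i<d. w (k i)) < 1 / \<tau>^2\<close> thus gives an error at most \<open>\<tau>\<close>.
  With \<open>q = (2 + ln d) / (2 * 1.2803)\<close> we have \<open>w 1 powr - q = exp (- 2) / d\<close>, hence
  \<open>(\<Sum>n. w n powr - q) ^ d \<le> 2\<close>, and Markov's inequality bounds the number of these \<open>k\<close>.
\<close>

subsection \<open>Square integrable functions\<close>

text \<open>Only the gap between the weights at 0 and 1 has to be nearly sharp. For large d, the
  constants contribute 1 to the sum of powers in one coordinate and everything else together only a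
  multiple of 1 / d. So 2.5606 = 2 * 1.2803 is the logarithm of the second eigenvalue, rounded down,
  while crude weights serve from 2 on. The 2 in \<open>2 + ln d\<close> brings that multiple below
  2/3, and exp (2/3) \<le> 2 accounts for the 2 in \<open>2 / n\<close>. Weak derivatives are tested
  only against functions vanishing near the end points and carry no boundary data. Legendre
  polynomials suit this: with w = x * (1 - x), both the \<open>leg n\<close> and the products of w
  with their second derivatives are orthogonal families, and derivatives moved off multiples of w
  leave no boundary terms. The tensor norm is a limit along arbitrarily chosen sequences of lists,
  and the chosen weak derivatives are not linear. Therefore the inequality is proved for kernels
  evaluated on lists, and a sequence that is Cauchy for the tensor norm and null in L2 must be shown
  to be null in the tensor norm.\<close>

abbreviation l2 :: "'a measure \<Rightarrow> ('a \<Rightarrow> complex) set" where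
  "l2 M \<equiv> hcarrier (L2 M)"

abbreviation ip :: "'a measure \<Rightarrow> ('a \<Rightarrow> complex) \<Rightarrow> ('a \<Rightarrow> complex) \<Rightarrow> complex" where
  "ip M \<equiv> hinner (L2 M)"

abbreviation nrm :: "'a measure \<Rightarrow> ('a \<Rightarrow> complex) \<Rightarrow> real" where
  "nrm M \<equiv> hnorm (L2 M)"

lemma l2_iff: "f \<in> l2 M \<longleftrightarrow> f \<in> borel_measurable M \<and> integrable M (\<lambda>x. (cmod (f x))\<^sup>2)"
  by (simp add: L2_def)

lemma l2_measurable: "f \<in> l2 M \<Longrightarrow> f \<in> borel_measurable M"
  by (simp add: l2_iff)

lemma ip_def: "ip M f g = (\<integral>x. f x * cnj (g x) \<partial>M)"
  by (simp add: L2_def)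

lemma ip_self: "ip M f f = complex_of_real (\<integral>x. (cmod (f x))\<^sup>2 \<partial>M)"
  unfolding ip_def complex_norm_square[symmetric] by (rule integral_complex_of_real)

lemma nrm_square: "(nrm M f)\<^sup>2 = Re (ip M f f)"
  by (simp add: hnorm_def ip_self)

lemma nrm_square': "(nrm M f)\<^sup>2 = (\<integral>x. (cmod (f x))\<^sup>2 \<partial>M)"
  by (simp add: nrm_square ip_self)

lemma ip_self_nrm: "ip M f f = complex_of_real ((nrm M f)\<^sup>2)"
  by (simp add: nrm_square' ip_self)

lemma nrm_nonneg [simp]: "0 \<le> nrm M f"
  by (simp add: hnorm_def ip_self)

lemma l2_integrable_mult:
  assumes "f \<in> l2 M" "g \<in> l2 M"
  shows "integrable M (\<lambda>x. f x * g x)"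
proof (rule Bochner_Integration.integrable_bound)
  show "integrable M (\<lambda>x. (cmod (f x))\<^sup>2 + (cmod (g x))\<^sup>2)"
    using assms by (simp add: l2_iff)
  show "(\<lambda>x. f x * g x) \<in> borel_measurable M"
    using assms by (auto simp: l2_iff)
  have "cmod a * cmod b \<le> (cmod a)\<^sup>2 + (cmod b)\<^sup>2" for a b
    using sum_squares_bound[of "cmod a" "cmod b"] mult_nonneg_nonneg[OF norm_ge_zero norm_ge_zero, of a b]
    by linarith
  then show "AE x in M. norm (f x * g x) \<le> norm ((cmod (f x))\<^sup>2 + (cmod (g x))\<^sup>2)"
    by (simp add: norm_mult)
qed

lemma l2_cnj: "f \<in> l2 M \<Longrightarrow> (\<lambda>x. cnj (f x)) \<in> l2 M"
  using borel_measurable_continuous_onI[OF continuous_on_cnj[OF continuous_on_id]]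
  by (auto simp: l2_iff intro: measurable_compose)

lemma l2_integrable_ip:
  assumes "f \<in> l2 M" "g \<in> l2 M"
  shows "integrable M (\<lambda>x. f x * cnj (g x))"
  using assms by (intro l2_integrable_mult l2_cnj)

lemma l2_zero [simp]: "(\<lambda>x. 0) \<in> l2 M"
  by (simp add: l2_iff)

lemma l2_cmult: "f \<in> l2 M \<Longrightarrow> (\<lambda>x. a * f x) \<in> l2 M"
  by (auto simp: l2_iff norm_mult power_mult_distrib)

lemma l2_add:
  assumes "f \<in> l2 M" "g \<in> l2 M"
  shows "(\<lambda>x. f x + g x) \<in> l2 M"
proof -
  have "integrable M (\<lambda>x. (cmod (f x + g x))\<^sup>2)"
  proof (rule Bochner_Integration.integrable_bound)
    show "integrable M (\<lambda>x. 2 * (cmod (f x))\<^sup>2 + 2 * (cmod (g x))\<^sup>2)"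
      using assms by (simp add: l2_iff)
    show "(\<lambda>x. (cmod (f x + g x))\<^sup>2) \<in> borel_measurable M"
      using assms by (auto simp: l2_iff)
    have "(cmod (a + b))\<^sup>2 \<le> 2 * (cmod a)\<^sup>2 + 2 * (cmod b)\<^sup>2" for a b
    proof -
      have "(cmod (a + b))\<^sup>2 \<le> (cmod a + cmod b)\<^sup>2"
        by (intro power_mono norm_triangle_ineq) simp
      also have "\<dots> \<le> 2 * (cmod a)\<^sup>2 + 2 * (cmod b)\<^sup>2"
        using sum_squares_bound[of "cmod a" "cmod b"] by (simp add: power2_sum)
      finally show ?thesis .
    qed
    then show "AE x in M. norm ((cmod (f x + g x))\<^sup>2) \<le> norm (2 * (cmod (f x))\<^sup>2 + 2 * (cmod (g x))\<^sup>2)"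
      by simp
  qed
  then show ?thesis
    using assms by (auto simp: l2_iff)
qed

lemma l2_minus: "f \<in> l2 M \<Longrightarrow> g \<in> l2 M \<Longrightarrow> (\<lambda>x. f x - g x) \<in> l2 M"
  using l2_add[of f M "\<lambda>x. - 1 * g x"] l2_cmult[of g M "-1"] by simp

lemma l2_sum: "(\<And>i. i \<in> A \<Longrightarrow> f i \<in> l2 M) \<Longrightarrow> (\<lambda>x. \<Sum>i\<in>A. f i x) \<in> l2 M"
  by (induction A rule: infinite_finite_induct) (auto intro: l2_add)

lemma l2_lincomb: "(\<And>i. i \<in> A \<Longrightarrow> f i \<in> l2 M) \<Longrightarrow> (\<lambda>x. \<Sum>i\<in>A. a i * f i x) \<in> l2 M"
  by (intro l2_sum l2_cmult)

lemma ip_commute: "ip M f g = cnj (ip M g f)"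
  unfolding ip_def Bochner_Integration.integral_cnj[symmetric] by (simp add: mult.commute)

lemma ip_sum_left:
  assumes "\<And>i. i \<in> A \<Longrightarrow> f i \<in> l2 M" "g \<in> l2 M"
  shows "ip M (\<lambda>x. \<Sum>i\<in>A. a i * f i x) g = (\<Sum>i\<in>A. a i * ip M (f i) g)"
proof -
  have "ip M (\<lambda>x. \<Sum>i\<in>A. a i * f i x) g = (\<integral>x. (\<Sum>i\<in>A. a i * (f i x * cnj (g x))) \<partial>M)"
    by (simp add: ip_def sum_distrib_right mult.assoc)
  also have "\<dots> = (\<Sum>i\<in>A. a i * ip M (f i) g)"
    using assms by (subst Bochner_Integration.integral_sum) (auto simp: ip_def intro!: integrable_mult_right l2_integrable_ip)
  finally show ?thesis .
qed

lemma ip_sum_right: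
  assumes "\<And>i. i \<in> A \<Longrightarrow> f i \<in> l2 M" "g \<in> l2 M"
  shows "ip M g (\<lambda>x. \<Sum>i\<in>A. a i * f i x) = (\<Sum>i\<in>A. cnj (a i) * ip M g (f i))"
proof -
  have "ip M g (\<lambda>x. \<Sum>i\<in>A. a i * f i x) = cnj (ip M (\<lambda>x. \<Sum>i\<in>A. a i * f i x) g)"
    by (rule ip_commute)
  also have "\<dots> = (\<Sum>i\<in>A. cnj (a i) * cnj (ip M (f i) g))"
    using assms by (subst ip_sum_left) simp_all
  finally show ?thesis
    by (simp add: ip_commute[of M g, symmetric])
qed

lemma ip_sum_sum:
  assumes "\<And>i. i \<in> A \<Longrightarrow> f i \<in> l2 M" "\<And>j. j \<in> B \<Longrightarrow> g j \<in> l2 M"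
  shows "ip M (\<lambda>x. \<Sum>i\<in>A. a i * f i x) (\<lambda>x. \<Sum>j\<in>B. b j * g j x)
       = (\<Sum>i\<in>A. \<Sum>j\<in>B. a i * cnj (b j) * ip M (f i) (g j))"
  using assms
  by (simp add: ip_sum_left ip_sum_right l2_lincomb sum_distrib_left mult.assoc)

lemma ip_cmult_left: "ip M (\<lambda>x. a * f x) g = a * ip M f g"
  by (simp add: ip_def mult.assoc)

lemma ip_cmult_right: "ip M f (\<lambda>x. a * g x) = cnj a * ip M f g"
  by (simp add: ip_def mult.left_commute)

lemma ip_add_left:
  assumes "f \<in> l2 M" "g \<in> l2 M" "h \<in> l2 M"
  shows "ip M (\<lambda>x. f x + g x) h = ip M f h + ip M g h"
  using assms by (simp add: ip_def distrib_right l2_integrable_ip)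

lemma ip_minus_left:
  assumes "f \<in> l2 M" "g \<in> l2 M" "h \<in> l2 M"
  shows "ip M (\<lambda>x. f x - g x) h = ip M f h - ip M g h"
  using assms by (simp add: ip_def left_diff_distrib l2_integrable_ip)

lemma ip_add_right:
  assumes "f \<in> l2 M" "g \<in> l2 M" "h \<in> l2 M"
  shows "ip M h (\<lambda>x. f x + g x) = ip M h f + ip M h g"
  using assms by (simp add: ip_def distrib_left l2_integrable_ip)

lemma ip_minus_right:
  assumes "f \<in> l2 M" "g \<in> l2 M" "h \<in> l2 M"
  shows "ip M h (\<lambda>x. f x - g x) = ip M h f - ip M h g"
  using assms by (simp add: ip_def right_diff_distrib l2_integrable_ip)

text \<open>The pointwise inequality 2 |f g| \<le> s |f|^2 + |g|^2 / s is integrated for a free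
  parameter s > 0. The best s is the quotient of the norms; if one of the norms vanishes, s is
  pushed towards infinity or 0 instead.\<close>

lemma ip_le:
  assumes f: "f \<in> l2 M" and g: "g \<in> l2 M"
  shows "cmod (ip M f g) \<le> nrm M f * nrm M g"
proof -
  let ?A = "nrm M f" and ?B = "nrm M g"
  have key: "2 * cmod (ip M f g) \<le> s * ?A\<^sup>2 + ?B\<^sup>2 / s" if s: "s > 0" for s :: real
  proof -
    have "cmod (ip M f g) \<le> (\<integral>x. cmod (f x * cnj (g x)) \<partial>M)"
      unfolding ip_def by (rule integral_norm_bound)
    also have "2 * \<dots> = (\<integral>x. 2 * (cmod (f x) * cmod (g x)) \<partial>M)"
      by (simp add: norm_mult)
    also have "\<dots> \<le> (\<integral>x. s * (cmod (f x))\<^sup>2 + (cmod (g x))\<^sup>2 / s \<partial>M)"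
    proof (rule integral_mono)
      show "integrable M (\<lambda>x. 2 * (cmod (f x) * cmod (g x)))"
        using integrable_norm[OF l2_integrable_ip[OF f g]] by (simp add: norm_mult)
      show "integrable M (\<lambda>x. s * (cmod (f x))\<^sup>2 + (cmod (g x))\<^sup>2 / s)"
        using f g by (simp add: l2_iff)
      fix x
      have "0 \<le> (s * cmod (f x) - cmod (g x))\<^sup>2 / s"
        using s by simp
      also have "\<dots> = s * (cmod (f x))\<^sup>2 + (cmod (g x))\<^sup>2 / s - 2 * (cmod (f x) * cmod (g x))"
        using s by (simp add: power2_eq_square field_simps)
      finally show "2 * (cmod (f x) * cmod (g x)) \<le> s * (cmod (f x))\<^sup>2 + (cmod (g x))\<^sup>2 / s"
        by simp
    qed
    also have "\<dots> = s * ?A\<^sup>2 + ?B\<^sup>2 / s"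
      using f g by (simp add: l2_iff nrm_square')
    finally show ?thesis by simp
  qed
  show ?thesis
  proof (cases "?A = 0 \<or> ?B = 0")
    case True
    have "cmod (ip M f g) \<le> 0"
    proof (rule field_le_epsilon)
      fix e :: real assume e: "e > 0"
      show "cmod (ip M f g) \<le> 0 + e"
      proof (cases "?A = 0")
        case True
        have pos: "?B\<^sup>2 + 1 > 0"
          by (intro add_nonneg_pos) simp_all
        then have "2 * cmod (ip M f g) \<le> ?B\<^sup>2 / ((?B\<^sup>2 + 1) / e)"
          using key[of "(?B\<^sup>2 + 1) / e"] e True by (simp add: divide_pos_pos)
        also have "\<dots> \<le> e"
          using e pos by (simp add: pos_divide_le_eq field_simps)
        finally show ?thesis using e by simp
      next
        case False
        with \<open>?A = 0 \<or> ?B = 0\<close> have "?B = 0" by simp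
        have pos: "?A\<^sup>2 + 1 > 0"
          by (intro add_nonneg_pos) simp_all
        have "2 * cmod (ip M f g) \<le> (e / (?A\<^sup>2 + 1)) * ?A\<^sup>2"
          using key[of "e / (?A\<^sup>2 + 1)"] e \<open>?B = 0\<close> by (simp add: add_nonneg_pos)
        also have "\<dots> \<le> e"
          using e pos by (simp add: pos_divide_le_eq field_simps)
        finally show ?thesis using e by simp
      qed
    qed
    with True show ?thesis by auto
  next
    case False
    then have pos: "?A > 0" "?B > 0"
      by (simp_all add: less_le)
    then have "2 * cmod (ip M f g) \<le> ?B / ?A * ?A\<^sup>2 + ?B\<^sup>2 / (?B / ?A)"
      by (intro key) simp
    also have "\<dots> = 2 * (?A * ?B)"
      using pos by (simp add: power2_eq_square field_simps)
    finally show ?thesis by simp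
  qed
qed

lemma nrm_cmult: "nrm M (\<lambda>x. a * f x) = cmod a * nrm M f"
proof -
  have "(nrm M (\<lambda>x. a * f x))\<^sup>2 = (cmod a * nrm M f)\<^sup>2"
    by (simp add: nrm_square' norm_mult power_mult_distrib)
  then show ?thesis
    by (simp add: power2_eq_iff_nonneg)
qed

lemma nrm_zero [simp]: "nrm M (\<lambda>x. 0) = 0"
  by (simp add: hnorm_def ip_def)

lemma nrm_add_square:
  assumes "f \<in> l2 M" "g \<in> l2 M"
  shows "(nrm M (\<lambda>x. f x + g x))\<^sup>2 = (nrm M f)\<^sup>2 + 2 * Re (ip M f g) + (nrm M g)\<^sup>2"
  using assms ip_commute[of M g f] by (simp add: nrm_square ip_add_left ip_add_right l2_add)

lemma nrm_add:
  assumes f: "f \<in> l2 M" and g: "g \<in> l2 M"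
  shows "nrm M (\<lambda>x. f x + g x) \<le> nrm M f + nrm M g"
proof (rule power2_le_imp_le)
  have "Re (ip M f g) \<le> nrm M f * nrm M g"
    using complex_Re_le_cmod[of "ip M f g"] ip_le[OF f g] by simp
  then show "(nrm M (\<lambda>x. f x + g x))\<^sup>2 \<le> (nrm M f + nrm M g)\<^sup>2"
    by (simp add: nrm_add_square[OF f g] power2_sum)
qed simp

lemma nrm_minus_commute: "nrm M (\<lambda>x. f x - g x) = nrm M (\<lambda>x. g x - f x)"
  by (rule power2_eq_imp_eq) (simp_all add: nrm_square' norm_minus_commute)

lemma nrm_triangle:
  assumes "f \<in> l2 M" "g \<in> l2 M" "h \<in> l2 M"
  shows "nrm M (\<lambda>x. f x - h x) \<le> nrm M (\<lambda>x. f x - g x) + nrm M (\<lambda>x. g x - h x)"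
  using nrm_add[of "\<lambda>x. f x - g x" M "\<lambda>x. g x - h x"] assms by (simp add: l2_minus)

lemma nrm_minus_le:
  assumes "f \<in> l2 M" "g \<in> l2 M"
  shows "nrm M (\<lambda>x. f x - g x) \<le> nrm M f + nrm M g"
  using nrm_triangle[of f M "\<lambda>x. 0" g] nrm_minus_commute[of M g "\<lambda>x. 0"] assms by simp

lemma nrm_diff_le:
  assumes "f \<in> l2 M" "g \<in> l2 M"
  shows "\<bar>nrm M f - nrm M g\<bar> \<le> nrm M (\<lambda>x. f x - g x)"
proof -
  have "nrm M f \<le> nrm M (\<lambda>x. f x - g x) + nrm M g"
    using nrm_triangle[of f M g "\<lambda>x. 0"] assms by simp
  moreover have "nrm M g \<le> nrm M (\<lambda>x. f x - g x) + nrm M f"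
    using nrm_triangle[of g M f "\<lambda>x. 0"] assms by (simp add: nrm_minus_commute[of M g])
  ultimately show ?thesis by linarith
qed

lemma ip_sum_orthonormal:
  assumes fin: "finite A" and e: "\<And>i. i \<in> A \<Longrightarrow> e i \<in> l2 M"
    and on: "\<And>i j. i \<in> A \<Longrightarrow> j \<in> A \<Longrightarrow> ip M (e i) (e j) = (if i = j then 1 else 0)"
  shows "ip M (\<lambda>x. \<Sum>i\<in>A. a i * e i x) (\<lambda>x. \<Sum>i\<in>A. b i * e i x) = (\<Sum>i\<in>A. a i * cnj (b i))"
proof -
  have "ip M (\<lambda>x. \<Sum>i\<in>A. a i * e i x) (\<lambda>x. \<Sum>i\<in>A. b i * e i x)
      = (\<Sum>i\<in>A. \<Sum>j\<in>A. a i * cnj (b j) * (if i = j then 1 else 0))"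
    using e on by (simp add: ip_sum_sum cong: sum.cong)
  also have "\<dots> = (\<Sum>i\<in>A. a i * cnj (b i))"
    using fin by (simp add: if_distrib cong: if_cong sum.cong)
  finally show ?thesis .
qed

lemma ip_residual:
  assumes fin: "finite A" and e: "\<And>i. i \<in> A \<Longrightarrow> e i \<in> l2 M"
    and on: "\<And>i j. i \<in> A \<Longrightarrow> j \<in> A \<Longrightarrow> ip M (e i) (e j) = (if i = j then 1 else 0)"
    and f: "f \<in> l2 M" and g: "g \<in> l2 M"
  shows "ip M (\<lambda>x. f x - (\<Sum>i\<in>A. ip M f (e i) * e i x)) (\<lambda>x. g x - (\<Sum>i\<in>A. ip M g (e i) * e i x))
       = ip M f g - (\<Sum>i\<in>A. ip M f (e i) * cnj (ip M g (e i)))"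
proof -
  let ?P = "\<lambda>h x. \<Sum>i\<in>A. ip M h (e i) * e i x"
  have P: "?P h \<in> l2 M" for h
    using e by (rule l2_lincomb)
  have "ip M (\<lambda>x. f x - ?P f x) (\<lambda>x. g x - ?P g x)
      = ip M f g - ip M f (?P g) - (ip M (?P f) g - ip M (?P f) (?P g))"
    using f g P by (simp add: ip_minus_left ip_minus_right l2_minus)
  moreover have "ip M f (?P g) = (\<Sum>i\<in>A. ip M f (e i) * cnj (ip M g (e i)))"
    using e f by (subst ip_sum_right) (simp_all add: mult.commute)
  moreover have "ip M (?P f) g = (\<Sum>i\<in>A. ip M f (e i) * cnj (ip M g (e i)))"
    using e g by (subst ip_sum_left) (simp_all add: ip_commute[of M _ g])
  moreover have "ip M (?P f) (?P g) = (\<Sum>i\<in>A. ip M f (e i) * cnj (ip M g (e i)))"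
    using fin e on by (rule ip_sum_orthonormal)
  ultimately show ?thesis by simp
qed

lemma nrm_residual:
  assumes "finite A" "\<And>i. i \<in> A \<Longrightarrow> e i \<in> l2 M"
    and "\<And>i j. i \<in> A \<Longrightarrow> j \<in> A \<Longrightarrow> ip M (e i) (e j) = (if i = j then 1 else 0)"
    and "f \<in> l2 M"
  shows "(nrm M (\<lambda>x. f x - (\<Sum>i\<in>A. ip M f (e i) * e i x)))\<^sup>2
       = (nrm M f)\<^sup>2 - (\<Sum>i\<in>A. (cmod (ip M f (e i)))\<^sup>2)"
  using arg_cong[OF ip_residual[OF assms(1-3) assms(4) assms(4)], of Re]
  by (simp add: nrm_square flip: complex_norm_square)

lemma bessel:
  assumes "finite A" "\<And>i. i \<in> A \<Longrightarrow> e i \<in> l2 M"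
    and "\<And>i j. i \<in> A \<Longrightarrow> j \<in> A \<Longrightarrow> ip M (e i) (e j) = (if i = j then 1 else 0)"
    and "f \<in> l2 M"
  shows "(\<Sum>i\<in>A. (cmod (ip M f (e i)))\<^sup>2) \<le> (nrm M f)\<^sup>2"
  using nrm_residual[OF assms] zero_le_power2[of "nrm M (\<lambda>x. f x - (\<Sum>i\<in>A. ip M f (e i) * e i x))"]
  by linarith

lemma tendsto_ip:
  assumes F: "\<And>k. F k \<in> l2 M" and f: "f \<in> l2 M" and g: "g \<in> l2 M"
    and lim: "(\<lambda>k. nrm M (\<lambda>x. F k x - f x)) \<longlonglongrightarrow> 0"
  shows "(\<lambda>k. ip M (F k) g) \<longlonglongrightarrow> ip M f g"
proof (rule Lim_null[THEN iffD2], rule Lim_null_comparison)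
  show "\<forall>\<^sub>F k in sequentially. cmod (ip M (F k) g - ip M f g) \<le> nrm M (\<lambda>x. F k x - f x) * nrm M g"
    using F f g by (intro always_eventually) (simp add: ip_minus_left[symmetric] ip_le l2_minus)
  show "(\<lambda>k. nrm M (\<lambda>x. F k x - f x) * nrm M g) \<longlonglongrightarrow> 0"
    using tendsto_mult_right[OF lim, of "nrm M g"] by simp
qed

lemma tendsto_ip_right:
  assumes "\<And>k. F k \<in> l2 M" "f \<in> l2 M" "g \<in> l2 M"
    and "(\<lambda>k. nrm M (\<lambda>x. F k x - f x)) \<longlonglongrightarrow> 0"
  shows "(\<lambda>k. ip M g (F k)) \<longlonglongrightarrow> ip M g f"
  using tendsto_cnj[OF tendsto_ip[OF assms]] by (simp flip: ip_commute)

lemma tendsto_nrm: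
  assumes F: "\<And>k. F k \<in> l2 M" and f: "f \<in> l2 M"
    and lim: "(\<lambda>k. nrm M (\<lambda>x. F k x - f x)) \<longlonglongrightarrow> 0"
  shows "(\<lambda>k. nrm M (F k)) \<longlonglongrightarrow> nrm M f"
proof (rule Lim_null[THEN iffD2], rule Lim_null_comparison[OF _ lim])
  show "\<forall>\<^sub>F k in sequentially. norm (nrm M (F k) - nrm M f) \<le> nrm M (\<lambda>x. F k x - f x)"
    using F f by (intro always_eventually) (simp add: nrm_diff_le)
qed

lemma nrm_tendsto_0I:
  assumes F: "\<And>k. F k \<in> borel_measurable M" and f: "f \<in> borel_measurable M"
    and lim: "AE x in M. (\<lambda>k. F k x) \<longlonglongrightarrow> f x"
    and w: "integrable M (\<lambda>x. (w x)\<^sup>2)"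
    and bnd: "\<And>k. AE x in M. cmod (F k x - f x) \<le> w x"
  shows "(\<lambda>k. nrm M (\<lambda>x. F k x - f x)) \<longlonglongrightarrow> 0"
proof -
  have "(\<lambda>k. \<integral>x. (cmod (F k x - f x))\<^sup>2 \<partial>M) \<longlonglongrightarrow> (\<integral>x. 0 \<partial>M)"
  proof (rule integral_dominated_convergence[OF _ _ w])
    show "AE x in M. (\<lambda>k. (cmod (F k x - f x))\<^sup>2) \<longlonglongrightarrow> 0"
      using lim
    proof eventually_elim
      case (elim x)
      then show ?case
        by (intro tendsto_null_power tendsto_norm_zero LIM_zero) auto
    qed
    show "AE x in M. norm ((cmod (F k x - f x))\<^sup>2) \<le> (w x)\<^sup>2" for k
      using bnd[of k] by eventually_elim (auto intro: power_mono)
  qed (use F f in measurable)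
  then have "(\<lambda>k. sqrt ((nrm M (\<lambda>x. F k x - f x))\<^sup>2)) \<longlonglongrightarrow> sqrt 0"
    unfolding nrm_square' by (intro tendsto_real_sqrt) simp
  then show ?thesis by simp
qed

subsection \<open>Density in \<open>L2\<close> of the unit interval\<close>

abbreviation I01 :: "real measure" where "I01 \<equiv> unit_interval"

lemma space_I01 [simp]: "space I01 = {0..1}"
  by (simp add: unit_interval_def space_restrict_space)

lemma sets_I01: "A \<in> sets I01 \<longleftrightarrow> A \<in> sets borel \<and> A \<subseteq> {0..1}"
  by (auto simp: unit_interval_def sets_restrict_space_iff)

lemma measurable_I01: "f \<in> borel_measurable borel \<Longrightarrow> f \<in> borel_measurable I01"
  unfolding unit_interval_def by (rule measurable_restrict_space1) simp

lemma prob_space_I01: "emeasure I01 (space I01) = 1"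
  by (simp add: unit_interval_def space_restrict_space emeasure_restrict_space)

interpretation I01: finite_measure I01
  by standard (use prob_space_I01 in simp)

lemma measure_I01_UNIV [simp]: "measure I01 {0..1} = 1"
  using prob_space_I01 by (simp add: measure_def)

lemma integral_I01: "integral\<^sup>L I01 f = (\<integral>x. indicator {0..1} x *\<^sub>R f x \<partial>lborel)"
  for f :: "real \<Rightarrow> 'b::{banach, second_countable_topology}"
  unfolding unit_interval_def by (rule integral_restrict_space) simp

lemma borel_measurable_I01_continuous:
  fixes f :: "real \<Rightarrow> 'b::{second_countable_topology,real_normed_vector}"
  assumes "continuous_on {0..1} f"
  shows "f \<in> borel_measurable I01"
proof -
  have "sets I01 = sets (restrict_space borel {0..1})"
    by (simp add: unit_interval_def sets_restrict_space)
  then show ?thesis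
    using borel_measurable_continuous_on_restrict[OF assms] measurable_cong_sets by blast
qed

lemma integrable_I01_continuous:
  fixes f :: "real \<Rightarrow> 'b::{banach, second_countable_topology}"
  assumes "continuous_on {0..1} f"
  shows "integrable I01 f"
  using borel_integrable_atLeastAtMost'[OF assms]
  unfolding unit_interval_def by (simp add: integrable_restrict_space set_integrable_def)

lemma integral_I01_FTC:
  fixes f :: "real \<Rightarrow> 'b::euclidean_space"
  assumes "\<And>x. x \<in> {0..1} \<Longrightarrow> (F has_vector_derivative f x) (at x within {0..1})"
    and "continuous_on {0..1} f"
  shows "integral\<^sup>L I01 f = F 1 - F 0"
  unfolding integral_I01 using assms by (intro integral_FTC_atLeastAtMost) auto

lemma l2_I01_continuous:
  assumes "continuous_on {0..1} f"
  shows "f \<in> l2 I01"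
proof -
  have "continuous_on {0..1} (\<lambda>x. (cmod (f x))\<^sup>2)"
    using assms by (intro continuous_intros)
  with assms show ?thesis
    by (simp add: l2_iff borel_measurable_I01_continuous integrable_I01_continuous)
qed

lemma l2_I01_integrable:
  assumes "f \<in> l2 I01"
  shows "integrable I01 f"
  using l2_integrable_mult[OF assms l2_I01_continuous[of "\<lambda>x. 1"]] by simp

lemma l2_I01_bounded:
  assumes "f \<in> borel_measurable I01" "\<And>x. x \<in> {0..1} \<Longrightarrow> cmod (f x) \<le> B"
  shows "f \<in> l2 I01"
proof -
  have "integrable I01 (\<lambda>x. (cmod (f x))\<^sup>2)"
  proof (rule I01.integrable_const_bound)
    show "AE x in I01. norm ((cmod (f x))\<^sup>2) \<le> B\<^sup>2"
      using assms(2) by (intro AE_I2) (auto intro: power_mono)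
  qed (use assms in measurable)
  with assms show ?thesis by (simp add: l2_iff)
qed

section \<open>Polynomials and their integrals on the unit interval\<close>

definition pfun :: "real poly \<Rightarrow> real \<Rightarrow> complex" where
  "pfun p x = complex_of_real (poly p x)"

lemma cnj_pfun [simp]: "cnj (pfun p x) = pfun p x"
  by (simp add: pfun_def)

lemma continuous_pfun: "continuous_on A (pfun p)"
  unfolding pfun_def by (intro continuous_intros)

lemma pfun_l2 [simp]: "pfun p \<in> l2 I01"
  by (intro l2_I01_continuous continuous_pfun)

lemma pfun_mult: "pfun (p * q) x = pfun p x * pfun q x"
  by (simp add: pfun_def)

definition pint :: "real poly \<Rightarrow> real" where
  "pint p = (\<integral>x. poly p x \<partial>I01)"

lemma integrable_poly_I01: "integrable I01 (\<lambda>x. poly p x :: real)"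
  by (intro integrable_I01_continuous continuous_intros)

lemma pint_add: "pint (p + q) = pint p + pint q"
  by (simp add: pint_def integrable_poly_I01)

lemma pint_smult: "pint (smult a p) = a * pint p"
  by (simp add: pint_def)

lemma pint_0 [simp]: "pint 0 = 0"
  by (simp add: pint_def)

lemma pint_diff: "pint (p - q) = pint p - pint q"
  by (simp add: pint_def integrable_poly_I01)

lemma pint_pderiv: "pint (pderiv q) = poly q 1 - poly q 0"
  unfolding pint_def
proof (rule integral_I01_FTC[where F = "poly q"])
  show "((\<lambda>x. poly q x) has_vector_derivative poly (pderiv q) x) (at x within {0..1})" for x
    unfolding has_real_derivative_iff_has_vector_derivative[symmetric]
    by (rule has_field_derivative_at_within[OF poly_DERIV])
  show "continuous_on {0..1} (\<lambda>x. poly (pderiv q) x)"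
    by (rule continuous_on_poly[OF continuous_on_id])
qed

text \<open>For evaluating concrete integrals: the antiderivative is supplied as a witness and
  verified by formal differentiation.\<close>

lemma pint_pderiv_eq: "pderiv q = p \<Longrightarrow> pint p = poly q 1 - poly q 0"
  using pint_pderiv by blast

lemma pint_square_nonneg: "0 \<le> pint (p * p)"
  unfolding pint_def by (intro integral_nonneg_AE) auto

lemma pint_square_eq_0:
  assumes "pint (p * p) = 0"
  shows "p = 0"
proof -
  have cont: "continuous_on {0..1} (\<lambda>x. poly p x * poly p x)"
    by (intro continuous_on_mult continuous_on_poly continuous_on_id)
  have "pint (p * p) = integral {0..1} (\<lambda>x. poly p x * poly p x)"
    using set_borel_integral_eq_integral(2)[OF borel_integrable_atLeastAtMost'[OF cont]]
    by (simp add: pint_def integral_I01 set_lebesgue_integral_def)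
  then have "integral {0..1} (\<lambda>x. poly p x * poly p x) = 0"
    using assms by simp
  then have "\<forall>x\<in>{0..1}. poly p x * poly p x = 0"
    using integral_eq_0_iff[OF cont] by auto
  then have "{0..1} \<subseteq> {x. poly p x = 0}"
    by auto
  then have "infinite {x. poly p x = 0}"
    using infinite_Icc[OF zero_less_one] by (rule infinite_super)
  then show ?thesis
    using poly_roots_finite by blast
qed

lemma ip_pfun: "ip I01 (pfun p) (pfun q) = complex_of_real (pint (p * q))"
  by (simp add: ip_def pfun_def pint_def flip: of_real_mult)

section \<open>Subspaces and their closures for the L2 seminorm\<close>

definition l2_subspace :: "(real \<Rightarrow> complex) set \<Rightarrow> bool" where
  "l2_subspace S \<longleftrightarrow> S \<subseteq> l2 I01 \<and> (\<lambda>x. 0) \<in> S \<and>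
     (\<forall>f\<in>S. \<forall>g\<in>S. \<forall>a b. (\<lambda>x. a * f x + b * g x) \<in> S)"

definition l2_closure :: "(real \<Rightarrow> complex) set \<Rightarrow> (real \<Rightarrow> complex) set" where
  "l2_closure S = {f \<in> l2 I01. \<forall>e>0. \<exists>g\<in>S. nrm I01 (\<lambda>x. f x - g x) < e}"

lemma l2_closureI:
  assumes "f \<in> l2 I01" "\<And>e. e > 0 \<Longrightarrow> \<exists>g\<in>S. nrm I01 (\<lambda>x. f x - g x) < e"
  shows "f \<in> l2_closure S"
  using assms by (simp add: l2_closure_def)

lemma l2_closure_l2: "f \<in> l2_closure S \<Longrightarrow> f \<in> l2 I01"
  by (simp add: l2_closure_def)

lemma l2_subspace_l2: "l2_subspace S \<Longrightarrow> f \<in> S \<Longrightarrow> f \<in> l2 I01"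
  by (auto simp: l2_subspace_def)

lemma l2_subspace_lincomb:
  "l2_subspace S \<Longrightarrow> f \<in> S \<Longrightarrow> g \<in> S \<Longrightarrow> (\<lambda>x. a * f x + b * g x) \<in> S"
  by (simp add: l2_subspace_def)

lemma subset_l2_closure: "l2_subspace S \<Longrightarrow> f \<in> S \<Longrightarrow> f \<in> l2_closure S"
  by (intro l2_closureI) (auto simp: l2_subspace_def intro!: bexI[of _ f])

lemma l2_closure_approx:
  assumes S: "S \<subseteq> l2 I01" and f: "f \<in> l2 I01"
    and approx: "\<And>e. e > 0 \<Longrightarrow> \<exists>g\<in>l2_closure S. nrm I01 (\<lambda>x. f x - g x) < e"
  shows "f \<in> l2_closure S"
proof (rule l2_closureI[OF f])
  fix e :: real assume e: "e > 0"
  obtain g where g: "g \<in> l2_closure S" "nrm I01 (\<lambda>x. f x - g x) < e / 2"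
    using approx[of "e / 2"] e by auto
  obtain h where h: "h \<in> S" "nrm I01 (\<lambda>x. g x - h x) < e / 2"
    using g(1) e by (auto simp: l2_closure_def dest: spec[of _ "e / 2"])
  have "nrm I01 (\<lambda>x. f x - h x) \<le> nrm I01 (\<lambda>x. f x - g x) + nrm I01 (\<lambda>x. g x - h x)"
    using f g h S by (intro nrm_triangle) (auto dest: l2_closure_l2)
  with g h show "\<exists>g\<in>S. nrm I01 (\<lambda>x. f x - g x) < e"
    by (intro bexI[of _ h]) auto
qed

lemma l2_closure_limit:
  assumes S: "S \<subseteq> l2 I01" and F: "\<And>k::nat. F k \<in> l2_closure S" and f: "f \<in> l2 I01"
    and lim: "(\<lambda>k. nrm I01 (\<lambda>x. F k x - f x)) \<longlonglongrightarrow> 0"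
  shows "f \<in> l2_closure S"
proof (rule l2_closure_approx[OF S f])
  fix e :: real assume "e > 0"
  then have "\<forall>\<^sub>F k in sequentially. nrm I01 (\<lambda>x. F k x - f x) < e"
    using order_tendstoD(2)[OF lim] by blast
  then obtain k where "nrm I01 (\<lambda>x. F k x - f x) < e"
    by (auto simp: eventually_sequentially)
  then show "\<exists>g\<in>l2_closure S. nrm I01 (\<lambda>x. f x - g x) < e"
    using F by (auto simp: nrm_minus_commute[of I01 f])
qed

lemma l2_closure_lincomb:
  assumes S: "l2_subspace S" and f: "f \<in> l2_closure S" and g: "g \<in> l2_closure S"
  shows "(\<lambda>x. a * f x + b * g x) \<in> l2_closure S"
proof (rule l2_closureI)
  show l2: "(\<lambda>x. a * f x + b * g x) \<in> l2 I01"
    using f g by (intro l2_add l2_cmult l2_closure_l2)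
  fix e :: real assume e: "e > 0"
  define c where "c = cmod a + cmod b + 1"
  have c: "c > 0" "cmod a + cmod b < c"
    by (auto simp: c_def add_nonneg_pos)
  obtain u where u: "u \<in> S" "nrm I01 (\<lambda>x. f x - u x) < e / c"
    using f e c by (auto simp: l2_closure_def dest: spec[of _ "e / c"])
  obtain v where v: "v \<in> S" "nrm I01 (\<lambda>x. g x - v x) < e / c"
    using g e c by (auto simp: l2_closure_def dest: spec[of _ "e / c"])
  have uv: "u \<in> l2 I01" "v \<in> l2 I01" "f \<in> l2 I01" "g \<in> l2 I01"
    using u v f g S by (auto simp: l2_subspace_def dest: l2_closure_l2)
  have "nrm I01 (\<lambda>x. a * f x + b * g x - (a * u x + b * v x))
      = nrm I01 (\<lambda>x. a * (f x - u x) + b * (g x - v x))"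
    by (simp add: algebra_simps)
  also have "\<dots> \<le> cmod a * nrm I01 (\<lambda>x. f x - u x) + cmod b * nrm I01 (\<lambda>x. g x - v x)"
    using nrm_add[of "\<lambda>x. a * (f x - u x)" I01 "\<lambda>x. b * (g x - v x)"] uv
    by (simp add: nrm_cmult l2_cmult l2_minus)
  also have "\<dots> \<le> cmod a * (e / c) + cmod b * (e / c)"
    using u v by (intro add_mono mult_left_mono) auto
  also have "\<dots> = (cmod a + cmod b) * (e / c)"
    by (simp add: algebra_simps)
  also have "\<dots> < c * (e / c)"
    using c e by (intro mult_strict_right_mono) auto
  also have "\<dots> = e"
    using c by simp
  finally show "\<exists>g'\<in>S. nrm I01 (\<lambda>x. a * f x + b * g x - g' x) < e"
    using u v S by (intro bexI[of _ "\<lambda>x. a * u x + b * v x"]) (auto simp: l2_subspace_def)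
qed

lemma l2_subspace_closure:
  assumes "l2_subspace S"
  shows "l2_subspace (l2_closure S)"
  using assms subset_l2_closure[OF assms, of "\<lambda>x. 0"] l2_closure_lincomb[OF assms]
  unfolding l2_subspace_def[of "l2_closure S"]
  by (auto simp: l2_subspace_def dest: l2_closure_l2)

lemma l2_subspace_sum:
  assumes S: "l2_subspace S" and "\<And>i. i \<in> A \<Longrightarrow> f i \<in> S"
  shows "(\<lambda>x. \<Sum>i\<in>A. a i * f i x) \<in> S"
  using assms(2)
proof (induction A rule: infinite_finite_induct)
  case (insert i A)
  then have "f i \<in> S" "(\<lambda>x. \<Sum>i\<in>A. a i * f i x) \<in> S"
    by simp_all
  then have "(\<lambda>x. a i * f i x + 1 * (\<Sum>i\<in>A. a i * f i x)) \<in> S"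
    by (rule l2_subspace_lincomb[OF S])
  with insert show ?case by simp
qed (use S in \<open>simp_all add: l2_subspace_def\<close>)

text \<open>Functions live on the whole line, but \<open>I01\<close> sees only the unit interval.
  The simple functions in \<open>l2_closure_UNIV\<close> agree with their expansion into indicators
  only there.\<close>

lemma l2_closure_cong:
  assumes S: "S \<subseteq> l2 I01" and f: "f \<in> l2_closure S" and eq: "\<And>x. x \<in> {0..1} \<Longrightarrow> f x = g x"
  shows "g \<in> l2_closure S"
proof (rule l2_closure_limit[OF S, of "\<lambda>_. f"])
  have "g \<in> borel_measurable I01 \<longleftrightarrow> f \<in> borel_measurable I01"
    by (rule measurable_cong) (simp add: eq)
  moreover have "integrable I01 (\<lambda>x. (cmod (g x))\<^sup>2) \<longleftrightarrow> integrable I01 (\<lambda>x. (cmod (f x))\<^sup>2)"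
    by (rule Bochner_Integration.integrable_cong) (simp_all add: eq)
  ultimately show "g \<in> l2 I01"
    using l2_closure_l2[OF f] by (simp add: l2_iff)
  have "(\<integral>x. (cmod (f x - g x))\<^sup>2 \<partial>I01) = (\<integral>x. 0 \<partial>I01)"
    by (rule Bochner_Integration.integral_cong) (simp_all add: eq)
  then have "(nrm I01 (\<lambda>x. f x - g x))\<^sup>2 = 0"
    unfolding nrm_square' by simp
  then show "(\<lambda>k. nrm I01 (\<lambda>x. f x - g x)) \<longlonglongrightarrow> 0"
    by simp
qed (rule f)

lemma nrm_I01_le:
  assumes "f \<in> borel_measurable I01" "\<And>x. x \<in> {0..1} \<Longrightarrow> cmod (f x) \<le> B" "B \<ge> 0"
  shows "nrm I01 f \<le> B"
proof (rule power2_le_imp_le)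
  have "(\<integral>x. (cmod (f x))\<^sup>2 \<partial>I01) \<le> (\<integral>x. B\<^sup>2 \<partial>I01)"
    using l2_I01_bounded[OF assms(1,2)] assms(2)
    by (intro integral_mono) (auto simp: l2_iff intro: power_mono)
  then show "(nrm I01 f)\<^sup>2 \<le> B\<^sup>2"
    by (simp add: nrm_square')
qed fact

lemma l2_closure_bounded_limit:
  assumes S: "S \<subseteq> l2 I01" and F: "\<And>k::nat. F k \<in> l2_closure S"
    and f: "f \<in> borel_measurable I01"
    and lim: "\<And>x. x \<in> {0..1} \<Longrightarrow> (\<lambda>k. F k x) \<longlonglongrightarrow> f x"
    and bnd: "\<And>k x. x \<in> {0..1} \<Longrightarrow> cmod (F k x) \<le> B" "\<And>x. x \<in> {0..1} \<Longrightarrow> cmod (f x) \<le> B"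
  shows "f \<in> l2_closure S"
proof (rule l2_closure_limit[OF S F])
  show "f \<in> l2 I01"
    using f bnd(2) by (rule l2_I01_bounded)
  show "(\<lambda>k. nrm I01 (\<lambda>x. F k x - f x)) \<longlonglongrightarrow> 0"
  proof (rule nrm_tendsto_0I[where w = "\<lambda>_. B + B"])
    show "AE x in I01. cmod (F k x - f x) \<le> B + B" for k
    proof (rule AE_I2)
      fix x assume "x \<in> space I01"
      then show "cmod (F k x - f x) \<le> B + B"
        using bnd(1)[of x k] bnd(2)[of x] norm_triangle_ineq4[of "F k x" "f x"] by simp
    qed
  qed (use f F lim in \<open>auto intro!: AE_I2 l2_measurable dest: l2_closure_l2\<close>)
qed

section \<open>Density criterion: a closure that contains all monomials\<close>

context
  fixes S :: "(real \<Rightarrow> complex) set"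
  assumes S: "l2_subspace S" and mono: "\<And>n. pfun (monom 1 n) \<in> l2_closure S"
begin

private lemma S': "S \<subseteq> l2 I01"
  using S by (simp add: l2_subspace_def)

lemma l2_closure_pfun: "pfun p \<in> l2_closure S"
proof -
  have "(\<lambda>x. \<Sum>i\<le>degree p. complex_of_real (coeff p i) * pfun (monom 1 i) x) \<in> l2_closure S"
    by (rule l2_subspace_sum[OF l2_subspace_closure[OF S]]) (rule mono)
  then show ?thesis
    by (simp add: pfun_def[abs_def] poly_altdef[of p] poly_monom)
qed

lemma l2_closure_continuous:
  fixes g :: "real \<Rightarrow> real"
  assumes g: "continuous_on {0..1} g"
  shows "(\<lambda>x. complex_of_real (g x)) \<in> l2_closure S"
proof (rule l2_closure_approx[OF S'])
  show l2: "(\<lambda>x. complex_of_real (g x)) \<in> l2 I01"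
    using g by (intro l2_I01_continuous continuous_intros)
  fix e :: real assume e: "e > 0"
  obtain h where h: "real_polynomial_function h" "\<And>x. x \<in> {0..1} \<Longrightarrow> \<bar>g x - h x\<bar> < e / 2"
    using Stone_Weierstrass_real_polynomial_function[of "{0..1}" g "e / 2"] g e by auto
  obtain a n where an: "h = (\<lambda>x. \<Sum>i\<le>n. a i * x ^ i)"
    using h(1) real_polynomial_function_iff_sum by blast
  define p where "p = (\<Sum>i\<le>n. monom (a i) i)"
  have p: "poly p x = h x" for x
    by (simp add: p_def an poly_sum poly_monom)
  have "nrm I01 (\<lambda>x. complex_of_real (g x) - pfun p x) \<le> e / 2"
  proof (rule nrm_I01_le)
    show "(\<lambda>x. complex_of_real (g x) - pfun p x) \<in> borel_measurable I01"
      using l2 by (intro l2_measurable l2_minus) auto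
    show "cmod (complex_of_real (g x) - pfun p x) \<le> e / 2" if "x \<in> {0..1}" for x
      using h(2)[OF that] by (simp add: pfun_def p flip: of_real_diff)
  qed (use e in simp)
  then show "\<exists>u\<in>l2_closure S. nrm I01 (\<lambda>x. complex_of_real (g x) - u x) < e"
    using e by (intro bexI[OF _ l2_closure_pfun[of p]]) auto
qed

lemma l2_closure_indicator_atMost: "(\<lambda>x. indicator {..a} x) \<in> l2_closure S"
proof (rule l2_closure_bounded_limit[OF S', where B = 1])
  \<comment> \<open>Ramps that fall linearly from 1 at a to 0 at a + 1 / k; for k = 0 the ramp is
    constantly 1.\<close>
  let ?g = "\<lambda>k x. max 0 (min 1 (1 - real k * (x - a)))"
  show "(\<lambda>x. complex_of_real (?g k x)) \<in> l2_closure S" for k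
    by (intro l2_closure_continuous continuous_intros)
  show "(indicator {..a} :: real \<Rightarrow> complex) \<in> borel_measurable I01"
    by (intro measurable_I01) simp
  show "(\<lambda>k. complex_of_real (?g k x)) \<longlonglongrightarrow> indicator {..a} x" for x
  proof (cases "x \<le> a")
    case True
    then have "real k * (x - a) \<le> 0" for k
      by (simp add: mult_nonneg_nonpos)
    then have "?g k x = 1" for k
      by (simp add: max_def min_def)
    with True show ?thesis by simp
  next
    case False
    then obtain N where N: "1 / (x - a) \<le> real N"
      using real_arch_simple by blast
    have "?g k x = 0" if "k \<ge> N" for k
    proof -
      have "1 / (x - a) \<le> real k" using N that by linarith
      then have "1 \<le> real k * (x - a)"
        using False by (simp add: field_simps)
      then show ?thesis by simp
    qed
    then have "\<forall>\<^sub>F k in sequentially. complex_of_real (?g k x) = indicator {..a} x"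
      using False by (intro eventually_sequentiallyI[of N]) auto
    then show ?thesis by (rule tendsto_eventually)
  qed
qed (auto simp: indicator_def)

text \<open>Half-lines form an intersection-stable generator of the Borel sets, and the sets with
  indicator in the closure form a Dynkin system: complements use that the constant 1 is a
  polynomial, disjoint unions use bounded convergence.\<close>

lemma l2_closure_indicator_borel:
  assumes "A \<in> sets borel"
  shows "(\<lambda>x. indicator A x) \<in> l2_closure S"
proof -
  have A: "A \<in> sigma_sets UNIV (range (\<lambda>a::real. {..a}))"
    using assms by (subst (asm) borel_eq_atMost) simp
  have stable: "Int_stable (range (\<lambda>a::real. {..a}))"
    by (auto simp: Int_stable_def)
  have subset_Pow_UNIV: "range (\<lambda>a::real. {..a}) \<subseteq> Pow UNIV"
    by simp
  have borel: "B \<in> sets borel" if "B \<in> sigma_sets UNIV (range (\<lambda>a::real. {..a}))" for B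
    using that by (subst borel_eq_atMost) simp
  show ?thesis
    using stable subset_Pow_UNIV A
  proof (induction rule: sigma_sets_induct_disjoint)
    case (basic A)
    then show ?case by (auto intro: l2_closure_indicator_atMost)
  next
    case empty
    then show ?case
      using l2_subspace_closure[OF S] by (simp add: l2_subspace_def)
  next
    case (compl A)
    have "(\<lambda>x. 1 * pfun 1 x + (-1) * indicator A x) \<in> l2_closure S"
      by (intro l2_closure_lincomb[OF S] l2_closure_pfun compl)
    moreover have "1 * pfun 1 x + (-1) * indicator A x = indicator (UNIV - A) x" for x
      by (simp add: pfun_def indicator_def)
    ultimately show ?case
      by simp
  next
    case (union A)
    let ?F = "\<lambda>k x. \<Sum>i<k. 1 * indicator (A i) x :: complex"
    have eq: "?F k x = indicator (\<Union>i<k. A i) x" for k x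
      using union(1) by (subst indicator_UN_disjoint) (auto simp: disjoint_family_on_def)
    show ?case
    proof (rule l2_closure_bounded_limit[OF S', where B = 1])
      show "?F k \<in> l2_closure S" for k
        by (rule l2_subspace_sum[OF l2_subspace_closure[OF S]]) (rule union)
      have "(\<Union>i. A i) \<in> sets borel"
        using union(2) borel by (intro sets.countable_UN) auto
      then show "(indicator (\<Union>i. A i) :: real \<Rightarrow> complex) \<in> borel_measurable I01"
        by (intro measurable_I01) simp
      show "(\<lambda>k. ?F k x) \<longlonglongrightarrow> indicator (\<Union>i. A i) x" for x
        unfolding eq by (rule LIMSEQ_indicator_UN)
      show "cmod (?F k x) \<le> 1" for k x
        unfolding eq by (simp add: indicator_def)
    qed (auto simp: indicator_def)
  qed
qed

text \<open>The last rung of a ladder: monomials give polynomials, these give continuous functions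
  by Weierstrass, then indicators, simple functions and finally all of L2. It is applied to the span
  of the test functions and to the complex polynomials.\<close>

lemma l2_closure_UNIV:
  assumes f: "f \<in> l2 I01"
  shows "f \<in> l2_closure S"
proof -
  obtain F where F: "\<And>i. simple_function I01 (F i)"
      "\<And>x. x \<in> space I01 \<Longrightarrow> (\<lambda>i. F i x) \<longlonglongrightarrow> f x"
      "\<And>i x. x \<in> space I01 \<Longrightarrow> dist (F i x) 0 \<le> 2 * dist (f x) 0"
    using borel_measurable_implies_sequence_metric[OF l2_measurable[OF f], of 0] by blast
  have cl: "F i \<in> l2_closure S" for i
  proof -
    let ?Y = "F i ` space I01"
    let ?A = "\<lambda>y. F i -` {y} \<inter> space I01"
    have fin: "finite ?Y"
      using F(1)[of i] by (simp add: simple_function_def)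
    have "(\<lambda>x. \<Sum>y\<in>?Y. y * indicator (?A y) x) \<in> l2_closure S"
    proof (rule l2_subspace_sum[OF l2_subspace_closure[OF S]])
      fix y assume "y \<in> ?Y"
      then have "?A y \<in> sets I01"
        using F(1)[of i] by (auto simp: simple_function_def)
      then show "(\<lambda>x. indicator (?A y) x) \<in> l2_closure S"
        by (intro l2_closure_indicator_borel) (simp add: sets_I01)
    qed
    then show ?thesis
    proof (rule l2_closure_cong[OF S'])
      fix x :: real assume x: "x \<in> {0..1}"
      have "(\<Sum>y\<in>?Y. y * indicator (?A y) x) = (\<Sum>y\<in>?Y. if y = F i x then y else 0)"
        using x by (intro sum.cong) (auto simp: indicator_def)
      also have "\<dots> = F i x"
        using fin x by (subst sum.delta) auto
      finally show "(\<Sum>y\<in>?Y. y * indicator (?A y) x) = F i x" .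
    qed
  qed
  show ?thesis
  proof (rule l2_closure_limit[OF S' cl f])
    show "(\<lambda>k. nrm I01 (\<lambda>x. F k x - f x)) \<longlonglongrightarrow> 0"
    proof (rule nrm_tendsto_0I[where w = "\<lambda>x. 3 * cmod (f x)"])
      show "integrable I01 (\<lambda>x. (3 * cmod (f x))\<^sup>2)"
        using f by (simp add: l2_iff power_mult_distrib)
      show "AE x in I01. cmod (F k x - f x) \<le> 3 * cmod (f x)" for k
      proof (rule AE_I2)
        fix x assume "x \<in> space I01"
        then show "cmod (F k x - f x) \<le> 3 * cmod (f x)"
          using F(3)[of x k] norm_triangle_ineq4[of "F k x" "f x"] by simp
      qed
    qed (use f cl F(2) in \<open>auto intro!: AE_I2 l2_measurable dest: l2_closure_l2\<close>)
  qed
qed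

end

subsection \<open>Test functions\<close>

text \<open>
  Smooth cut-offs of polynomials, supported where the polynomial \<open>v\<close> is positive. Allowing a
  denominator \<open>v ^ m\<close> makes this class of functions closed under differentiation.
\<close>

definition bump :: "real poly \<Rightarrow> real \<Rightarrow> real poly \<Rightarrow> nat \<Rightarrow> real \<Rightarrow> real" where
  "bump v c P m x = (if poly v x > 0 then exp (- c / poly v x) * poly P x / poly v x ^ m else 0)"

text \<open>The quotient rule over the common denominator v ^ (m + 2): the exponential contributes c
  v' P / v^2 and the denominator contributes - m P v' / v.\<close>

definition bump_step :: "real poly \<Rightarrow> real \<Rightarrow> real poly \<Rightarrow> nat \<Rightarrow> real poly" where
  "bump_step v c P m = smult c (pderiv v * P) + pderiv P * v ^ 2 - smult (real m) (P * pderiv v * v)"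

text \<open>The exponential beats every power of 1 / t near 0. The explicit constant comes from (1 +
  x / k) ^ k \<le> exp x with k = n + 1 and x = c / t.\<close>

lemma exp_minus_le:
  assumes "c > 0" "t > (0::real)"
  shows "exp (- c / t) \<le> (real (Suc n) / c) ^ Suc n * t ^ Suc n"
proof -
  have "(c / t / real (Suc n)) ^ Suc n \<le> (1 + c / t / real (Suc n)) ^ Suc n"
    using assms by (intro power_mono) auto
  also have "\<dots> \<le> exp (c / t)"
    using assms by (intro exp_ge_one_plus_x_over_n_power_n) (auto intro: order_trans[of _ 0])
  finally have "exp (- c / t) \<le> inverse ((c / t / real (Suc n)) ^ Suc n)"
    using assms by (simp only: minus_divide_left[symmetric] exp_minus)
      (intro le_imp_inverse_le zero_less_power, auto)
  also have "\<dots> = (real (Suc n) / c) ^ Suc n * t ^ Suc n"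
    by (simp only: power_inverse[symmetric] power_mult_distrib[symmetric]) (simp add: field_simps)
  finally show ?thesis .
qed

lemma DERIV_bump:
  assumes c: "c > 0"
  shows "DERIV (bump v c P m) x :> bump v c (bump_step v c P m) (m + 2) x"
proof (cases "poly v x > 0")
  case True
  let ?f = "\<lambda>x. exp (- c / poly v x) * poly P x / poly v x ^ m"
  have nz: "poly v x \<noteq> 0" using True by simp
  have 1: "DERIV (\<lambda>x. exp (- c / poly v x)) x :> exp (- c / poly v x) * (c * poly (pderiv v) x / poly v x ^ 2)"
    using nz by (auto intro!: derivative_eq_intros simp: power2_eq_square)
  have 2: "DERIV (\<lambda>x. poly v x ^ m) x :> real m * poly v x ^ (m - 1) * poly (pderiv v) x"
    by (auto intro!: derivative_eq_intros)
  have 3: "DERIV ?f x :> ((exp (- c / poly v x) * (c * poly (pderiv v) x / poly v x ^ 2) * poly P x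
      + poly (pderiv P) x * exp (- c / poly v x)) * poly v x ^ m
      - exp (- c / poly v x) * poly P x * (real m * poly v x ^ (m - 1) * poly (pderiv v) x))
      / (poly v x ^ m * poly v x ^ m)"
    using nz by (intro DERIV_divide DERIV_mult 1 2 poly_DERIV) simp
  have "real m * poly v x ^ (m - 1) = real m * poly v x ^ m / poly v x"
    using nz by (cases m) simp_all
  then have eq: "real m * poly v x ^ (m - 1) = real m * poly v x ^ m / poly v x"
    by simp
  have "((exp (- c / poly v x) * (c * poly (pderiv v) x / poly v x ^ 2) * poly P x
      + poly (pderiv P) x * exp (- c / poly v x)) * poly v x ^ m
      - exp (- c / poly v x) * poly P x * (real m * poly v x ^ (m - 1) * poly (pderiv v) x))
      / (poly v x ^ m * poly v x ^ m) = bump v c (bump_step v c P m) (m + 2) x"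
    unfolding eq using True
    by (simp add: bump_def bump_step_def divide_simps power2_eq_square) (simp add: algebra_simps)
  with 3 have "DERIV ?f x :> bump v c (bump_step v c P m) (m + 2) x"
    by simp
  moreover have "eventually (\<lambda>y. poly v y > 0) (nhds x)"
    using True by (intro order_tendstoD(1)[of _ "poly v x"] isCont_tendsto_compose[of x "poly v"])
      (auto intro: filterlim_ident)
  then have "eventually (\<lambda>y. bump v c P m y = ?f y) (nhds x)"
    by eventually_elim (simp add: bump_def)
  ultimately show ?thesis
    by (subst DERIV_cong_ev[OF refl _ refl])
next
  case False
  \<comment> \<open>Taking the power m + 2 in \<open>exp_minus_le\<close> leaves two factors v y
    after division by v y ^ m. As v x \<le> 0 < v y, each is at most |v y - v x|, so the difference
    quotient at x is of order |y - x|.\<close>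
  define C where "C = (real (Suc (m + 1)) / c) ^ Suc (m + 1)"
  have bound: "\<bar>bump v c P m y\<bar> \<le> C * \<bar>poly P y\<bar> * \<bar>poly v y - poly v x\<bar> ^ 2" for y
  proof (cases "poly v y > 0")
    case True
    have "\<bar>bump v c P m y\<bar> = exp (- c / poly v y) / poly v y ^ m * \<bar>poly P y\<bar>"
      using True by (simp add: bump_def abs_mult)
    also have "\<dots> \<le> C * poly v y ^ Suc (m + 1) / poly v y ^ m * \<bar>poly P y\<bar>"
      unfolding C_def using True c by (intro mult_right_mono divide_right_mono exp_minus_le) auto
    also have "\<dots> = C * \<bar>poly P y\<bar> * poly v y ^ 2"
      using True by (simp add: power2_eq_square)
    also have "\<dots> \<le> C * \<bar>poly P y\<bar> * \<bar>poly v y - poly v x\<bar> ^ 2"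
      using True False c unfolding C_def by (intro mult_left_mono power_mono) auto
    finally show ?thesis .
  qed (use c in \<open>simp add: bump_def C_def\<close>)
  have "((\<lambda>y. (bump v c P m y - bump v c P m x) / (y - x)) \<longlongrightarrow> 0) (at x)"
  proof (rule Lim_null_comparison)
    show "\<forall>\<^sub>F y in at x. norm ((bump v c P m y - bump v c P m x) / (y - x))
        \<le> C * \<bar>poly P y\<bar> * \<bar>poly v y - poly v x\<bar> * \<bar>(poly v y - poly v x) / (y - x)\<bar>"
      unfolding eventually_at_filter
    proof (intro always_eventually allI impI)
      fix y assume "y \<noteq> x"
      have "norm ((bump v c P m y - bump v c P m x) / (y - x)) = \<bar>bump v c P m y\<bar> / \<bar>y - x\<bar>"
        using False by (simp add: bump_def)
      also have "\<dots> \<le> C * \<bar>poly P y\<bar> * \<bar>poly v y - poly v x\<bar> ^ 2 / \<bar>y - x\<bar>"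
        by (intro divide_right_mono bound) simp
      also have "\<dots> = C * \<bar>poly P y\<bar> * \<bar>poly v y - poly v x\<bar> * \<bar>(poly v y - poly v x) / (y - x)\<bar>"
        by (simp only: power2_eq_square abs_divide) simp
      finally show "norm ((bump v c P m y - bump v c P m x) / (y - x))
          \<le> C * \<bar>poly P y\<bar> * \<bar>poly v y - poly v x\<bar> * \<bar>(poly v y - poly v x) / (y - x)\<bar>"
        .
    qed
    have "((\<lambda>y. C * \<bar>poly P y\<bar> * \<bar>poly v y - poly v x\<bar> * \<bar>(poly v y - poly v x) / (y - x)\<bar>)
        \<longlongrightarrow> C * \<bar>poly P x\<bar> * \<bar>poly v x - poly v x\<bar> * \<bar>poly (pderiv v) x\<bar>) (at x)"
      using poly_DERIV[of v x] unfolding has_field_derivative_iff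
      by (intro tendsto_intros) (auto simp: isCont_def[symmetric])
    then show "((\<lambda>y. C * \<bar>poly P y\<bar> * \<bar>poly v y - poly v x\<bar> * \<bar>(poly v y - poly v x) / (y - x)\<bar>)
        \<longlongrightarrow> 0) (at x)"
      by simp
  qed
  then show ?thesis
    using False by (simp add: has_field_derivative_iff bump_def)
qed

lemma deriv_bump: "c > 0 \<Longrightarrow> deriv (bump v c P m) = bump v c (bump_step v c P m) (m + 2)"
  using DERIV_imp_deriv[OF DERIV_bump] by blast

lemma higher_deriv_bump: "c > 0 \<Longrightarrow> \<exists>Q j. (deriv ^^ k) (bump v c P m) = bump v c Q j"
proof (induction k)
  case (Suc k)
  then obtain Q j where "(deriv ^^ k) (bump v c P m) = bump v c Q j"
    by blast
  then have "(deriv ^^ Suc k) (bump v c P m) = bump v c (bump_step v c Q j) (j + 2)"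
    using Suc.prems by (simp add: deriv_bump)
  then show ?case by blast
qed auto

text \<open>For d \<le> 1/2 it is positive exactly strictly between d and 1 - d. The limit case
  \<open>cut 0\<close> is w = x * (1 - x), which vanishes at both end points.\<close>

definition cut :: "real \<Rightarrow> real poly" where
  "cut d = [:- d * (1 - d), 1, -1:]"

lemma poly_cut: "poly (cut d) x = (x - d) * (1 - d - x)"
  by (simp add: cut_def algebra_simps)

lemma poly_cut_pos:
  assumes "d \<le> 1 / 2" "poly (cut d) x > 0"
  shows "d < x" "x < 1 - d"
  using assms by (auto simp: poly_cut zero_less_mult_iff)

lemma test_function_bump:
  assumes "c > 0" "0 < d" "d \<le> 1 / 2"
  shows "test_function (bump (cut d) c P m)"
proof -
  have "(deriv ^^ k) (bump (cut d) c P m) differentiable at x" for k x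
  proof -
    obtain Q j where "(deriv ^^ k) (bump (cut d) c P m) = bump (cut d) c Q j"
      using higher_deriv_bump[OF assms(1)] by blast
    then show ?thesis
      using DERIV_bump[OF assms(1)] real_differentiable_def by metis
  qed
  moreover have "bump (cut d) c P m x = 0" if "x \<notin> {d..1 - d}" for x
    using that poly_cut_pos[OF assms(3), of x] by (fastforce simp: bump_def)
  moreover have "0 < d" "1 - d < 1"
    using assms by simp_all
  ultimately show ?thesis
    unfolding test_function_def by blast
qed

lemma test_function_continuous: "test_function \<phi> \<Longrightarrow> continuous_on A ((deriv ^^ k) \<phi>)"
  unfolding test_function_def
  by (intro differentiable_imp_continuous_on)
     (auto simp: differentiable_on_def intro: differentiable_at_withinI)

lemma test_function_DERIV: "test_function \<phi> \<Longrightarrow> DERIV ((deriv ^^ k) \<phi>) x :> (deriv ^^ Suc k) \<phi> x"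
  unfolding test_function_def by (auto simp: DERIV_deriv_iff_real_differentiable)

lemma test_function_deriv:
  assumes tf: "test_function \<phi>"
  shows "test_function (deriv \<phi>)"
proof -
  obtain a b where ab: "0 < a" "b < 1" "\<And>x. x \<notin> {a..b} \<Longrightarrow> \<phi> x = 0"
    using tf unfolding test_function_def by blast
  have "deriv \<phi> x = 0" if "x \<notin> {a..b}" for x
  proof -
    have "eventually (\<lambda>y. y \<in> - {a..b}) (nhds x)"
      using that by (intro eventually_nhds_in_open) auto
    then have "eventually (\<lambda>y. \<phi> y = 0) (nhds x)"
      by eventually_elim (use ab(3) in auto)
    then have "deriv \<phi> x = deriv (\<lambda>_. 0) x"
      by (intro deriv_cong_ev) auto
    then show ?thesis by simp
  qed
  moreover have "(deriv ^^ k) (deriv \<phi>) differentiable at x" for k x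
  proof -
    have "(deriv ^^ Suc k) \<phi> differentiable at x"
      using tf unfolding test_function_def by blast
    then show ?thesis
      by (simp add: funpow_Suc_right del: funpow.simps)
  qed
  ultimately show ?thesis
    using ab(1,2) unfolding test_function_def by blast
qed

definition rfun :: "(real \<Rightarrow> real) \<Rightarrow> real \<Rightarrow> complex" where
  "rfun \<phi> x = complex_of_real (\<phi> x)"

lemma ip_rfun: "ip I01 f (rfun \<phi>) = (\<integral>x. f x * complex_of_real (\<phi> x) \<partial>I01)"
  by (simp add: ip_def rfun_def)

lemma rfun_test_l2: "test_function \<phi> \<Longrightarrow> rfun ((deriv ^^ k) \<phi>) \<in> l2 I01"
  unfolding rfun_def by (intro l2_I01_continuous continuous_intros test_function_continuous)

lemma is_weak_deriv_iff:
  "is_weak_deriv l f g \<longleftrightarrow>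
     (\<forall>\<phi>. test_function \<phi> \<longrightarrow> ip I01 f (rfun ((deriv ^^ l) \<phi>)) = (-1) ^ l * ip I01 g (rfun \<phi>))"
  by (simp add: is_weak_deriv_def ip_rfun)

lemma AE_I01_interior: "AE x in I01. 0 < x \<and> x < 1"
proof -
  have "AE x in I01. x \<noteq> a" for a :: real
    unfolding unit_interval_def
    using AE_lborel_singleton[of a] by (subst AE_restrict_space_iff) auto
  from this[of 0] this[of 1] AE_space[of I01] show ?thesis
    by eventually_elim auto
qed

section \<open>Approximation of polynomials by test functions\<close>

definition eta :: "nat \<Rightarrow> real poly" where
  "eta k = cut (1 / real (k + 2))"

text \<open>The constant in the exponent tends to 0, so the cut-off factor tends to 1 at every
  interior point while the support exhausts the interval. The denominator k + 2 in
  \<open>eta\<close> keeps the cut position at most 1/2 even for k = 0.\<close>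

definition approx_test :: "nat \<Rightarrow> real poly \<Rightarrow> real \<Rightarrow> real" where
  "approx_test k P = bump (eta k) (1 / real (k + 1)) P 0"

lemma test_function_approx: "test_function (approx_test k P)"
  unfolding approx_test_def eta_def by (intro test_function_bump) auto

lemma tendsto_eta: "(\<lambda>k. poly (eta k) x) \<longlonglongrightarrow> poly (cut 0) x"
proof -
  have "(\<lambda>k. 1 / real (k + 2)) \<longlonglongrightarrow> 0"
    by real_asymp
  then have "(\<lambda>k. (x - 1 / real (k + 2)) * (1 - 1 / real (k + 2) - x)) \<longlonglongrightarrow> (x - 0) * (1 - 0 - x)"
    by (intro tendsto_intros)
  then show ?thesis
    by (simp add: eta_def poly_cut)
qed

lemma poly_cut_le: "x \<in> {0..1} \<Longrightarrow> 0 \<le> d \<Longrightarrow> d \<le> 1/2 \<Longrightarrow> \<bar>poly (cut d) x\<bar> \<le> 1"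
proof -
  assume *: "x \<in> {0..1}" "0 \<le> d" "d \<le> 1/2"
  then have "\<bar>x - d\<bar> * \<bar>1 - d - x\<bar> \<le> 1 * 1"
    by (intro mult_mono) auto
  then show ?thesis by (simp add: poly_cut abs_mult)
qed

lemma eventually_eta:
  assumes "0 < x" "x < 1"
  shows "\<forall>\<^sub>F k in sequentially. poly (eta k) x > 0"
  using assms by (intro order_tendstoD(1)[OF tendsto_eta]) (simp add: poly_cut)

lemma tendsto_exp_eta:
  assumes "0 < x" "x < 1"
  shows "(\<lambda>k. exp (- (1 / real (k + 1)) / poly (eta k) x)) \<longlonglongrightarrow> 1"
    and "(\<lambda>k. (1 / real (k + 1)) / poly (eta k) x) \<longlonglongrightarrow> 0"
proof -
  have 0: "(\<lambda>k. 1 / real (k + 1)) \<longlonglongrightarrow> 0"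
    by real_asymp
  have "poly (cut 0) x \<noteq> 0"
    using assms by (simp add: poly_cut)
  then show 1: "(\<lambda>k. (1 / real (k + 1)) / poly (eta k) x) \<longlonglongrightarrow> 0"
    using tendsto_divide[OF 0 tendsto_eta[of x]] by simp
  show "(\<lambda>k. exp (- (1 / real (k + 1)) / poly (eta k) x)) \<longlonglongrightarrow> 1"
    using tendsto_exp[OF tendsto_minus[OF 1]] by simp
qed

lemma poly_bounded: "\<exists>B. \<forall>x\<in>{0..1}. \<bar>poly q (x::real)\<bar> \<le> B"
proof -
  have "bounded (poly q ` {0..1})"
    by (intro compact_imp_bounded compact_continuous_image continuous_intros) auto
  then show ?thesis
    by (auto simp: bounded_iff)
qed

lemma approx_test_seq_tendsto:
  assumes lim: "\<And>x. (\<lambda>k. poly (Q k) x) \<longlonglongrightarrow> poly q x"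
    and bnd: "\<And>k x. x \<in> {0..1} \<Longrightarrow> \<bar>poly (Q k) x\<bar> \<le> B"
  shows "(\<lambda>k. nrm I01 (\<lambda>x. rfun (approx_test k (Q k)) x - pfun q x)) \<longlonglongrightarrow> 0"
proof (rule nrm_tendsto_0I[where w = "\<lambda>_. B + B"])
  show "rfun (approx_test k (Q k)) \<in> borel_measurable I01" for k
    using rfun_test_l2[OF test_function_approx, of 0] by (auto intro: l2_measurable)
  show "AE x in I01. (\<lambda>k. rfun (approx_test k (Q k)) x) \<longlonglongrightarrow> pfun q x"
    using AE_I01_interior
  proof eventually_elim
    case (elim x)
    have "(\<lambda>k. exp (- (1 / real (k + 1)) / poly (eta k) x) * poly (Q k) x) \<longlonglongrightarrow> 1 * poly q x"
      using elim by (intro tendsto_mult tendsto_exp_eta lim) auto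
    moreover have "\<forall>\<^sub>F k in sequentially.
        exp (- (1 / real (k + 1)) / poly (eta k) x) * poly (Q k) x = approx_test k (Q k) x"
      using eventually_eta[OF elim[THEN conjunct1] elim[THEN conjunct2]]
      by eventually_elim (simp add: approx_test_def bump_def)
    ultimately have "(\<lambda>k. approx_test k (Q k) x) \<longlonglongrightarrow> 1 * poly q x"
      by (rule Lim_transform_eventually)
    then show ?case
      unfolding rfun_def pfun_def by (intro tendsto_of_real) simp
  qed
  show "AE x in I01. cmod (rfun (approx_test k (Q k)) x - pfun q x) \<le> B + B" for k
  proof (rule AE_I2)
    fix x assume "x \<in> space I01"
    then have x: "x \<in> {0..1}" by simp
    have "\<bar>poly q x\<bar> \<le> B"
      by (rule LIMSEQ_le_const2[OF tendsto_rabs[OF lim]]) (use bnd[OF x] in auto)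
    moreover have "\<bar>approx_test k (Q k) x\<bar> \<le> B"
      using bnd[OF x, of k]
        mult_mono[of "exp (- (1 / real (k + 1)) / poly (eta k) x)" 1 "\<bar>poly (Q k) x\<bar>" B]
      by (auto simp: approx_test_def bump_def abs_mult)
    ultimately show "cmod (rfun (approx_test k (Q k)) x - pfun q x) \<le> B + B"
      by (simp add: rfun_def pfun_def flip: of_real_diff)
  qed
qed (auto intro: l2_measurable)

lemma approx_test_tendsto:
  "(\<lambda>k. nrm I01 (\<lambda>x. rfun (approx_test k q) x - pfun q x)) \<longlonglongrightarrow> 0"
proof -
  obtain B where "\<And>x. x \<in> {0..1} \<Longrightarrow> \<bar>poly q x\<bar> \<le> B"
    using poly_bounded by blast
  then show ?thesis
    by (intro approx_test_seq_tendsto) auto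
qed

lemma approx_test_mult_tendsto:
  "(\<lambda>k. nrm I01 (\<lambda>x. rfun (approx_test k (eta k * q)) x - pfun (cut 0 * q) x)) \<longlonglongrightarrow> 0"
proof -
  obtain B where B: "\<And>x. x \<in> {0..1} \<Longrightarrow> \<bar>poly q x\<bar> \<le> B"
    using poly_bounded by blast
  have "\<bar>poly (eta k * q) x\<bar> \<le> 1 * B" if "x \<in> {0..1}" for k x
    unfolding poly_mult abs_mult eta_def using that B[OF that] by (intro mult_mono poly_cut_le) auto
  then show ?thesis
    by (intro approx_test_seq_tendsto) (auto intro: tendsto_mult tendsto_eta)
qed

lemma deriv_bump_mult:
  assumes "c > 0"
  shows "deriv (bump v c (v * q) 0) x = (if poly v x > 0 then exp (- c / poly v x) *
      (c / poly v x * (poly (pderiv v) x * poly q x) + poly (pderiv (v * q)) x) else 0)"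
  by (simp add: deriv_bump[OF assms] bump_def bump_step_def power2_eq_square field_simps)

lemma approx_test_deriv:
  "deriv (approx_test k (eta k * q)) x =
     (if poly (eta k) x > 0 then exp (- (1 / real (k + 1)) / poly (eta k) x) *
        ((1 / real (k + 1)) / poly (eta k) x * (poly (pderiv (eta k)) x * poly q x)
          + poly (pderiv (eta k * q)) x) else 0)"
  unfolding approx_test_def by (rule deriv_bump_mult) simp

lemma pderiv_cut: "pderiv (cut d) = [:1, -2:]"
  by (simp add: cut_def pderiv_pCons)

text \<open>Functions that are limits of test functions together with their derivatives vanish at
  the end points; hence the multiples of \<open>cut 0\<close>. Differentiating the exponential
  brings in 1 / \<open>eta k\<close> twice: one copy is cancelled by the factor
  \<open>eta k\<close>, the other is controlled by the exponential.\<close>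

lemma approx_test_deriv_tendsto:
  "(\<lambda>k. nrm I01 (\<lambda>x. rfun (deriv (approx_test k (eta k * q))) x - pfun (pderiv (cut 0 * q)) x)) \<longlonglongrightarrow> 0"
proof -
  obtain B where B: "\<And>x. x \<in> {0..1} \<Longrightarrow> \<bar>poly q x\<bar> \<le> B"
    using poly_bounded by blast
  obtain B' where B': "\<And>x. x \<in> {0..1} \<Longrightarrow> \<bar>poly (pderiv q) x\<bar> \<le> B'"
    using poly_bounded by blast
  have B0: "B \<ge> 0" "B' \<ge> 0"
    using B[of 0] B'[of 0] by auto
  have bnd: "\<bar>poly (pderiv (cut d * q)) x\<bar> \<le> B + B'" if "x \<in> {0..1}" "0 \<le> d" "d \<le> 1 / 2" for x d
  proof -
    have "\<bar>1 - 2 * x\<bar> * \<bar>poly q x\<bar> \<le> 1 * B" "\<bar>poly (cut d) x\<bar> * \<bar>poly (pderiv q) x\<bar> \<le> 1 * B'"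
      using that B[of x] B'[of x] poly_cut_le[of x d] by (intro mult_mono; force)+
    then show ?thesis
      using abs_triangle_ineq[of "poly (cut d) x * poly (pderiv q) x" "(1 - 2 * x) * poly q x"]
      by (simp add: pderiv_mult pderiv_cut abs_mult del: abs_triangle_ineq) (simp add: algebra_simps)
  qed
  show ?thesis
  proof (rule nrm_tendsto_0I[where w = "\<lambda>_. (B + (B + B')) + (B + B')"])
    show "rfun (deriv (approx_test k (eta k * q))) \<in> borel_measurable I01" for k
      using rfun_test_l2[OF test_function_approx, of 1] by (auto intro: l2_measurable)
    show "AE x in I01. (\<lambda>k. rfun (deriv (approx_test k (eta k * q))) x) \<longlonglongrightarrow> pfun (pderiv (cut 0 * q)) x"
      using AE_I01_interior
    proof eventually_elim
      case (elim x)
      have pd: "poly (pderiv (eta k)) x = 1 - 2 * x" for k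
        by (simp add: eta_def pderiv_cut)
      let ?E = "\<lambda>k. exp (- (1 / real (k + 1)) / poly (eta k) x) *
          ((1 / real (k + 1)) / poly (eta k) x * ((1 - 2 * x) * poly q x)
            + (poly (eta k) x * poly (pderiv q) x + poly q x * (1 - 2 * x)))"
      have "?E \<longlonglongrightarrow> 1 * (0 * ((1 - 2 * x) * poly q x)
            + (poly (cut 0) x * poly (pderiv q) x + poly q x * (1 - 2 * x)))"
        using elim by (intro tendsto_mult tendsto_add tendsto_const tendsto_exp_eta tendsto_eta) auto
      moreover have "\<forall>\<^sub>F k in sequentially. ?E k = deriv (approx_test k (eta k * q)) x"
        using eventually_eta[OF elim[THEN conjunct1] elim[THEN conjunct2]]
        by eventually_elim (simp add: approx_test_deriv pd pderiv_mult)
      ultimately have "(\<lambda>k. deriv (approx_test k (eta k * q)) x) \<longlonglongrightarrow> 1 * (0 * ((1 - 2 * x) * poly q x)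
            + (poly (cut 0) x * poly (pderiv q) x + poly q x * (1 - 2 * x)))"
        by (rule Lim_transform_eventually)
      then have "(\<lambda>k. deriv (approx_test k (eta k * q)) x) \<longlonglongrightarrow> poly (pderiv (cut 0 * q)) x"
        by (simp add: pderiv_mult pderiv_cut algebra_simps)
      then show ?case
        unfolding rfun_def pfun_def by (rule tendsto_of_real)
    qed
    show "AE x in I01. cmod (rfun (deriv (approx_test k (eta k * q))) x - pfun (pderiv (cut 0 * q)) x)
        \<le> (B + (B + B')) + (B + B')" for k
    proof (rule AE_I2)
      fix x assume "x \<in> space I01"
      then have x: "x \<in> {0..1}" by simp
      have "\<bar>deriv (approx_test k (eta k * q)) x\<bar> \<le> B + (B + B')"
      proof (cases "poly (eta k) x > 0")
        case True
        \<comment> \<open>For z > 0 both exp (- z) and z * exp (- z) are at most 1, which yields a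
          majorant independent of k.\<close>
        define z where "z = (1 / real (k + 1)) / poly (eta k) x"
        have z: "z > 0" using True by (simp add: z_def)
        have "z \<le> exp z"
          using exp_ge_add_one_self[of z] by linarith
        then have ez: "exp (- z) \<le> 1" "z * exp (- z) \<le> 1"
          using z by (auto simp: exp_minus field_simps)
        have d: "deriv (approx_test k (eta k * q)) x
          = z * exp (- z) * ((1 - 2 * x) * poly q x) + exp (- z) * poly (pderiv (eta k * q)) x"
          using True unfolding approx_test_deriv z_def by (simp add: eta_def pderiv_cut algebra_simps)
        have "\<bar>(1 - 2 * x) * poly q x\<bar> \<le> 1 * B"
          unfolding abs_mult using x B[of x] by (intro mult_mono) auto
        then have "\<bar>z * exp (- z) * ((1 - 2 * x) * poly q x)\<bar> \<le> 1 * B"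
          unfolding abs_mult[of "z * exp (- z)"] using ez z by (intro mult_mono) auto
        moreover have "\<bar>poly (pderiv (eta k * q)) x\<bar> \<le> B + B'"
          unfolding eta_def using x by (intro bnd) auto
        then have "\<bar>exp (- z) * poly (pderiv (eta k * q)) x\<bar> \<le> 1 * (B + B')"
          unfolding abs_mult using ez by (intro mult_mono) auto
        ultimately show ?thesis
          unfolding d using abs_triangle_ineq by (smt (verit))
      qed (use B0 in \<open>simp add: approx_test_deriv\<close>)
      moreover have "\<bar>poly (pderiv (cut 0 * q)) x\<bar> \<le> B + B'"
        using x by (intro bnd) auto
      ultimately show "cmod (rfun (deriv (approx_test k (eta k * q))) x - pfun (pderiv (cut 0 * q)) x)
          \<le> (B + (B + B')) + (B + B')"
        by (simp add: rfun_def pfun_def flip: of_real_diff)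
    qed
  qed (auto intro: l2_measurable)
qed

text \<open>Test functions are real valued, so their complex span is generated explicitly. The two
  rules are the cases of the multilinearity argument in \<open>dfun_weakly_null\<close>.\<close>

inductive_set test_span :: "(real \<Rightarrow> complex) set" where
  base: "test_function \<phi> \<Longrightarrow> rfun \<phi> \<in> test_span"
| lincomb: "f \<in> test_span \<Longrightarrow> g \<in> test_span \<Longrightarrow> (\<lambda>x. a * f x + b * g x) \<in> test_span"

lemma l2_subspace_test_span: "l2_subspace test_span"
proof -
  have "f \<in> l2 I01" if "f \<in> test_span" for f
    using that by induction (use rfun_test_l2[of _ 0] in \<open>auto intro: l2_add l2_cmult\<close>)
  moreover have "(\<lambda>x. 0 * rfun (approx_test 0 0) x + 0 * rfun (approx_test 0 0) x) \<in> test_span"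
    by (intro test_span.intros test_function_approx)
  ultimately show ?thesis
    by (auto simp: l2_subspace_def intro: test_span.lincomb)
qed

lemma test_span_dense: "f \<in> l2 I01 \<Longrightarrow> f \<in> l2_closure test_span"
proof (rule l2_closure_UNIV[OF l2_subspace_test_span])
  show "pfun (monom 1 n) \<in> l2_closure test_span" for n
    by (rule l2_closure_limit[OF _ _ _ approx_test_tendsto])
       (use l2_subspace_test_span in \<open>auto simp: l2_subspace_def
          intro!: subset_l2_closure l2_subspace_test_span test_span.base test_function_approx\<close>)
qed

text \<open>Needed because the chosen weak derivative of order 0 is some function with the same
  action on test functions as f, not f itself. Polynomials are L2 limits of test functions.\<close>

lemma ip_pfun_eqI:
  assumes f: "f \<in> l2 I01" and g: "g \<in> l2 I01"
    and eq: "\<And>\<phi>. test_function \<phi> \<Longrightarrow> ip I01 f (rfun \<phi>) = ip I01 g (rfun \<phi>)"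
  shows "ip I01 f (pfun q) = ip I01 g (pfun q)"
proof -
  have l2: "rfun (approx_test k q) \<in> l2 I01" for k
    using rfun_test_l2[OF test_function_approx, of 0] by simp
  have "(\<lambda>k. ip I01 h (rfun (approx_test k q))) \<longlonglongrightarrow> ip I01 h (pfun q)" if "h \<in> l2 I01" for h
    by (rule tendsto_ip_right[OF l2 pfun_l2 that approx_test_tendsto])
  from this[OF f] this[OF g] have "(\<lambda>k. ip I01 f (rfun (approx_test k q))) \<longlonglongrightarrow> ip I01 f (pfun q)"
       "(\<lambda>k. ip I01 g (rfun (approx_test k q))) \<longlonglongrightarrow> ip I01 g (pfun q)" .
  then show ?thesis
    using eq[OF test_function_approx] by (auto intro: LIMSEQ_unique)
qed

text \<open>Integration by parts against a polynomial that vanishes at both end points. Such a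
  polynomial is approximated by test functions together with its derivative, so the weak identity
  passes to the limit.\<close>

lemma weak_deriv_pfun:
  assumes f: "f \<in> l2 I01" and g: "g \<in> l2 I01"
    and weak: "\<And>\<phi>. test_function \<phi> \<Longrightarrow> ip I01 f (rfun (deriv \<phi>)) = - ip I01 g (rfun \<phi>)"
  shows "ip I01 g (pfun (cut 0 * q)) = - ip I01 f (pfun (pderiv (cut 0 * q)))"
proof -
  let ?\<phi> = "\<lambda>k. approx_test k (eta k * q)"
  have l2: "rfun (?\<phi> k) \<in> l2 I01" "rfun (deriv (?\<phi> k)) \<in> l2 I01" for k
    using rfun_test_l2[OF test_function_approx, of 0] rfun_test_l2[OF test_function_approx, of 1] by simp_all
  have 1: "(\<lambda>k. ip I01 g (rfun (?\<phi> k))) \<longlonglongrightarrow> ip I01 g (pfun (cut 0 * q))"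
    by (rule tendsto_ip_right[OF l2(1) pfun_l2 g approx_test_mult_tendsto])
  have "(\<lambda>k. ip I01 f (rfun (deriv (?\<phi> k)))) \<longlonglongrightarrow> ip I01 f (pfun (pderiv (cut 0 * q)))"
    by (rule tendsto_ip_right[OF l2(2) pfun_l2 f approx_test_deriv_tendsto])
  then have "(\<lambda>k. - ip I01 g (rfun (?\<phi> k))) \<longlonglongrightarrow> ip I01 f (pfun (pderiv (cut 0 * q)))"
    using weak[OF test_function_approx] by simp
  from LIMSEQ_unique[OF this tendsto_minus[OF 1]] show ?thesis
    by simp
qed

subsection \<open>Legendre polynomials and the one-dimensional inequality\<close>

text \<open>Gram-Schmidt applied to the monomials. Only degree and orthonormality characterise these
  polynomials up to sign, and nothing else about them enters later.\<close>

fun leg :: "nat \<Rightarrow> real poly" where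
  "leg n = (let p = monom 1 n - (\<Sum>j<n. smult (pint (monom 1 n * leg j)) (leg j))
            in smult (1 / sqrt (pint (p * p))) p)"

declare leg.simps [simp del]

lemma pint_sum: "pint (\<Sum>i\<in>A. f i) = (\<Sum>i\<in>A. pint (f i))"
  by (induction A rule: infinite_finite_induct) (auto simp: pint_add)

lemma leg_induct_step:
  assumes "\<And>j. j < n \<Longrightarrow> degree (leg j) = j"
    and "\<And>i j. i < n \<Longrightarrow> j < n \<Longrightarrow> pint (leg i * leg j) = (if i = j then 1 else 0)"
  shows "degree (leg n) = n" "pint (leg n * leg n) = 1"
    and "\<And>j. j < n \<Longrightarrow> pint (leg n * leg j) = 0"
proof -
  define p where "p = monom 1 n - (\<Sum>j<n. smult (pint (monom 1 n * leg j)) (leg j))"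
  have leg: "leg n = smult (1 / sqrt (pint (p * p))) p"
    by (subst leg.simps) (simp add: p_def Let_def)
  have "coeff (leg j) n = 0" if "j < n" for j
    using assms(1)[OF that] that by (simp add: coeff_eq_0)
  \<comment> \<open>The leading coefficient 1 excludes p = 0, so p can be normalised.\<close>
  then have coeff: "coeff p n = 1"
    by (simp add: p_def coeff_sum)
  have "degree p \<le> n"
    unfolding p_def using assms(1)
    by (intro degree_diff_le degree_monom_le degree_sum_le) (auto intro: order_trans[OF degree_smult_le])
  with coeff have deg: "degree p = n"
    using le_degree[of p n] by simp
  have "p \<noteq> 0"
    using coeff by auto
  then have pos: "pint (p * p) > 0"
    using pint_square_nonneg[of p] pint_square_eq_0[of p] by (auto simp: less_le)
  then show "degree (leg n) = n"
    by (simp add: leg deg)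
  have "pint (leg n * leg n) = pint (p * p) / (sqrt (pint (p * p)) * sqrt (pint (p * p)))"
    by (simp add: leg pint_smult)
  then show "pint (leg n * leg n) = 1"
    using pos by simp
  fix j assume j: "j < n"
  have "pint (p * leg j) = pint (monom 1 n * leg j)
      - (\<Sum>i<n. pint (monom 1 n * leg i) * pint (leg i * leg j))"
    by (simp add: p_def left_diff_distrib sum_distrib_right pint_diff pint_sum pint_smult)
  also have "(\<Sum>i<n. pint (monom 1 n * leg i) * pint (leg i * leg j))
      = (\<Sum>i<n. if i = j then pint (monom 1 n * leg i) else 0)"
    using j assms(2) by (intro sum.cong) auto
  finally have "pint (p * leg j) = 0"
    using j by simp
  then show "pint (leg n * leg j) = 0"
    by (simp add: leg pint_smult)
qed

lemma leg_aux:
  "(\<forall>j<n. degree (leg j) = j) \<and> (\<forall>i<n. \<forall>j<n. pint (leg i * leg j) = (if i = j then 1 else 0))"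
proof (induction n)
  case (Suc n)
  then have IH: "\<And>j. j < n \<Longrightarrow> degree (leg j) = j"
    "\<And>i j. i < n \<Longrightarrow> j < n \<Longrightarrow> pint (leg i * leg j) = (if i = j then 1 else 0)"
    by auto
  have step: "degree (leg n) = n" "pint (leg n * leg n) = 1" "\<And>j. j < n \<Longrightarrow> pint (leg n * leg j) = 0"
    using leg_induct_step[of n] IH by blast+
  have "pint (leg i * leg j) = (if i = j then 1 else 0)" if "i < Suc n" "j < Suc n" for i j
  proof -
    consider "i < n" "j < n" | "i = n" "j = n" | "i = n" "j < n" | "i < n" "j = n"
      using \<open>i < Suc n\<close> \<open>j < Suc n\<close> unfolding less_Suc_eq by blast
    then show ?thesis
    proof cases
      case 4
      then show ?thesis
        using step(3)[of i] arg_cong[where f = pint, OF mult.commute[of "leg i" "leg n"]] by simp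
    qed (use IH step in simp_all)
  qed
  moreover have "degree (leg j) = j" if "j < Suc n" for j
    using that IH step(1) by (cases "j = n") simp_all
  ultimately show ?case
    by blast
qed simp

lemma degree_leg: "degree (leg n) = n"
  using leg_aux[of "Suc n"] by simp

lemma leg_orthonormal: "pint (leg i * leg j) = (if i = j then 1 else 0)"
  using leg_aux[of "Suc (max i j)"] by simp

lemma leg_nz: "leg n \<noteq> 0"
  using leg_orthonormal[of n n] by auto

lemma leg_expand:
  assumes "degree q \<le> m"
  shows "q = (\<Sum>j\<le>m. smult (pint (q * leg j)) (leg j))"
proof -
  have "\<exists>a. q = (\<Sum>j\<le>m. smult (a j) (leg j))" if "degree q \<le> m" for q m
    using that
  proof (induction m arbitrary: q)
    case 0
    then obtain b where q: "q = [:b:]"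
      by (auto elim: degree_eq_zeroE)
    obtain c where c: "leg 0 = [:c:]"
      using degree_leg[of 0] by (auto elim: degree_eq_zeroE)
    then have "c \<noteq> 0"
      using leg_nz[of 0] by auto
    then show ?case
      by (intro exI[of _ "\<lambda>_. b / c"]) (simp add: q c)
  next
    case (Suc m)
    define b where "b = coeff q (Suc m) / coeff (leg (Suc m)) (Suc m)"
    have "coeff (leg (Suc m)) (Suc m) \<noteq> 0"
      using leg_nz[of "Suc m"] degree_leg[of "Suc m"] by (metis leading_coeff_0_iff)
    then have "coeff (q - smult b (leg (Suc m))) (Suc m) = 0"
      by (simp add: b_def)
    moreover have "degree (q - smult b (leg (Suc m))) \<le> Suc m"
      using Suc.prems degree_smult_le[of b "leg (Suc m)"] by (intro degree_diff_le) (simp_all add: degree_leg)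
    ultimately have "degree (q - smult b (leg (Suc m))) \<le> m"
      by (intro degree_le allI impI) (metis Suc_lessI coeff_eq_0 le_less_trans)
    from Suc.IH[OF this] obtain a where "q - smult b (leg (Suc m)) = (\<Sum>j\<le>m. smult (a j) (leg j))"
      by blast
    then have "q = (\<Sum>j\<le>Suc m. smult ((a(Suc m := b)) j) (leg j))"
      by (simp add: algebra_simps)
    then show ?case by blast
  qed
  then obtain a where a: "q = (\<Sum>j\<le>m. smult (a j) (leg j))"
    using assms by blast
  have "pint (q * leg j) = a j" if "j \<le> m" for j
  proof -
    have "pint (q * leg j) = (\<Sum>i\<le>m. a i * pint (leg i * leg j))"
      by (simp add: a sum_distrib_right pint_sum pint_smult)
    also have "\<dots> = (\<Sum>i\<le>m. if i = j then a i else 0)"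
      by (intro sum.cong) (auto simp: leg_orthonormal)
    finally show ?thesis
      using that by simp
  qed
  then have "(\<Sum>j\<le>m. smult (a j) (leg j)) = (\<Sum>j\<le>m. smult (pint (q * leg j)) (leg j))"
    by (intro sum.cong) auto
  then show ?thesis
    using a by simp
qed

text \<open>
  The Legendre polynomials are eigenfunctions of this fourth order operator: it is symmetric and does
  not increase the degree.
\<close>

definition legop :: "real poly \<Rightarrow> real poly" where
  "legop p = pderiv (pderiv (cut 0 ^ 2 * pderiv (pderiv p)))"

text \<open>The leading coefficient of \<open>legop\<close> on x ^ n: two derivatives give n (n -
  1), multiplication by the leading term x^4 raises the degree to n + 2, and two more derivatives
  give (n + 2) (n + 1). It vanishes at 0 and 1, as affine functions are annihilated.\<close>

definition legeig :: "nat \<Rightarrow> real" where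
  "legeig n = (real n - 1) * real n * (real n + 1) * (real n + 2)"

lemma cut0_square: "cut 0 ^ 2 = monom 1 4 - monom 2 3 + monom 1 (2::nat)"
  by (simp add: cut_def power2_eq_square monom_altdef numeral_eq_Suc)

lemma coeff_legop:
  assumes "degree p \<le> n"
  shows "coeff (legop p) n = legeig n * coeff p n"
proof -
  have z: "coeff p k = 0" if "k > n" for k
    using assms that by (intro coeff_eq_0) simp
  show ?thesis
  proof (cases "n \<ge> 2")
    case True
    then obtain m where m: "n = m + 2"
      using le_Suc_ex by (metis add.commute)
    define r where "r = pderiv (pderiv p)"
    have r: "coeff (cut 0 ^ 2 * r) (n + 2) = coeff r m - 2 * coeff r (m + 1) + coeff r (m + 2)"
      by (simp add: cut0_square distrib_right left_diff_distrib coeff_monom_mult m)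
    have "coeff (legop p) n = real (n + 1) * (real (n + 2) * coeff (cut 0 ^ 2 * r) (n + 2))"
      by (simp add: legop_def coeff_pderiv r_def)
    then show ?thesis
      unfolding r unfolding r_def using z[of "n + 1"] z[of "n + 2"] by (simp add: legeig_def coeff_pderiv m algebra_simps)
  next
    case False
    then consider "n = 0" | "n = 1" by linarith
    then show ?thesis
    proof cases
      case 1
      have "coeff (cut 0 ^ 2 * r) (Suc (Suc 0)) = coeff r 0" for r
        by (simp add: cut0_square distrib_right left_diff_distrib coeff_monom_mult)
      then show ?thesis
        using 1 z[of "Suc (Suc 0)"] by (simp add: legop_def legeig_def coeff_pderiv)
    next
      case 2
      have "coeff (cut 0 ^ 2 * r) (Suc (Suc (Suc 0))) = coeff r (Suc 0) - 2 * coeff r 0" for r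
        by (simp add: cut0_square distrib_right left_diff_distrib coeff_monom_mult)
      then show ?thesis
        using 2 z[of "Suc (Suc 0)"] z[of "Suc (Suc (Suc 0))"]
        by (simp add: legop_def legeig_def coeff_pderiv)
    qed
  qed
qed

lemma degree_legop_le: "degree (legop p) \<le> degree p"
proof (rule degree_le, intro allI impI)
  fix i assume "degree p < i"
  then show "coeff (legop p) i = 0"
    using coeff_legop[of p i] by (simp add: coeff_eq_0)
qed

text \<open>Two integrations by parts; the boundary terms vanish by the double zeros of
  \<open>cut 0 ^ 2\<close> at 0 and 1. The right-hand side is symmetric in p and q, and with p = q
  it is a weighted norm of the second derivative.\<close>

lemma pint_legop: "pint (legop p * q) = pint (cut 0 ^ 2 * pderiv (pderiv p) * pderiv (pderiv q))"
proof -
  let ?u = "cut 0 ^ 2 * pderiv (pderiv p)"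
  have "pint (pderiv (pderiv ?u) * q) - pint (?u * pderiv (pderiv q))
      = pint (pderiv (pderiv ?u * q - ?u * pderiv q))"
    by (simp only: pint_diff[symmetric] pderiv_diff pderiv_mult[of _ q] pderiv_mult[of ?u "pderiv q"])
       (simp add: algebra_simps)
  also have "\<dots> = 0"
    unfolding pint_pderiv by (simp add: pderiv_mult poly_cut power2_eq_square)
  finally show ?thesis
    by (simp add: legop_def)
qed

text \<open>By symmetry the component of \<open>legop (leg n)\<close> along \<open>leg j\<close>
  with j < n is that of \<open>legop (leg j)\<close> along \<open>leg n\<close>, which vanishes for
  reasons of degree. Comparing leading coefficients gives the eigenvalue.\<close>

lemma legop_leg: "legop (leg n) = smult (legeig n) (leg n)"
proof -
  have "pint (legop (leg n) * leg j) = 0" if "j < n" for j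
  proof -
    have "pint (legop (leg n) * leg j) = pint (legop (leg j) * leg n)"
      unfolding pint_legop by (simp add: mult_ac)
    also have "legop (leg j) = (\<Sum>i\<le>j. smult (pint (legop (leg j) * leg i)) (leg i))"
      using degree_legop_le[of "leg j"] by (intro leg_expand) (simp add: degree_leg)
    also have "pint (\<dots> * leg n) = (\<Sum>i\<le>j. pint (legop (leg j) * leg i) * pint (leg i * leg n))"
      by (simp add: sum_distrib_right pint_sum pint_smult)
    also have "\<dots> = 0"
      using that by (intro sum.neutral) (auto simp: leg_orthonormal)
    finally show ?thesis .
  qed
  moreover have "legop (leg n) = (\<Sum>j\<le>n. smult (pint (legop (leg n) * leg j)) (leg j))"
    using degree_legop_le[of "leg n"] by (intro leg_expand) (simp add: degree_leg)
  moreover have "{..n} = insert n {..<n}" by auto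
  ultimately have eq: "legop (leg n) = smult (pint (legop (leg n) * leg n)) (leg n)"
    by simp
  have "coeff (leg n) n \<noteq> 0"
    using leg_nz[of n] degree_leg[of n] by (metis leading_coeff_0_iff)
  moreover have "coeff (legop (leg n)) n = legeig n * coeff (leg n) n"
    by (rule coeff_legop) (simp add: degree_leg)
  moreover have "coeff (legop (leg n)) n = pint (legop (leg n) * leg n) * coeff (leg n) n"
    by (subst eq) simp
  ultimately have "pint (legop (leg n) * leg n) = legeig n"
    by simp
  with eq show ?thesis by simp
qed

section \<open>Legendre coefficients: Parseval and Bessel\<close>

definition lc :: "(real \<Rightarrow> complex) \<Rightarrow> nat \<Rightarrow> complex" where
  "lc f n = ip I01 f (pfun (leg n))"

lemma ip_leg: "ip I01 (pfun (leg i)) (pfun (leg j)) = (if i = j then 1 else 0)"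
  by (simp add: ip_pfun leg_orthonormal)

lemma ip_pfun_smult: "ip I01 f (pfun (smult a p)) = complex_of_real a * ip I01 f (pfun p)"
  by (simp add: pfun_def[abs_def] ip_def mult_ac)

lemma ip_pfun_diff: "f \<in> l2 I01 \<Longrightarrow> ip I01 f (pfun (p - q)) = ip I01 f (pfun p) - ip I01 f (pfun q)"
  using ip_minus_right[OF pfun_l2 pfun_l2, of f p q] by (simp add: pfun_def[abs_def])

lemma l2_pfun_mult:
  assumes h: "h \<in> l2 I01"
  shows "(\<lambda>x. pfun p x * h x) \<in> l2 I01"
proof -
  obtain B where B: "\<And>x. x \<in> {0..1} \<Longrightarrow> \<bar>poly p x\<bar> \<le> B"
    using poly_bounded by blast
  have meas: "(\<lambda>x. pfun p x * h x) \<in> borel_measurable I01"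
    using l2_measurable[OF h] l2_measurable[OF pfun_l2] by (rule borel_measurable_times[rotated])
  moreover have "integrable I01 (\<lambda>x. (cmod (pfun p x * h x))\<^sup>2)"
  proof (rule Bochner_Integration.integrable_bound)
    show "integrable I01 (\<lambda>x. B\<^sup>2 * (cmod (h x))\<^sup>2)"
      using h by (simp add: l2_iff)
    show "(\<lambda>x. (cmod (pfun p x * h x))\<^sup>2) \<in> borel_measurable I01"
      using meas by measurable
    show "AE x in I01. norm ((cmod (pfun p x * h x))\<^sup>2) \<le> norm (B\<^sup>2 * (cmod (h x))\<^sup>2)"
    proof (rule AE_I2)
      fix x assume "x \<in> space I01"
      then have "\<bar>poly p x\<bar>\<^sup>2 \<le> B\<^sup>2"
        using B by (intro power_mono) auto
      then show "norm ((cmod (pfun p x * h x))\<^sup>2) \<le> norm (B\<^sup>2 * (cmod (h x))\<^sup>2)"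
        by (simp add: pfun_def norm_mult power_mult_distrib mult_right_mono)
    qed
  qed
  ultimately show ?thesis
    by (simp add: l2_iff)
qed

lemma lc_sums:
  assumes f: "f \<in> l2 I01"
  shows "(\<lambda>n. (cmod (lc f n))\<^sup>2) sums (nrm I01 f)\<^sup>2"
proof -
  \<comment> \<open>Complex polynomials, split into real and imaginary part because
    \<open>pfun\<close> takes real polynomials.\<close>
  define S where "S = {h. \<exists>p q. h = (\<lambda>x. pfun p x + \<i> * pfun q x)}"
  have sub: "l2_subspace S"
    unfolding l2_subspace_def
  proof (intro conjI ballI allI)
    show "S \<subseteq> l2 I01"
      by (auto simp: S_def intro!: l2_add l2_cmult)
    show "(\<lambda>x. 0) \<in> S"
      unfolding S_def by (intro CollectI exI[of _ 0]) (simp add: pfun_def)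
    fix h k a b assume "h \<in> S" "k \<in> S"
    then obtain p q r s where hk: "h = (\<lambda>x. pfun p x + \<i> * pfun q x)" "k = (\<lambda>x. pfun r x + \<i> * pfun s x)"
      by (auto simp: S_def)
    show "(\<lambda>x. a * h x + b * k x) \<in> S"
      unfolding S_def hk
      by (intro CollectI exI[of _ "smult (Re a) p - smult (Im a) q + smult (Re b) r - smult (Im b) s"]
            exI[of _ "smult (Re a) q + smult (Im a) p + smult (Re b) s + smult (Im b) r"])
         (simp add: fun_eq_iff complex_eq_iff pfun_def algebra_simps)
  qed
  have mono: "pfun (monom 1 n) \<in> S" for n
    unfolding S_def by (intro CollectI exI[of _ "monom 1 n"] exI[of _ 0]) (simp add: pfun_def[abs_def])
  have cl: "f \<in> l2_closure S"
    by (rule l2_closure_UNIV[OF sub subset_l2_closure[OF sub mono] f])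
  let ?P = "\<lambda>M h x. \<Sum>n<M. lc h n * pfun (leg n) x"
  have res: "(nrm I01 (\<lambda>x. h x - ?P M h x))\<^sup>2 = (nrm I01 h)\<^sup>2 - (\<Sum>n<M. (cmod (lc h n))\<^sup>2)"
    if "h \<in> l2 I01" for h M
    unfolding lc_def using that by (intro nrm_residual) (auto simp: ip_leg)
  have proj: "?P M (pfun p) x = pfun p x" if "degree p < M" for p M x
  proof -
    have "p = (\<Sum>j\<le>M - 1. smult (pint (p * leg j)) (leg j))"
      using that by (intro leg_expand) simp
    also have "{..M - 1} = {..<M}"
      using that by auto
    finally have "poly p x = (\<Sum>j<M. pint (p * leg j) * poly (leg j) x)"
      by (metis (no_types, lifting) poly_smult poly_sum sum.cong)
    then show ?thesis
      by (simp add: lc_def ip_pfun) (simp add: pfun_def)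
  qed
  have "(\<lambda>M. (nrm I01 f)\<^sup>2 - (\<Sum>n<M. (cmod (lc f n))\<^sup>2)) \<longlonglongrightarrow> 0"
  proof (rule LIMSEQ_I)
    fix e :: real assume e: "e > 0"
    obtain g where g: "g \<in> S" "nrm I01 (\<lambda>x. f x - g x) < sqrt e"
      using cl e by (auto simp: l2_closure_def dest: spec[of _ "sqrt e"])
    then obtain p q where pq: "g = (\<lambda>x. pfun p x + \<i> * pfun q x)"
      by (auto simp: S_def)
    have gl2: "g \<in> l2 I01"
      using g(1) sub by (auto dest: l2_subspace_l2)
    have "norm ((nrm I01 f)\<^sup>2 - (\<Sum>n<M. (cmod (lc f n))\<^sup>2) - 0) < e"
      if M: "M \<ge> Suc (max (degree p) (degree q))" for M
    proof -
      have lg: "lc g n = lc (pfun p) n + \<i> * lc (pfun q) n" for n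
        unfolding pq lc_def by (simp add: ip_add_left ip_cmult_left l2_cmult)
      have "?P M g x = ?P M (pfun p) x + \<i> * ?P M (pfun q) x" for x
        by (simp add: lg distrib_right sum.distrib sum_distrib_left mult.assoc)
      then have "?P M g x = g x" for x
        using M by (simp add: proj pq)
      moreover have "lc (\<lambda>x. f x - g x) n = lc f n - lc g n" for n
        using f gl2 by (simp add: lc_def ip_minus_left)
      \<comment> \<open>Once M exceeds the degrees of p and q, g equals its own partial sum. So f
        and f - g leave the same residual, and that of f - g is bounded by its norm.\<close>
      ultimately have "f x - g x - ?P M (\<lambda>x. f x - g x) x = f x - ?P M f x" for x
        by (simp add: left_diff_distrib sum_subtractf)
      then have E: "(\<lambda>x. f x - g x - ?P M (\<lambda>x. f x - g x) x) = (\<lambda>x. f x - ?P M f x)"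
        by (rule ext)
      have "(nrm I01 f)\<^sup>2 - (\<Sum>n<M. (cmod (lc f n))\<^sup>2)
          = (nrm I01 (\<lambda>x. f x - g x))\<^sup>2 - (\<Sum>n<M. (cmod (lc (\<lambda>x. f x - g x) n))\<^sup>2)"
        using res[OF f, of M] res[OF l2_minus[OF f gl2], of M] unfolding E by simp
      also have "\<dots> \<le> (nrm I01 (\<lambda>x. f x - g x))\<^sup>2"
        by (simp add: sum_nonneg)
      also have "\<dots> < (sqrt e)\<^sup>2"
        using g(2) by (intro power_strict_mono) auto
      finally have "(nrm I01 f)\<^sup>2 - (\<Sum>n<M. (cmod (lc f n))\<^sup>2) < e"
        using e by simp
      moreover have "0 \<le> (nrm I01 f)\<^sup>2 - (\<Sum>n<M. (cmod (lc f n))\<^sup>2)"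
        unfolding res[OF f, symmetric] by simp
      ultimately show ?thesis by simp
    qed
    then show "\<exists>N. \<forall>M\<ge>N. norm ((nrm I01 f)\<^sup>2 - (\<Sum>n<M. (cmod (lc f n))\<^sup>2) - 0) < e"
      by blast
  qed
  then show ?thesis
    unfolding sums_def using tendsto_diff[OF tendsto_const, of _ 0 sequentially "(nrm I01 f)\<^sup>2"] by fastforce
qed

text \<open>Bessel's inequality for two orthogonal polynomials that are not normalised: the weights
  a and b are the reciprocals of their squared norms.\<close>

lemma bessel_pair:
  assumes f: "f \<in> l2 I01" and ab: "a > 0" "b > 0"
    and pq: "pint (p * p) = 1 / a" "pint (q * q) = 1 / b" "pint (p * q) = 0"
  shows "a * (cmod (ip I01 f (pfun p)))\<^sup>2 + b * (cmod (ip I01 f (pfun q)))\<^sup>2 \<le> (nrm I01 f)\<^sup>2"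
proof -
  define e where "e = (\<lambda>i. if i then smult (sqrt a) p else smult (sqrt b) q)"
  have "pint (q * p) = 0"
    using pq(3) by (simp add: mult.commute)
  then have on: "ip I01 (pfun (e i)) (pfun (e j)) = (if i = j then 1 else 0)" for i j
    using ab by (cases i; cases j) (simp_all add: e_def ip_pfun pint_smult pq flip: of_real_mult)
  have "(\<Sum>i\<in>UNIV. (cmod (ip I01 f (pfun (e i))))\<^sup>2) \<le> (nrm I01 f)\<^sup>2"
    using f on by (intro bessel) auto
  then show ?thesis
    using ab by (simp add: UNIV_bool e_def ip_pfun_smult norm_mult power_mult_distrib)
qed

section \<open>Weights and the one-dimensional energy inequality\<close>

text \<open>
  The optimal value in place of \<open>lam\<close> is the second eigenvalue 12.9444... of the form
  \<open>|f|^2 + |f'|^2 + |f''|^2\<close>; the first one belongs to the constants. From \<open>n = 2\<close> on, the weights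
  are far from optimal.
\<close>

definition lam :: real where "lam = exp 2.5606"

text \<open>The form from 3 on serves two purposes. With a = (n - 1) (n + 2) one has
  \<open>legeig n\<close> = a^2 + 2 a, and lam / 86 stays below the factor 16/105 available in
  \<open>leg_energy\<close>; the square root of the weight is proportional to a, and sums of 1 / a
  telescope in the counting argument. The value at 2 likewise has a simple square root relative to
  \<open>lam\<close>.\<close>

definition legwt :: "nat \<Rightarrow> real" where
  "legwt n = (if n = 0 then 1 else if n = 1 then lam else if n = 2 then 4 * lam
     else lam * ((real n - 1) * (real n + 2)) ^ 2 / 86)"

text \<open>The bound is what the coefficient at 1 in \<open>leg_energy\<close> allows: lam - 1 must
  not exceed 12 * 213/214 = 11.94392... The exponent is split as 2.5606 = 5/2 + 303/5000; the first
  factor comes from a decimal bound for e, the second from a cubic Taylor polynomial with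
  remainder.\<close>

lemma lam_le: "lam \<le> 129439 / 10000"
proof -
  have e1: "exp 1 \<le> (2.718281829 :: real)"
    using e_approx_32 by (simp add: abs_if split: if_split_asm)
  have "exp (5 / 2 :: real) ^ 2 = exp 1 ^ 5"
    by (simp flip: exp_of_nat_mult)
  also have "\<dots> \<le> (2.718281829 :: real) ^ 5"
    using e1 by (intro power_mono) auto
  also have "\<dots> \<le> 12.1825 ^ 2"
    by (simp add: eval_nat_numeral)
  finally have a: "exp (5 / 2 :: real) \<le> 12.1825"
    by (rule power2_le_imp_le) simp
  let ?x = "303 / 5000 :: real"
  obtain t where t: "\<bar>t\<bar> \<le> \<bar>?x\<bar>"
    "exp ?x = (\<Sum>m<4. ?x ^ m / fact m) + exp t / fact 4 * ?x ^ 4"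
    using Maclaurin_exp_le[of ?x 4] by blast
  have "exp t \<le> exp 1"
    using t(1) by simp
  also have "exp 1 \<le> (3 :: real)"
    by (rule exp_le)
  finally have "exp t \<le> 3" .
  then have "exp t / fact 4 * ?x ^ 4 \<le> 3 / fact 4 * ?x ^ 4"
    by (intro mult_right_mono divide_right_mono) auto
  then have "exp ?x \<le> 1.062476"
    unfolding t(2) by (simp add: eval_nat_numeral fact_numeral)
  then have "exp (5 / 2) * exp ?x \<le> 12.1825 * 1.062476"
    using a by (intro mult_mono) auto
  then show ?thesis
    by (simp add: lam_def flip: exp_add)
qed

text \<open>
  Let \<open>m\<close> be the mean of \<open>g = f'\<close> and \<open>w = x * (1 - x)\<close>. Then \<open>sqrt 12 * c 1 = m - y\<close> up to sign, where
  \<open>y = \<langle>g, 1 - 6 * w\<rangle> = - \<langle>h, w * (1 - 2 * x)\<rangle>\<close>. Bessel's inequality gives \<open>|g|^2 \<ge> |m|^2 + 5 * |y|^2\<close> and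
  \<open>|h|^2 \<ge> 210 * |y|^2 + 504 * |c 2|^2\<close>. The fraction \<open>1 / 105\<close> of \<open>|h|^2\<close> is spent on the coefficients
  from \<open>c 3\<close> on, which leaves \<open>|m|^2 + 213 * |y|^2 \<ge> 213 / 214 * 12 * |c 1|^2\<close>.
\<close>

lemma leg_energy:
  assumes f: "f \<in> l2 I01" and g: "g \<in> l2 I01" and h: "h \<in> l2 I01"
    and fg: "\<And>\<phi>. test_function \<phi> \<Longrightarrow> ip I01 f (rfun (deriv \<phi>)) = - ip I01 g (rfun \<phi>)"
    and gh: "\<And>\<phi>. test_function \<phi> \<Longrightarrow> ip I01 g (rfun (deriv \<phi>)) = - ip I01 h (rfun \<phi>)"
  shows "(\<Sum>n<M. (legwt n - 1) * (cmod (lc f n))\<^sup>2) \<le> (nrm I01 g)\<^sup>2 + (nrm I01 h)\<^sup>2"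
proof -
  \<comment> \<open>The derivative of \<open>?K\<close> is 1 - 6 w, so y can be read off from g or
    from h. \<open>?W\<close> detects the coefficient at 2, since the second derivative of
    \<open>leg 2\<close> is constant.\<close>
  let ?w = "cut 0" and ?K = "cut 0 * [:1, -2:]" and ?W = "cut 0 ^ 2"
  define y where "y = ip I01 g (pfun [:1, -6, 6:])"
  define m where "m = ip I01 g (pfun 1)"
  have K': "pderiv ?K = [:1, -6, 6:]"
    by (simp add: cut_def pderiv_pCons)
  have y: "y = - ip I01 h (pfun ?K)"
    using weak_deriv_pfun[OF g h gh, of "[:1, -2:]"] unfolding y_def K' by simp
  \<comment> \<open>\<open>?K\<close> is odd and \<open>?W\<close> is even about 1/2, so they are
    orthogonal. The reciprocals 210 and 630 of the squared norms are the Bessel weights.\<close>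
  have "pint (?K * ?K) = 1 / 210"
    by (subst pint_pderiv_eq[of "[:0, 0, 0, 1/3, -3/2, 13/5, -2, 4/7:]"]) (simp_all add: cut_def pderiv_pCons)
  moreover have "pint (?W * ?W) = 1 / 630"
    by (subst pint_pderiv_eq[of "[:0, 0, 0, 0, 0, 1/5, -4/6, 6/7, -4/8, 1/9:]"])
       (simp_all add: cut_def pderiv_pCons power2_eq_square)
  moreover have "pint (?K * ?W) = 0"
    by (subst pint_pderiv_eq[of "[:0, 0, 0, 0, 1/4, -1, 3/2, -1, 1/4:]"])
       (simp_all add: cut_def pderiv_pCons power2_eq_square)
  ultimately have H: "210 * (cmod y)\<^sup>2 + 630 * (cmod (ip I01 h (pfun ?W)))\<^sup>2 \<le> (nrm I01 h)\<^sup>2"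
    using bessel_pair[OF h, of 210 630 ?K ?W] by (simp add: y)
  have "pint (1 * 1) = 1 / 1"
    by (subst pint_pderiv_eq[of "[:0, 1:]"]) (simp_all add: pderiv_pCons)
  moreover have "pint ([:1, -6, 6:] * [:1, -6, 6:]) = 1 / 5"
    by (subst pint_pderiv_eq[of "[:0, 1, -6, 16, -18, 36/5:]"]) (simp_all add: pderiv_pCons)
  moreover have "pint (1 * [:1, -6, 6:]) = 0"
    by (subst pint_pderiv_eq[of "[:0, 1, -3, 2:]"]) (simp_all add: pderiv_pCons)
  ultimately have G: "(cmod m)\<^sup>2 + 5 * (cmod y)\<^sup>2 \<le> (nrm I01 g)\<^sup>2"
    using bessel_pair[OF g, of 1 5 1 "[:1, -6, 6:]"] by (simp add: y_def m_def)

  have c1: "(cmod (lc f 1))\<^sup>2 = (cmod (m - y))\<^sup>2 / 12"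
  proof -
    obtain a b where ab: "leg 1 = [:a, b:]"
    proof
      show "leg 1 = [:coeff (leg 1) 0, coeff (leg 1) 1:]"
        by (rule poly_eqI) (auto simp: coeff_pCons coeff_eq_0 degree_leg split: nat.split)
    qed
    obtain c where c: "leg 0 = [:c:]"
      using degree_leg[of 0] by (auto elim: degree_eq_zeroE)
    have "c \<noteq> 0"
      using leg_nz[of 0] c by auto
    have "pint (leg 0 * leg 1) = c * (a + b / 2)"
      unfolding ab c
      by (subst pint_pderiv_eq[of "[:0, c * a, c * b / 2:]"]) (simp_all add: pderiv_pCons algebra_simps)
    then have a: "a = - b / 2"
      using \<open>c \<noteq> 0\<close> leg_orthonormal[of 0 1] by (simp add: add_eq_0_iff)
    have "pint (leg 1 * leg 1) = a ^ 2 + a * b + b ^ 2 / 3"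
      unfolding ab
      by (subst pint_pderiv_eq[of "[:0, a ^ 2, a * b, b ^ 2 / 3:]"])
         (simp_all add: pderiv_pCons power2_eq_square algebra_simps)
    then have b: "b ^ 2 = 12"
      using leg_orthonormal[of 1 1] by (simp add: a power2_eq_square field_simps)
    \<comment> \<open>1 - 2 x is the derivative of w, so the coefficient at 1 is b / 2 times the
      pairing of g with w; and w = (1 - (1 - 6 w)) / 6 turns that pairing into (m - y) / 6. Only b ^
      2 = 12 enters the modulus.\<close>
    have leg1: "leg 1 = smult (- b / 2) [:1, -2:]"
      unfolding ab a by simp
    have w': "pderiv (?w * 1) = [:1, -2:]"
      by (simp add: pderiv_cut)
    have "lc f 1 = complex_of_real (b / 2) * ip I01 g (pfun ?w)"
      using weak_deriv_pfun[OF f g fg, of 1] unfolding w' unfolding lc_def leg1 ip_pfun_smult by simp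
    moreover have "pfun [:1, -6, 6:] = pfun (1 - smult 6 ?w)"
      by (simp add: cut_def one_pCons)
    then have "y = m - 6 * ip I01 g (pfun ?w)"
      using g by (simp add: y_def m_def ip_pfun_diff ip_pfun_smult)
    ultimately have lc1: "lc f 1 = complex_of_real (b / 12) * (m - y)"
      by simp
    have "(cmod (lc f 1))\<^sup>2 = b ^ 2 / 144 * (cmod (m - y))\<^sup>2"
      unfolding lc1 by (simp add: norm_mult power_mult_distrib power_divide)
    then show ?thesis
      by (simp add: b)
  qed
  \<comment> \<open>Cauchy-Schwarz with weights 1 and 213, as 1 + 1/213 = 214/213.\<close>
  have my: "213 / 214 * (cmod (m - y))\<^sup>2 \<le> (cmod m)\<^sup>2 + 213 * (cmod y)\<^sup>2"
  proof -
    have "(cmod (m - y))\<^sup>2 \<le> (cmod m + cmod y)\<^sup>2"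
      by (intro power_mono norm_triangle_ineq4) simp
    moreover have "213 * (cmod m + cmod y)\<^sup>2 \<le> 214 * ((cmod m)\<^sup>2 + 213 * (cmod y)\<^sup>2)"
      using zero_le_power2[of "cmod m - 213 * cmod y"] by (simp add: power2_eq_square algebra_simps)
    ultimately have "213 * (cmod (m - y))\<^sup>2 \<le> 214 * ((cmod m)\<^sup>2 + 213 * (cmod y)\<^sup>2)"
      by (meson mult_left_mono order_trans zero_le_numeral)
    then show ?thesis by simp
  qed

  \<comment> \<open>Both derivatives are moved from h to the polynomial. The double zeros of w^2
    make this possible twice: after one derivative a factor w is still left, as \<open>W'\<close>
    displays.\<close>
  have eig: "ip I01 h (pfun (?W * pderiv (pderiv (leg n)))) = complex_of_real (legeig n) * lc f n" for n
  proof -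
    let ?r = "pderiv (pderiv (leg n))"
    have W: "?W * ?r = ?w * (?w * ?r)"
      by (simp add: power2_eq_square)
    have W': "pderiv (?W * ?r) = ?w * (?w * pderiv ?r + (?r * [:1, -2:] + ?r * [:1, -2:]))"
      unfolding W pderiv_mult[of ?w] pderiv_cut by (simp only: distrib_left mult_ac add_ac)
    have "ip I01 h (pfun (?W * ?r)) = - ip I01 g (pfun (pderiv (?W * ?r)))"
      unfolding W by (rule weak_deriv_pfun[OF g h gh])
    also have "\<dots> = ip I01 f (pfun (pderiv (pderiv (?W * ?r))))"
      unfolding W' by (subst weak_deriv_pfun[OF f g fg]) simp_all
    also have "\<dots> = complex_of_real (legeig n) * lc f n"
      using legop_leg[of n] by (simp add: legop_def ip_pfun_smult lc_def)
    finally show ?thesis .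
  qed

  have c2: "504 * (cmod (lc f 2))\<^sup>2 = 630 * (cmod (ip I01 h (pfun ?W)))\<^sup>2"
  proof -
    have "degree (pderiv (pderiv (leg 2))) = 0"
      by (simp add: degree_pderiv degree_leg)
    then obtain a where a: "pderiv (pderiv (leg 2)) = [:a:]"
      by (auto elim: degree_eq_zeroE)
    \<comment> \<open>This is the eigenvalue 24 of \<open>leg 2\<close> written as a^2 / 30, hence
      a^2 = 720 and 630 * 24^2 / 720 = 504.\<close>
    have "pint (?W * [:a:] * [:a:]) = a ^ 2 / 30"
      by (subst pint_pderiv_eq[of "[:0, 0, 0, a^2/3, -(a^2)/2, a^2/5:]"])
         (simp_all add: cut_def pderiv_pCons power2_eq_square)
    moreover have "pint (legop (leg 2) * leg 2) = 24"
      by (simp add: legop_leg pint_smult leg_orthonormal legeig_def)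
    ultimately have a2: "a ^ 2 = 720"
      by (simp add: pint_legop a)
    have "?W * [:a:] = smult a ?W"
      by simp
    then have "complex_of_real a * ip I01 h (pfun ?W) = 24 * lc f 2"
      using eig[of 2] by (simp add: a ip_pfun_smult legeig_def)
    then have "(cmod (complex_of_real a * ip I01 h (pfun ?W)))\<^sup>2 = (cmod (24 * lc f 2))\<^sup>2"
      by simp
    then show ?thesis
      by (simp add: norm_mult power_mult_distrib a2)
  qed

  have tail: "16 * (\<Sum>n\<in>{2..<M}. legeig n * (cmod (lc f n))\<^sup>2) \<le> (nrm I01 h)\<^sup>2"
  proof -
    \<comment> \<open>By \<open>pint_legop\<close> these functions are orthonormal; the eigenvalue
      is positive exactly from n = 2 on. Bessel's inequality is applied to w h, and w \<le> 1/4
      produces the factor 16.\<close>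
    define u where "u = (\<lambda>n. smult (1 / sqrt (legeig n)) (?w * pderiv (pderiv (leg n))))"
    define wh where "wh = (\<lambda>x. pfun ?w x * h x)"
    have pos: "legeig n > 0" if "n \<ge> 2" for n
      unfolding legeig_def using that by (intro mult_pos_pos) auto
    have whl2: "wh \<in> l2 I01"
      unfolding wh_def using h by (rule l2_pfun_mult)
    have on: "ip I01 (pfun (u i)) (pfun (u j)) = (if i = j then 1 else 0)" if "i \<ge> 2" "j \<ge> 2" for i j
    proof -
      have "pint (u i * u j) = pint (legop (leg i) * leg j) / (sqrt (legeig i) * sqrt (legeig j))"
        unfolding pint_legop by (simp add: u_def pint_smult power2_eq_square mult_ac)
      also have "\<dots> = (if i = j then 1 else 0)"
        using pos[OF that(1)] by (auto simp: legop_leg pint_smult leg_orthonormal)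
      finally show ?thesis
        by (simp add: ip_pfun)
    qed
    have ip: "(cmod (ip I01 wh (pfun (u n))))\<^sup>2 = legeig n * (cmod (lc f n))\<^sup>2" if "n \<ge> 2" for n
    proof -
      have "ip I01 wh (pfun (?w * pderiv (pderiv (leg n)))) = complex_of_real (legeig n) * lc f n"
        unfolding eig[symmetric] by (simp add: wh_def ip_def pfun_mult power2_eq_square mult_ac)
      then have "ip I01 wh (pfun (u n)) = complex_of_real (legeig n / sqrt (legeig n)) * lc f n"
        by (simp add: u_def ip_pfun_smult)
      also have "legeig n / sqrt (legeig n) = sqrt (legeig n)"
        using pos[OF that] by (simp add: real_div_sqrt)
      finally show ?thesis
        using pos[OF that] by (simp add: norm_mult power_mult_distrib)
    qed
    have "(\<Sum>n\<in>{2..<M}. (cmod (ip I01 wh (pfun (u n))))\<^sup>2) \<le> (nrm I01 wh)\<^sup>2"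
      using whl2 on by (intro bessel) auto
    also have "\<dots> \<le> (\<integral>x. (1 / 16) * (cmod (h x))\<^sup>2 \<partial>I01)"
      unfolding nrm_square'
    proof (rule integral_mono)
      fix x assume "x \<in> space I01"
      then have "\<bar>poly ?w x\<bar> \<le> 1 / 4"
        using zero_le_power2[of "x - 1 / 2"] mult_nonneg_nonneg[of x "1 - x"]
        by (simp add: poly_cut power2_eq_square abs_le_iff algebra_simps)
      then have "(\<bar>poly ?w x\<bar>)\<^sup>2 \<le> (1 / 4)\<^sup>2"
        by (intro power_mono) auto
      then have "(\<bar>poly ?w x\<bar>)\<^sup>2 * (cmod (h x))\<^sup>2 \<le> (1 / 4)\<^sup>2 * (cmod (h x))\<^sup>2"
        by (rule mult_right_mono) simp
      then show "(cmod (wh x))\<^sup>2 \<le> (1 / 16) * (cmod (h x))\<^sup>2"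
        by (simp add: wh_def pfun_def norm_mult power_mult_distrib power_divide)
    qed (use whl2 h in \<open>simp_all add: l2_iff\<close>)
    also have "\<dots> = (nrm I01 h)\<^sup>2 / 16"
      by (simp add: nrm_square')
    finally show ?thesis
      by (simp add: ip)
  qed

  \<comment> \<open>2556/214 is 12 * 213/214, and 499 is 504 * 104/105 = 499.2 rounded down. The
    factor 16/105 is \<open>tail\<close> multiplied by the share 1/105.\<close>
  have bound: "(\<Sum>n<M. (legwt n - 1) * (cmod (lc f n))\<^sup>2) \<le>
      2556 / 214 * (cmod (lc f 1))\<^sup>2 + 499 * (cmod (lc f 2))\<^sup>2
      + 16 / 105 * (\<Sum>n\<in>{2..<M}. legeig n * (cmod (lc f n))\<^sup>2)"
  proof -
    define c where "c n = (cmod (lc f n))\<^sup>2" for n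
    have c0: "c n \<ge> 0" for n by (simp add: c_def)
    have lam: "1 \<le> lam" "lam \<le> 129439 / 10000"
      using lam_le by (simp_all add: lam_def)
    have "(\<Sum>n<M. (legwt n - 1) * c n) \<le> (\<Sum>n<M. (if n = 1 then 2556 / 214 * c n else 0)
        + (if n = 2 then 499 * c n else 0) + (if n \<in> {2..<M} then 16 / 105 * (legeig n * c n) else 0))"
    proof (rule sum_mono)
      fix n assume n: "n \<in> {..<M}"
      consider "n = 0" | "n = 1" | "n = 2" | "n \<ge> 3" by linarith
      then show "(legwt n - 1) * c n \<le> (if n = 1 then 2556 / 214 * c n else 0)
        + (if n = 2 then 499 * c n else 0) + (if n \<in> {2..<M} then 16 / 105 * (legeig n * c n) else 0)"
      proof cases
        case 2
        have "(legwt n - 1) * c n \<le> 2556 / 214 * c n"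
          using lam c0[of n] 2 by (intro mult_right_mono) (simp_all add: legwt_def)
        then show ?thesis using 2 by simp
      next
        case 3
        have "(legwt n - 1) * c n \<le> 499 * c n"
          using lam c0[of n] 3 by (intro mult_right_mono) (simp_all add: legwt_def)
        moreover have "0 \<le> legeig n * c n"
          using c0[of n] 3 by (simp add: legeig_def)
        ultimately show ?thesis using 3 by auto
      next
        case 4
        define a where "a = (real n - 1) * (real n + 2)"
        have a: "a \<ge> 10"
          unfolding a_def using 4 mult_mono[of 2 "real n - 1" 5 "real n + 2"] by simp
        have "legeig n = a\<^sup>2 + 2 * a"
          by (simp add: legeig_def a_def power2_eq_square algebra_simps)
        moreover have "lam * a\<^sup>2 \<le> 129439 / 10000 * a\<^sup>2"
          using lam(2) by (rule mult_right_mono) simp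
        moreover have "legwt n = lam * a\<^sup>2 / 86"
          using 4 by (simp add: legwt_def a_def)
        ultimately have "legwt n - 1 \<le> 16 / 105 * legeig n"
          using a zero_le_power2[of a] by linarith
        then have "(legwt n - 1) * c n \<le> 16 / 105 * legeig n * c n"
          using c0 by (rule mult_right_mono)
        then show ?thesis
          using 4 n by auto
      qed (simp add: legwt_def)
    qed
    also have "\<dots> = (if 1 < M then 2556 / 214 * c 1 else 0) + (if 2 < M then 499 * c 2 else 0)
        + (\<Sum>n\<in>{2..<M}. 16 / 105 * (legeig n * c n))"
      unfolding sum.distrib
    proof (intro arg_cong2[where f = "(+)"])
      show "(\<Sum>n<M. if n \<in> {2..<M} then 16 / 105 * (legeig n * c n) else 0)
          = (\<Sum>n\<in>{2..<M}. 16 / 105 * (legeig n * c n))"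
        by (intro sum.mono_neutral_cong_right) auto
    qed (subst sum.delta, auto)+
    also have "\<dots> \<le> 2556 / 214 * c 1 + 499 * c 2 + 16 / 105 * (\<Sum>n\<in>{2..<M}. legeig n * c n)"
      using c0[of 1] c0[of 2] by (simp add: sum_distrib_left)
    finally show ?thesis
      by (simp add: c_def)
  qed
  \<comment> \<open>The balance: \<open>G\<close>, 104/105 of \<open>H\<close> and 1/105 of
    \<open>tail\<close>. The coefficient of |y|^2 is 5 + 210 * 104/105 = 213, just what
    \<open>my\<close> consumes.\<close>
  show ?thesis
    using bound tail c1 c2 my H G zero_le_power2[of "cmod (lc f 2)"] by linarith
qed

subsection \<open>Positive semidefinite kernels\<close>

definition qform :: "nat \<Rightarrow> (nat \<Rightarrow> complex) \<Rightarrow> (nat \<Rightarrow> nat \<Rightarrow> complex) \<Rightarrow> complex" where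
  "qform m a K = (\<Sum>i<m. \<Sum>j<m. a i * cnj (a j) * K i j)"

definition psd :: "nat \<Rightarrow> (nat \<Rightarrow> nat \<Rightarrow> complex) \<Rightarrow> bool" where
  "psd m K \<longleftrightarrow> (\<forall>a. 0 \<le> Re (qform m a K))"

text \<open>The conclusion of the Schur product theorem made into a property. For Gram kernels in L2
  it follows directly by integration, and it is evidently closed under sums, products and limits, so
  no matrix factorisation is involved.\<close>

definition schur :: "nat \<Rightarrow> (nat \<Rightarrow> nat \<Rightarrow> complex) \<Rightarrow> bool" where
  "schur m K \<longleftrightarrow> (\<forall>P. psd m P \<longrightarrow> psd m (\<lambda>i j. P i j * K i j))"

lemma qform_add: "qform m a (\<lambda>i j. K i j + L i j) = qform m a K + qform m a L"
  by (simp add: qform_def distrib_left sum.distrib)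

lemma qform_diff: "qform m a (\<lambda>i j. K i j - L i j) = qform m a K - qform m a L"
  by (simp add: qform_def right_diff_distrib sum_subtractf)

lemma qform_cmult: "qform m a (\<lambda>i j. c * K i j) = c * qform m a K"
  by (simp add: qform_def sum_distrib_left mult_ac)

lemma qform_sum: "qform m a (\<lambda>i j. \<Sum>k\<in>A. K k i j) = (\<Sum>k\<in>A. qform m a (K k))"
  unfolding qform_def sum_distrib_left
  by (simp add: sum.swap[of _ A])

lemma psd_cong: "psd m K \<Longrightarrow> (\<And>i j. i < m \<Longrightarrow> j < m \<Longrightarrow> K i j = L i j) \<Longrightarrow> psd m L"
  by (simp add: psd_def qform_def)

lemma psd_add: "psd m K \<Longrightarrow> psd m L \<Longrightarrow> psd m (\<lambda>i j. K i j + L i j)"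
  by (simp add: psd_def qform_add)

lemma psd_cmult: "0 \<le> c \<Longrightarrow> psd m K \<Longrightarrow> psd m (\<lambda>i j. complex_of_real c * K i j)"
  by (simp add: psd_def qform_cmult)

lemma psd_sum: "(\<And>k. k \<in> A \<Longrightarrow> psd m (K k)) \<Longrightarrow> psd m (\<lambda>i j. \<Sum>k\<in>A. K k i j)"
  by (simp add: psd_def qform_sum sum_nonneg)

lemma tendsto_qform:
  assumes "\<And>i j. i < m \<Longrightarrow> j < m \<Longrightarrow> ((\<lambda>L. K L i j) \<longlongrightarrow> K' i j) F"
  shows "((\<lambda>L. qform m a (K L)) \<longlongrightarrow> qform m a K') F"
  unfolding qform_def using assms by (intro tendsto_intros) auto

lemma psd_lim:
  assumes "\<And>L::nat. psd m (K L)"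
    and "\<And>i j. i < m \<Longrightarrow> j < m \<Longrightarrow> (\<lambda>L. K L i j) \<longlonglongrightarrow> K' i j"
  shows "psd m K'"
  unfolding psd_def
proof
  fix a
  have "(\<lambda>L. Re (qform m a (K L))) \<longlonglongrightarrow> Re (qform m a K')"
    using assms(2) by (intro tendsto_intros tendsto_qform)
  then show "0 \<le> Re (qform m a K')"
    using assms(1) by (intro LIMSEQ_le_const) (auto simp: psd_def)
qed

lemma psd_one: "psd m (\<lambda>i j. 1)"
  unfolding psd_def
proof
  fix a
  have "qform m a (\<lambda>i j. 1) = (\<Sum>i<m. a i) * cnj (\<Sum>i<m. a i)"
    by (simp add: qform_def sum_product)
  then show "0 \<le> Re (qform m a (\<lambda>i j. 1))"
    unfolding complex_norm_square[symmetric] by simp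
qed

lemma schurD: "schur m K \<Longrightarrow> psd m P \<Longrightarrow> psd m (\<lambda>i j. P i j * K i j)"
  by (simp add: schur_def)

lemma schur_psd: "schur m K \<Longrightarrow> psd m K"
  using schurD[OF _ psd_one] by fastforce

lemma schur_one: "schur m (\<lambda>i j. 1)"
  by (simp add: schur_def)

lemma schur_mult: "schur m K \<Longrightarrow> schur m L \<Longrightarrow> schur m (\<lambda>i j. K i j * L i j)"
  by (simp add: schur_def mult.assoc[symmetric])

lemma schur_prod: "(\<And>k. k \<in> A \<Longrightarrow> schur m (K k)) \<Longrightarrow> schur m (\<lambda>i j. \<Prod>k\<in>A. K k i j)"
  by (induction A rule: infinite_finite_induct) (auto intro: schur_mult schur_one)

lemma schur_sum: "(\<And>k. k \<in> A \<Longrightarrow> schur m (K k)) \<Longrightarrow> schur m (\<lambda>i j. \<Sum>k\<in>A. K k i j)"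
  unfolding schur_def by (auto simp: sum_distrib_left intro!: psd_sum)

lemma schur_cmult:
  assumes "0 \<le> c" "schur m K"
  shows "schur m (\<lambda>i j. complex_of_real c * K i j)"
  using psd_cmult[OF assms(1)] assms(2) by (simp add: schur_def mult.left_commute)

lemma schur_lim:
  assumes "\<And>L::nat. schur m (K L)"
    and "\<And>i j. i < m \<Longrightarrow> j < m \<Longrightarrow> (\<lambda>L. K L i j) \<longlonglongrightarrow> K' i j"
  shows "schur m K'"
  unfolding schur_def
proof (intro allI impI)
  fix P assume "psd m P"
  then have P: "psd m (\<lambda>i j. P i j * K L i j)" for L
    by (rule schurD[OF assms(1)])
  show "psd m (\<lambda>i j. P i j * K' i j)"
    by (rule psd_lim[where K = "\<lambda>L i j. P i j * K L i j", OF P]) (intro tendsto_mult_left assms(2))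
qed

lemma schur_rank1: "schur m (\<lambda>i j. c i * cnj (c j))"
  unfolding schur_def
proof (intro allI impI)
  fix P assume P: "psd m P"
  have "qform m a (\<lambda>i j. P i j * (c i * cnj (c j))) = qform m (\<lambda>i. a i * c i) P" for a
    by (simp add: qform_def mult_ac)
  then show "psd m (\<lambda>i j. P i j * (c i * cnj (c j)))"
    using P by (simp add: psd_def)
qed

text \<open>An L2 Gram kernel is an integral of rank-one kernels. Multiplying P by the one at x
  amounts to replacing the coefficients a i by a i * F i x in the form of P, so the integrand is
  nonnegative.\<close>

lemma schur_ip:
  assumes F: "\<And>i. i < m \<Longrightarrow> F i \<in> l2 M"
  shows "schur m (\<lambda>i j. ip M (F i) (F j))"
  unfolding schur_def psd_def
proof (intro allI impI)
  fix P a assume P: "\<forall>a. 0 \<le> Re (qform m a P)"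
  have int: "integrable M (\<lambda>x. a i * cnj (a j) * P i j * (F i x * cnj (F j x)))" if "i < m" "j < m" for i j
    using that F by (intro integrable_mult_right l2_integrable_ip)
  have "qform m a (\<lambda>i j. P i j * ip M (F i) (F j))
      = (\<Sum>i<m. \<Sum>j<m. \<integral>x. a i * cnj (a j) * P i j * (F i x * cnj (F j x)) \<partial>M)"
    by (simp add: qform_def ip_def mult.assoc)
  also have "\<dots> = (\<integral>x. (\<Sum>i<m. \<Sum>j<m. a i * cnj (a j) * P i j * (F i x * cnj (F j x))) \<partial>M)"
  proof -
    have "(\<integral>x. (\<Sum>i<m. \<Sum>j<m. a i * cnj (a j) * P i j * (F i x * cnj (F j x))) \<partial>M)
        = (\<Sum>i<m. \<integral>x. (\<Sum>j<m. a i * cnj (a j) * P i j * (F i x * cnj (F j x))) \<partial>M)"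
      using int by (intro Bochner_Integration.integral_sum Bochner_Integration.integrable_sum) auto
    also have "\<dots> = (\<Sum>i<m. \<Sum>j<m. \<integral>x. a i * cnj (a j) * P i j * (F i x * cnj (F j x)) \<partial>M)"
      using int by (intro sum.cong refl Bochner_Integration.integral_sum) auto
    finally show ?thesis by simp
  qed
  also have "\<dots> = (\<integral>x. qform m (\<lambda>i. a i * F i x) P \<partial>M)"
    by (simp add: qform_def mult_ac)
  finally have "Re (qform m a (\<lambda>i j. P i j * ip M (F i) (F j))) = Re (\<integral>x. qform m (\<lambda>i. a i * F i x) P \<partial>M)"
    by simp
  also have "integrable M (\<lambda>x. qform m (\<lambda>i. a i * F i x) P)"
  proof -
    have "integrable M (\<lambda>x. \<Sum>i<m. \<Sum>j<m. a i * cnj (a j) * P i j * (F i x * cnj (F j x)))"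
      using int by (intro Bochner_Integration.integrable_sum) auto
    then show ?thesis
      by (simp add: qform_def mult_ac)
  qed
  then have "Re (\<integral>x. qform m (\<lambda>i. a i * F i x) P \<partial>M) = (\<integral>x. Re (qform m (\<lambda>i. a i * F i x) P) \<partial>M)"
    by (simp add: integral_Re)
  also have "\<dots> \<ge> 0"
    using P by (intro integral_nonneg_AE AE_I2) auto
  finally show "0 \<le> Re (qform m a (\<lambda>i j. P i j * ip M (F i) (F j)))" .
qed

text \<open>Factors are exchanged one at a time: G G_d - G' G'_d = (G - G') G_d + (G_d - G'_d) G',
  where each difference is positive semidefinite and each cofactor is a Schur multiplier.\<close>

lemma psd_prod_diff:
  fixes d :: nat
  assumes "\<And>k. k < d \<Longrightarrow> schur m (G k)" "\<And>k. k < d \<Longrightarrow> schur m (G' k)"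
    and "\<And>k. k < d \<Longrightarrow> psd m (\<lambda>i j. G k i j - G' k i j)"
  shows "psd m (\<lambda>i j. (\<Prod>k<d. G k i j) - (\<Prod>k<d. G' k i j))"
  using assms
proof (induction d)
  case 0
  then show ?case
    by (simp add: psd_def qform_def)
next
  case (Suc d)
  have "psd m (\<lambda>i j. ((\<Prod>k<d. G k i j) - (\<Prod>k<d. G' k i j)) * G d i j)"
    using Suc by (intro schurD) auto
  moreover have "psd m (\<lambda>i j. (G d i j - G' d i j) * (\<Prod>k<d. G' k i j))"
    using Suc.prems by (intro schurD schur_prod) auto
  ultimately have "psd m (\<lambda>i j. ((\<Prod>k<d. G k i j) - (\<Prod>k<d. G' k i j)) * G d i j
      + (G d i j - G' d i j) * (\<Prod>k<d. G' k i j))"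
    by (rule psd_add)
  then show ?case
    by (rule psd_cong) (simp add: algebra_simps)
qed

section \<open>Kernels evaluated on lists\<close>

definition kpsd :: "'b set \<Rightarrow> ('b \<Rightarrow> 'b \<Rightarrow> complex) \<Rightarrow> bool" where
  "kpsd C K \<longleftrightarrow> (\<forall>T. set T \<subseteq> C \<longrightarrow> psd (length T) (\<lambda>i j. K (T ! i) (T ! j)))"

definition lform :: "('b \<Rightarrow> 'b \<Rightarrow> complex) \<Rightarrow> 'b list \<Rightarrow> 'b list \<Rightarrow> complex" where
  "lform K R S = (\<Sum>u\<leftarrow>R. \<Sum>v\<leftarrow>S. K u v)"

lemma sum_append_weighted:
  fixes f :: "'b \<Rightarrow> complex"
  shows "(\<Sum>i<length (R @ S). (if i < length R then a else b) * f ((R @ S) ! i))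
    = a * (\<Sum>u\<leftarrow>R. f u) + b * (\<Sum>v\<leftarrow>S. f v)"
proof -
  let ?g = "\<lambda>i. (if i < length R then a else b) * f ((R @ S) ! i)"
  have "(\<Sum>i<length (R @ S). ?g i) = (\<Sum>i\<in>{0..<length R}. ?g i) + (\<Sum>i\<in>{length R..<length R + length S}. ?g i)"
    by (subst sum.atLeastLessThan_concat) (auto simp: lessThan_atLeast0)
  also have "(\<Sum>i\<in>{length R..<length R + length S}. ?g i) = (\<Sum>i\<in>{0..<length S}. ?g (i + length R))"
    using sum.shift_bounds_nat_ivl[of ?g 0 "length R" "length S"] by (simp add: add.commute)
  finally show ?thesis
    by (simp add: sum_list_sum_nth sum_distrib_left nth_append)
qed

text \<open>The concatenated list with weight a on the first block and b on the second encodes the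
  formal combination a R + b S. This transfers positivity from matrices to tensors given as
  lists.\<close>

lemma qform_append:
  "qform (length (R @ S)) (\<lambda>i. if i < length R then a else b) (\<lambda>i j. K ((R @ S) ! i) ((R @ S) ! j))
    = a * cnj a * lform K R R + a * cnj b * lform K R S + b * cnj a * lform K S R + b * cnj b * lform K S S"
proof -
  let ?w = "\<lambda>a b i. if i < length R then a else (b::complex)"
  let ?T = "R @ S"
  have "qform (length ?T) (?w a b) (\<lambda>i j. K (?T ! i) (?T ! j))
      = (\<Sum>i<length ?T. ?w a b i * (\<Sum>j<length ?T. ?w (cnj a) (cnj b) j * K (?T ! i) (?T ! j)))"
    unfolding qform_def sum_distrib_left by (intro sum.cong) auto
  also have "\<dots> = (\<Sum>i<length ?T. ?w a b i * (cnj a * (\<Sum>u\<leftarrow>R. K (?T ! i) u) + cnj b * (\<Sum>v\<leftarrow>S. K (?T ! i) v)))"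
    by (simp only: sum_append_weighted)
  also have "\<dots> = a * (\<Sum>w\<leftarrow>R. cnj a * (\<Sum>u\<leftarrow>R. K w u) + cnj b * (\<Sum>v\<leftarrow>S. K w v))
      + b * (\<Sum>w\<leftarrow>S. cnj a * (\<Sum>u\<leftarrow>R. K w u) + cnj b * (\<Sum>v\<leftarrow>S. K w v))"
    by (rule sum_append_weighted)
  also have "\<dots> = a * cnj a * lform K R R + a * cnj b * lform K R S + b * cnj a * lform K S R + b * cnj b * lform K S S"
    by (simp add: lform_def sum_list_addf sum_list_const_mult algebra_simps)
  finally show ?thesis .
qed

lemma kpsd_append:
  assumes "kpsd C K" "set R \<subseteq> C" "set S \<subseteq> C"
  shows "0 \<le> Re (a * cnj a * lform K R R + a * cnj b * lform K R S + b * cnj a * lform K S R + b * cnj b * lform K S S)"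
proof -
  have "psd (length (R @ S)) (\<lambda>i j. K ((R @ S) ! i) ((R @ S) ! j))"
    using assms(1)[unfolded kpsd_def, rule_format, of "R @ S"] assms(2,3) by simp
  then show ?thesis
    unfolding qform_append[symmetric] psd_def by blast
qed

lemma kpsd_lform: "kpsd C K \<Longrightarrow> set R \<subseteq> C \<Longrightarrow> 0 \<le> Re (lform K R R)"
  using kpsd_append[of C K R "[]" 1 0] by simp

lemma kpsdI:
  assumes "\<And>T. set T \<subseteq> C \<Longrightarrow> psd (length T) (\<lambda>i j. K (T ! i) (T ! j))"
  shows "kpsd C K"
  using assms by (simp add: kpsd_def)

definition ldist2 :: "('b \<Rightarrow> 'b \<Rightarrow> complex) \<Rightarrow> 'b list \<Rightarrow> 'b list \<Rightarrow> real" where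
  "ldist2 K R S = Re (lform K R R - lform K R S - lform K S R + lform K S S)"

text \<open>The reverse triangle inequality for the seminorm of a kernel. Cauchy-Schwarz is
  recovered from positivity on s R - t S, with s and t the crossed norms, or with one of them large
  if a norm vanishes.\<close>

lemma lform_sqrt_diff:
  assumes K: "kpsd C K" and R: "set R \<subseteq> C" and S: "set S \<subseteq> C"
  shows "\<bar>sqrt (Re (lform K R R)) - sqrt (Re (lform K S S))\<bar> \<le> sqrt (ldist2 K R S)"
proof (rule real_le_rsqrt)
  define A B X where "A = sqrt (Re (lform K R R))" and "B = sqrt (Re (lform K S S))"
    and "X = Re (lform K R S) + Re (lform K S R)"
  have A: "A \<ge> 0" "A\<^sup>2 = Re (lform K R R)" and B: "B \<ge> 0" "B\<^sup>2 = Re (lform K S S)"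
    using kpsd_lform[OF K R] kpsd_lform[OF K S] by (simp_all add: A_def B_def)
  have quad: "0 \<le> s\<^sup>2 * A\<^sup>2 - s * t * X + t\<^sup>2 * B\<^sup>2" for s t :: real
    using kpsd_append[OF K R S, of "complex_of_real s" "- complex_of_real t"]
    unfolding A(2) B(2) by (simp add: X_def power2_eq_square algebra_simps)
  have "X \<le> 2 * (A * B)"
  proof (cases "A = 0 \<or> B = 0")
    case True
    show ?thesis
    proof (rule ccontr)
      assume "\<not> X \<le> 2 * (A * B)"
      then have X: "X > 0" using True by auto
      show False
      proof (cases "A = 0")
        case True
        then show False
          using quad[of "(B\<^sup>2 + 1) / X" 1] X by simp
      next
        case False
        then show False
          using \<open>A = 0 \<or> B = 0\<close> quad[of 1 "(A\<^sup>2 + 1) / X"] X by simp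
      qed
    qed
  next
    case False
    then have "A * B > 0"
      using A B by (simp add: less_le)
    moreover have "A * B * X \<le> A * B * (2 * (A * B))"
      using quad[of B A] by (simp add: power2_eq_square algebra_simps)
    ultimately show ?thesis
      by (metis mult_le_cancel_left_pos)
  qed
  then have "(A - B)\<^sup>2 \<le> ldist2 K R S"
    by (simp add: ldist2_def power2_diff A B X_def)
  then show "\<bar>sqrt (Re (lform K R R)) - sqrt (Re (lform K S S))\<bar>\<^sup>2 \<le> ldist2 K R S"
    by (simp add: A_def B_def)
qed

lemma lform_diff: "lform (\<lambda>u v. K u v - L u v) R S = lform K R S - lform L R S"
  by (simp add: lform_def sum_list_subtractf)

lemma lform_cmult: "lform (\<lambda>u v. c * K u v) R S = c * lform K R S"
  by (simp add: lform_def sum_list_const_mult)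

lemma lform_sum: "lform (\<lambda>u v. \<Sum>k\<in>A. K k u v) R S = (\<Sum>k\<in>A. lform (K k) R S)"
  by (induction A rule: infinite_finite_induct) (simp_all add: lform_def sum_list_addf)

lemma tendsto_sum_list:
  fixes f :: "'b \<Rightarrow> 'c \<Rightarrow> complex"
  shows "(\<And>u. u \<in> set R \<Longrightarrow> ((\<lambda>L. f u L) \<longlongrightarrow> f' u) F) \<Longrightarrow> ((\<lambda>L. \<Sum>u\<leftarrow>R. f u L) \<longlongrightarrow> (\<Sum>u\<leftarrow>R. f' u)) F"
  by (induction R) (auto intro: tendsto_add)

lemma tendsto_lform:
  assumes "\<And>u v. u \<in> set R \<Longrightarrow> v \<in> set S \<Longrightarrow> ((\<lambda>L. K L u v) \<longlongrightarrow> K' u v) F"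
  shows "((\<lambda>L. lform (K L) R S) \<longlongrightarrow> lform K' R S) F"
  unfolding lform_def using assms by (intro tendsto_sum_list)

lemma l2_sum_list: "(\<And>u. u \<in> set R \<Longrightarrow> \<Phi> u \<in> l2 M) \<Longrightarrow> (\<lambda>x. \<Sum>u\<leftarrow>R. \<Phi> u x) \<in> l2 M"
  by (induction R) (auto intro: l2_add)

lemma ip_sum_list_left:
  assumes "\<And>u. u \<in> set R \<Longrightarrow> \<Phi> u \<in> l2 M" "g \<in> l2 M"
  shows "ip M (\<lambda>x. \<Sum>u\<leftarrow>R. \<Phi> u x) g = (\<Sum>u\<leftarrow>R. ip M (\<Phi> u) g)"
  using assms(1)
proof (induction R)
  case Nil
  then show ?case by (simp add: ip_def)
next
  case (Cons u R)
  then show ?case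
    using assms(2) by (simp add: ip_add_left l2_sum_list)
qed

lemma ip_sum_list_right:
  assumes "\<And>u. u \<in> set R \<Longrightarrow> \<Phi> u \<in> l2 M" "g \<in> l2 M"
  shows "ip M g (\<lambda>x. \<Sum>u\<leftarrow>R. \<Phi> u x) = (\<Sum>u\<leftarrow>R. ip M g (\<Phi> u))"
  using assms(1)
proof (induction R)
  case Nil
  then show ?case by (simp add: ip_def)
next
  case (Cons u R)
  then show ?case
    using assms(2) by (simp add: ip_add_right l2_sum_list)
qed

lemma lform_ip:
  assumes "\<And>u. u \<in> set R \<Longrightarrow> \<Phi> u \<in> l2 M" "\<And>v. v \<in> set S \<Longrightarrow> \<Phi> v \<in> l2 M"
  shows "lform (\<lambda>u v. ip M (\<Phi> u) (\<Phi> v)) R S = ip M (\<lambda>x. \<Sum>u\<leftarrow>R. \<Phi> u x) (\<lambda>x. \<Sum>v\<leftarrow>S. \<Phi> v x)"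
proof -
  have "ip M (\<lambda>x. \<Sum>u\<leftarrow>R. \<Phi> u x) (\<lambda>x. \<Sum>v\<leftarrow>S. \<Phi> v x) = (\<Sum>u\<leftarrow>R. ip M (\<Phi> u) (\<lambda>x. \<Sum>v\<leftarrow>S. \<Phi> v x))"
    using assms by (intro ip_sum_list_left l2_sum_list)
  also have "\<dots> = (\<Sum>u\<leftarrow>R. \<Sum>v\<leftarrow>S. ip M (\<Phi> u) (\<Phi> v))"
    using assms by (intro arg_cong[where f = sum_list] map_cong refl ip_sum_list_right)
  finally show ?thesis
    by (simp add: lform_def)
qed

lemma lform_rank1: "lform (\<lambda>u v. c u * cnj (c v)) R S = (\<Sum>u\<leftarrow>R. c u) * cnj (\<Sum>v\<leftarrow>S. c v)"
proof -
  have "(\<Sum>v\<leftarrow>S. cnj (c v)) = cnj (\<Sum>v\<leftarrow>S. c v)"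
    by (induction S) auto
  then show ?thesis
    by (simp add: lform_def sum_list_const_mult sum_list_mult_const)
qed

section \<open>Elementary tensors on the cube\<close>

abbreviation cube :: "nat \<Rightarrow> (nat \<Rightarrow> real) measure" where "cube d \<equiv> unit_cube d"

definition tens :: "nat \<Rightarrow> (nat \<Rightarrow> real \<Rightarrow> complex) \<Rightarrow> (nat \<Rightarrow> real) \<Rightarrow> complex" where
  "tens d g x = (\<Prod>i<d. g i (x i))"

interpretation cube: product_sigma_finite "\<lambda>_::nat. I01"
  by standard

lemma tens_integrable:
  assumes "\<And>i. i < d \<Longrightarrow> integrable I01 (g i)"
  shows "integrable (cube d) (tens d g)"
  unfolding tens_def unit_cube_def using assms by (intro cube.product_integrable_prod) auto

lemma tens_integral:
  assumes "\<And>i. i < d \<Longrightarrow> integrable I01 (g i)"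
  shows "integral\<^sup>L (cube d) (tens d g) = (\<Prod>i<d. integral\<^sup>L I01 (g i))"
  unfolding tens_def unit_cube_def using assms by (intro cube.product_integral_prod) auto

lemma tens_l2:
  assumes "\<And>i. i < d \<Longrightarrow> g i \<in> l2 I01"
  shows "tens d g \<in> l2 (cube d)"
proof -
  have "tens d g \<in> borel_measurable (cube d)"
    using assms by (intro borel_measurable_integrable tens_integrable l2_I01_integrable)
  moreover have "integrable (cube d) (\<lambda>x. \<Prod>i<d. (cmod (g i (x i)))\<^sup>2)"
    unfolding unit_cube_def using assms
    by (intro cube.product_integrable_prod[where f = "\<lambda>i x. (cmod (g i x))\<^sup>2"]) (auto simp: l2_iff)
  ultimately show ?thesis
    by (simp add: l2_iff tens_def prod_norm[symmetric] prod_power_distrib)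
qed

lemma ip_tens:
  assumes "\<And>i. i < d \<Longrightarrow> g i \<in> l2 I01" "\<And>i. i < d \<Longrightarrow> h i \<in> l2 I01"
  shows "ip (cube d) (tens d g) (tens d h) = (\<Prod>i<d. ip I01 (g i) (h i))"
proof -
  have "tens d g x * cnj (tens d h x) = tens d (\<lambda>i x. g i x * cnj (h i x)) x" for x
    by (simp add: tens_def prod.distrib)
  then have "ip (cube d) (tens d g) (tens d h) = integral\<^sup>L (cube d) (tens d (\<lambda>i x. g i x * cnj (h i x)))"
    by (simp add: ip_def)
  also have "\<dots> = (\<Prod>i<d. ip I01 (g i) (h i))"
    unfolding ip_def using assms by (intro tens_integral l2_integrable_ip)
  finally show ?thesis .
qed

lemma nrm_tens:
  assumes "\<And>i. i < d \<Longrightarrow> g i \<in> l2 I01"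
  shows "nrm (cube d) (tens d g) = (\<Prod>i<d. nrm I01 (g i))"
proof (rule power2_eq_imp_eq)
  have "complex_of_real ((nrm (cube d) (tens d g))\<^sup>2) = (\<Prod>i<d. ip I01 (g i) (g i))"
    unfolding ip_self_nrm[symmetric] by (rule ip_tens) (use assms in auto)
  also have "\<dots> = complex_of_real ((\<Prod>i<d. nrm I01 (g i))\<^sup>2)"
    by (simp add: ip_self_nrm prod_power_distrib)
  finally have "complex_of_real ((nrm (cube d) (tens d g))\<^sup>2) = complex_of_real ((\<Prod>i<d. nrm I01 (g i))\<^sup>2)" .
  then show "(nrm (cube d) (tens d g))\<^sup>2 = (\<Prod>i<d. nrm I01 (g i))\<^sup>2"
    by (simp only: of_real_eq_iff)
qed (simp_all add: prod_nonneg)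

subsection \<open>Truncation of the tensor Legendre expansion\<close>

lemma legwt_ge_1: "1 \<le> legwt n"
proof -
  have lam: "1 \<le> lam" by (simp add: lam_def)
  consider "n < 3" | "n \<ge> 3" by linarith
  then show ?thesis
  proof cases
    case 1
    then have "n = 0 \<or> n = 1 \<or> n = 2" by auto
    then show ?thesis using lam by (auto simp: legwt_def)
  next
    case 2
    have "10 \<le> (real n - 1) * (real n + 2)"
      using 2 mult_mono[of 2 "real n - 1" 5 "real n + 2"] by simp
    then have "10\<^sup>2 \<le> ((real n - 1) * (real n + 2))\<^sup>2"
      by (rule power_mono) simp
    then have "1 * 86 \<le> lam * ((real n - 1) * (real n + 2))\<^sup>2"
      using lam by (intro mult_mono) auto
    with 2 show ?thesis by (simp add: legwt_def)
  qed
qed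

lemma legwt_mono: "3 \<le> N \<Longrightarrow> N \<le> n \<Longrightarrow> legwt N \<le> legwt n"
  unfolding legwt_def lam_def by (auto intro!: divide_right_mono mult_left_mono power_mono mult_mono)

lemma legwt_unbounded: "\<exists>N\<ge>3. t \<le> legwt N"
proof -
  obtain N :: nat where N: "real N \<ge> max 3 (86 * t)"
    using real_arch_simple by blast
  then have N3: "N \<ge> 3" by simp
  have "real N \<le> 1 * (real N + 2)"
    by simp
  also have "\<dots> \<le> (real N - 1) * (real N + 2)"
    using N3 by (intro mult_right_mono) auto
  also have "\<dots> \<le> ((real N - 1) * (real N + 2))\<^sup>2"
    using N3 calculation by (intro self_le_power) auto
  also have "\<dots> \<le> lam * ((real N - 1) * (real N + 2))\<^sup>2"
    using mult_right_mono[of 1 lam "((real N - 1) * (real N + 2))\<^sup>2"] by (simp add: lam_def)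
  finally have "t \<le> legwt N"
    using N N3 by (simp add: legwt_def)
  with N3 show ?thesis by blast
qed

text \<open>To keep the index set finite, all coefficients from N on are lumped together and given
  the smallest of their weights. The weights increase from 3 on, and Parseval evaluates the
  lump.\<close>

lemma leg_energy_tail:
  assumes l2: "h \<in> l2 I01" "g0 \<in> l2 I01" "g1 \<in> l2 I01" "g2 \<in> l2 I01"
    and w: "is_weak_deriv 0 h g0" "is_weak_deriv 1 h g1" "is_weak_deriv 2 h g2"
    and N: "3 \<le> N"
  shows "(\<Sum>n<N. legwt n * (cmod (lc h n))\<^sup>2) + legwt N * ((nrm I01 h)\<^sup>2 - (\<Sum>n<N. (cmod (lc h n))\<^sup>2))
    \<le> (nrm I01 g0)\<^sup>2 + (nrm I01 g1)\<^sup>2 + (nrm I01 g2)\<^sup>2" (is "_ \<le> ?B")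
proof -
  have w0: "ip I01 h (rfun \<phi>) = ip I01 g0 (rfun \<phi>)" if "test_function \<phi>" for \<phi>
    using w(1) that by (simp add: is_weak_deriv_iff)
  have w1: "ip I01 h (rfun (deriv \<phi>)) = - ip I01 g1 (rfun \<phi>)" if "test_function \<phi>" for \<phi>
    using w(2) that by (simp add: is_weak_deriv_iff)
  \<comment> \<open>Order 2 relates \<open>h\<close> directly to \<open>g2\<close>. Testing the
    relation of order 1 with \<open>deriv\<close> of the test function turns this into a relation
    between \<open>g1\<close> and \<open>g2\<close>.\<close>
  have w2: "ip I01 g1 (rfun (deriv \<phi>)) = - ip I01 g2 (rfun \<phi>)" if "test_function \<phi>" for \<phi>
    using w(3) that w1[OF test_function_deriv[OF that]]
    by (simp add: is_weak_deriv_iff numeral_2_eq_2)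
  have lc0: "lc g0 n = lc h n" for n
    unfolding lc_def by (rule ip_pfun_eqI) (use l2 w0 in auto)
  let ?c = "\<lambda>n. (cmod (lc h n))\<^sup>2"
  have part: "(\<Sum>n<M. legwt n * ?c n) \<le> ?B" for M
  proof -
    have "(\<Sum>n<M. ?c n) \<le> (nrm I01 g0)\<^sup>2"
      unfolding lc0[symmetric] unfolding lc_def using l2 by (intro bessel) (auto simp: ip_leg)
    moreover have "(\<Sum>n<M. (legwt n - 1) * ?c n) \<le> (nrm I01 g1)\<^sup>2 + (nrm I01 g2)\<^sup>2"
      by (rule leg_energy[OF l2(1) l2(3) l2(4) w1 w2])
    ultimately show ?thesis
      by (simp add: left_diff_distrib sum_subtractf)
  qed
  have "(\<Sum>n<N. legwt n * ?c n) + legwt N * ((\<Sum>n<M. ?c n) - (\<Sum>n<N. ?c n)) \<le> ?B" if M: "M \<ge> N" for M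
  proof -
    have split: "(\<Sum>n<M. f n) = (\<Sum>n<N. f n) + (\<Sum>n\<in>{N..<M}. f n)" for f :: "nat \<Rightarrow> real"
      using M by (simp add: sum.atLeastLessThan_concat lessThan_atLeast0)
    have "legwt N * (\<Sum>n\<in>{N..<M}. ?c n) \<le> (\<Sum>n\<in>{N..<M}. legwt n * ?c n)"
      unfolding sum_distrib_left using N by (intro sum_mono mult_right_mono legwt_mono) auto
    with part[of M] show ?thesis
      by (simp add: split)
  qed
  moreover have "(\<lambda>M. \<Sum>n<M. ?c n) \<longlonglongrightarrow> (nrm I01 h)\<^sup>2"
    using lc_sums[OF l2(1)] by (simp add: sums_def)
  then have "(\<lambda>M. (\<Sum>n<N. legwt n * ?c n) + legwt N * ((\<Sum>n<M. ?c n) - (\<Sum>n<N. ?c n)))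
      \<longlonglongrightarrow> (\<Sum>n<N. legwt n * ?c n) + legwt N * ((nrm I01 h)\<^sup>2 - (\<Sum>n<N. ?c n))"
    by (intro tendsto_intros)
  ultimately show ?thesis
    by (intro LIMSEQ_le_const2) auto
qed

lemma qform_ip:
  assumes "\<And>i. i < m \<Longrightarrow> F i \<in> l2 M"
  shows "qform m a (\<lambda>i j. ip M (F i) (F j)) = complex_of_real ((nrm M (\<lambda>x. \<Sum>i<m. a i * F i x))\<^sup>2)"
  unfolding ip_self_nrm[symmetric] qform_def using assms by (subst ip_sum_sum) auto

lemma qform_rank1: "qform m a (\<lambda>i j. c i * cnj (c j)) = complex_of_real ((cmod (\<Sum>i<m. a i * c i))\<^sup>2)"
  by (simp only: qform_def complex_norm_square cnj_sum complex_cnj_mult sum_product mult_ac)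

text \<open>Splits the L2 Gram kernel into N rank-one kernels and one residual kernel, used at index
  N. The product over the coordinates then expands over a finite box of multi-indices.\<close>

definition legpart :: "nat \<Rightarrow> nat \<Rightarrow> (real \<Rightarrow> complex) \<Rightarrow> (real \<Rightarrow> complex) \<Rightarrow> complex" where
  "legpart N n u v = (if n < N then lc u n * cnj (lc v n)
     else ip I01 u v - (\<Sum>k<N. lc u k * cnj (lc v k)))"

lemma sum_legpart: "(\<Sum>n\<le>N. legpart N n u v) = ip I01 u v"
proof -
  have "{..N} = insert N {..<N}" by auto
  then show ?thesis by (simp add: legpart_def)
qed

lemma schur_legpart:
  assumes x: "\<And>i. i < m \<Longrightarrow> x i \<in> l2 I01"
  shows "schur m (\<lambda>i j. legpart N n (x i) (x j))"
proof (cases "n < N")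
  case True
  then show ?thesis
    by (simp add: legpart_def schur_rank1)
next
  case False
  let ?r = "\<lambda>u x. u x - (\<Sum>k<N. ip I01 u (pfun (leg k)) * pfun (leg k) x)"
  have eq: "ip I01 (?r (x i)) (?r (x j)) = legpart N n (x i) (x j)" if "i < m" "j < m" for i j
    using False x that
    by (subst ip_residual) (auto simp: ip_leg legpart_def lc_def)
  have "schur m (\<lambda>i j. ip I01 (?r (x i)) (?r (x j)))"
    using x by (intro schur_ip l2_minus l2_lincomb) auto
  then show ?thesis
    using eq unfolding schur_def by (auto intro: psd_cong)
qed

text \<open>
  \<open>D l\<close> chooses the weak derivatives of order \<open>l\<close>; for finite smoothness \<open>s\<close> it is zero for \<open>l > s\<close>. It is
  linear only almost everywhere, so the tensor arguments avoid using linearity.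
\<close>

locale sobolev_space =
  fixes H :: "real hspace" and D :: "nat \<Rightarrow> (real \<Rightarrow> complex) \<Rightarrow> (real \<Rightarrow> complex)"
  assumes carrier_l2: "f \<in> hcarrier H \<Longrightarrow> f \<in> l2 I01"
    and D_l2: "f \<in> hcarrier H \<Longrightarrow> D l f \<in> l2 I01"
    and D_weak: "(\<forall>f\<in>hcarrier H. is_weak_deriv l f (D l f)) \<or> (\<forall>f\<in>hcarrier H. D l f = (\<lambda>x. 0))"
    and D_weak_le_2: "l \<le> 2 \<Longrightarrow> f \<in> hcarrier H \<Longrightarrow> is_weak_deriv l f (D l f)"
    and D_summable: "f \<in> hcarrier H \<Longrightarrow> summable (\<lambda>l. (nrm I01 (D l f))\<^sup>2)"
    and inner: "f \<in> hcarrier H \<Longrightarrow> g \<in> hcarrier H \<Longrightarrow> hinner H f g = (\<Sum>l. ip I01 (D l f) (D l g))"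
begin

lemma inner_sums:
  assumes "f \<in> hcarrier H" "g \<in> hcarrier H"
  shows "(\<lambda>l. ip I01 (D l f) (D l g)) sums hinner H f g"
proof -
  have "summable (\<lambda>l. ip I01 (D l f) (D l g))"
  proof (rule summable_comparison_test')
    show "summable (\<lambda>l. (nrm I01 (D l f))\<^sup>2 + (nrm I01 (D l g))\<^sup>2)"
      using assms by (intro summable_add D_summable)
    fix l
    have "cmod (ip I01 (D l f) (D l g)) \<le> nrm I01 (D l f) * nrm I01 (D l g)"
      using assms by (intro ip_le D_l2)
    also have "\<dots> \<le> (nrm I01 (D l f))\<^sup>2 + (nrm I01 (D l g))\<^sup>2"
      using sum_squares_bound[of "nrm I01 (D l f)" "nrm I01 (D l g)"]
        mult_nonneg_nonneg[OF nrm_nonneg nrm_nonneg, of I01 "D l f" I01 "D l g"] by linarith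
    finally show "norm (ip I01 (D l f) (D l g)) \<le> (nrm I01 (D l f))\<^sup>2 + (nrm I01 (D l g))\<^sup>2" .
  qed
  then show ?thesis
    using assms by (simp add: inner summable_sums)
qed

lemma schur_inner:
  assumes x: "\<And>i. i < m \<Longrightarrow> x i \<in> hcarrier H"
  shows "schur m (\<lambda>i j. hinner H (x i) (x j))"
proof (rule schur_lim)
  show "schur m (\<lambda>i j. \<Sum>l<L. ip I01 (D l (x i)) (D l (x j)))" for L
    using x by (intro schur_sum schur_ip D_l2)
  show "(\<lambda>L. \<Sum>l<L. ip I01 (D l (x i)) (D l (x j))) \<longlonglongrightarrow> hinner H (x i) (x j)" if "i < m" "j < m" for i j
    using inner_sums[OF x[OF that(1)] x[OF that(2)]] by (simp add: sums_def)
qed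

lemma psd_inner_legpart:
  assumes x: "\<And>i. i < m \<Longrightarrow> x i \<in> hcarrier H" and N: "3 \<le> N"
  shows "psd m (\<lambda>i j. hinner H (x i) (x j)
    - (\<Sum>n\<le>N. complex_of_real (legwt n) * legpart N n (x i) (x j)))"
  unfolding psd_def
proof
  fix a
  \<comment> \<open>\<open>D l\<close> need not be linear, so \<open>g l\<close> may differ from the
    weak derivative chosen for h; it is still one of them, which is all that
    \<open>leg_energy_tail\<close> asks for.\<close>
  define h where "h = (\<lambda>t. \<Sum>i<m. a i * x i t)"
  define g where "g = (\<lambda>l t. \<Sum>i<m. a i * D l (x i) t)"
  have h: "h \<in> l2 I01" and g: "g l \<in> l2 I01" for l
    unfolding h_def g_def using x carrier_l2 D_l2 by (auto intro!: l2_lincomb)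
  have weak: "is_weak_deriv l h (g l)" if "l \<le> 2" for l
    unfolding is_weak_deriv_iff
  proof (intro allI impI)
    fix \<phi> assume \<phi>: "test_function \<phi>"
    have l2: "rfun \<phi> \<in> l2 I01" "rfun ((deriv ^^ l) \<phi>) \<in> l2 I01"
      using rfun_test_l2[OF \<phi>, of 0] rfun_test_l2[OF \<phi>, of l] by auto
    have "ip I01 h (rfun ((deriv ^^ l) \<phi>)) = (\<Sum>i<m. a i * ip I01 (x i) (rfun ((deriv ^^ l) \<phi>)))"
      unfolding h_def using x l2 carrier_l2 by (intro ip_sum_left) auto
    also have "\<dots> = (\<Sum>i<m. a i * ((-1) ^ l * ip I01 (D l (x i)) (rfun \<phi>)))"
      using D_weak_le_2[OF that x] \<phi> by (intro sum.cong refl) (auto simp: is_weak_deriv_iff)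
    also have "\<dots> = (-1) ^ l * (\<Sum>i<m. a i * ip I01 (D l (x i)) (rfun \<phi>))"
      by (simp add: sum_distrib_left mult_ac)
    also have "(\<Sum>i<m. a i * ip I01 (D l (x i)) (rfun \<phi>)) = ip I01 (g l) (rfun \<phi>)"
      unfolding g_def using x l2 D_l2 by (intro ip_sum_left[symmetric]) auto
    finally show "ip I01 h (rfun ((deriv ^^ l) \<phi>)) = (-1) ^ l * ip I01 (g l) (rfun \<phi>)" .
  qed
  have lch: "lc h n = (\<Sum>i<m. a i * lc (x i) n)" for n
    unfolding lc_def h_def using x carrier_l2 by (intro ip_sum_left) auto
  have rank: "qform m a (\<lambda>i j. lc (x i) n * cnj (lc (x j) n)) = complex_of_real ((cmod (lc h n))\<^sup>2)" for n
    by (simp add: qform_rank1 lch)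
  have ipq: "qform m a (\<lambda>i j. ip I01 (x i) (x j)) = complex_of_real ((nrm I01 h)\<^sup>2)"
    unfolding h_def using x carrier_l2 by (intro qform_ip) auto
  have part: "qform m a (\<lambda>i j. legpart N n (x i) (x j)) = complex_of_real (if n < N then (cmod (lc h n))\<^sup>2
      else (nrm I01 h)\<^sup>2 - (\<Sum>k<N. (cmod (lc h k))\<^sup>2))" for n
    by (simp add: legpart_def rank ipq qform_diff qform_sum)
  have "Re (qform m a (\<lambda>i j. \<Sum>n\<le>N. complex_of_real (legwt n) * legpart N n (x i) (x j)))
      = (\<Sum>n\<le>N. legwt n * (if n < N then (cmod (lc h n))\<^sup>2 else (nrm I01 h)\<^sup>2 - (\<Sum>k<N. (cmod (lc h k))\<^sup>2)))"
    by (simp only: qform_sum qform_cmult part of_real_mult[symmetric] Re_sum Re_complex_of_real)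
  also have "\<dots> = (\<Sum>n<N. legwt n * (cmod (lc h n))\<^sup>2) + legwt N * ((nrm I01 h)\<^sup>2 - (\<Sum>n<N. (cmod (lc h n))\<^sup>2))"
  proof -
    have "{..N} = insert N {..<N}" by auto
    then show ?thesis by simp
  qed
  also have "\<dots> \<le> (nrm I01 (g 0))\<^sup>2 + (nrm I01 (g 1))\<^sup>2 + (nrm I01 (g 2))\<^sup>2"
    by (intro leg_energy_tail h g weak N) auto
  also have "\<dots> = (\<Sum>l<3. (nrm I01 (g l))\<^sup>2)"
    by (simp add: eval_nat_numeral)
  \<comment> \<open>Dropping all orders above 2 treats every smoothness, finite or infinite, at
    once.\<close>
  also have "\<dots> \<le> Re (qform m a (\<lambda>i j. hinner H (x i) (x j)))"
  proof (rule LIMSEQ_le_const)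
    show "(\<lambda>L. Re (qform m a (\<lambda>i j. \<Sum>l<L. ip I01 (D l (x i)) (D l (x j)))))
        \<longlonglongrightarrow> Re (qform m a (\<lambda>i j. hinner H (x i) (x j)))"
      using inner_sums x by (intro tendsto_Re tendsto_qform) (auto simp: sums_def)
    have "qform m a (\<lambda>i j. \<Sum>l<L. ip I01 (D l (x i)) (D l (x j))) = (\<Sum>l<L. complex_of_real ((nrm I01 (g l))\<^sup>2))" for L
      unfolding qform_sum g_def using x D_l2 by (intro sum.cong refl qform_ip) auto
    then show "\<exists>N. \<forall>L\<ge>N. (\<Sum>l<3. (nrm I01 (g l))\<^sup>2)
        \<le> Re (qform m a (\<lambda>i j. \<Sum>l<L. ip I01 (D l (x i)) (D l (x j))))"
      by (intro exI[of _ 3]) (auto intro!: sum_mono2)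
  qed
  finally show "0 \<le> Re (qform m a (\<lambda>i j. hinner H (x i) (x j)
      - (\<Sum>n\<le>N. complex_of_real (legwt n) * legpart N n (x i) (x j))))"
    by (simp add: qform_diff)
qed

abbreviation factors :: "nat \<Rightarrow> (nat \<Rightarrow> real \<Rightarrow> complex) set" where
  "factors d \<equiv> {u. \<forall>i<d. u i \<in> hcarrier H}"

definition tker :: "nat \<Rightarrow> (nat \<Rightarrow> real \<Rightarrow> complex) \<Rightarrow> (nat \<Rightarrow> real \<Rightarrow> complex) \<Rightarrow> complex" where
  "tker d u v = (\<Prod>i<d. hinner H (u i) (v i))"

lemma tensor_inner_lform: "tensor_inner d H R S = lform (tker d) R S"
  by (simp add: tensor_inner_def lform_def tker_def)

lemma tensor_dist_ldist2: "tensor_dist d H R S = sqrt (ldist2 (tker d) R S)"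
  by (simp add: tensor_dist_def ldist2_def tensor_inner_lform)

lemma tensors_iff: "R \<in> tensors d H \<longleftrightarrow> set R \<subseteq> factors d"
  by (auto simp: tensors_def)

definition basis :: "nat \<Rightarrow> (nat \<Rightarrow> nat) \<Rightarrow> (nat \<Rightarrow> real) \<Rightarrow> complex" where
  "basis d k = tens d (\<lambda>i. pfun (leg (k i)))"

lemma kpsd_tker: "kpsd (factors d) (tker d)"
proof (rule kpsdI)
  fix T assume T: "set T \<subseteq> factors d"
  then have "T ! i \<in> factors d" if "i < length T" for i
    using that nth_mem by blast
  then show "psd (length T) (\<lambda>i j. tker d (T ! i) (T ! j))"
    unfolding tker_def by (intro schur_psd schur_prod schur_inner) auto
qed

text \<open>In each coordinate \<open>hinner H\<close> dominates the weighted sum of the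
  \<open>legpart\<close> kernels. After \<open>psd_prod_diff\<close> the product of these sums
  expands over the box; lowering the product of the weights to t outside I and to 0 on I leaves
  nonnegative differences. The same expansion with all weights 1 is the L2 kernel, whose terms in I
  have rank one since the entries there stay below N.\<close>

lemma kpsd_truncation:
  assumes N: "3 \<le> N" and I: "I \<subseteq> PiE {..<d} (\<lambda>_. {..<N})" and t: "0 \<le> t"
    and le: "\<And>k. k \<in> PiE {..<d} (\<lambda>_. {..N}) \<Longrightarrow> k \<notin> I \<Longrightarrow> t \<le> (\<Prod>i<d. legwt (k i))"
  shows "kpsd (factors d) (\<lambda>u v. tker d u v - complex_of_real t * ((\<Prod>i<d. ip I01 (u i) (v i))
    - (\<Sum>k\<in>I. (\<Prod>i<d. lc (u i) (k i)) * cnj (\<Prod>i<d. lc (v i) (k i)))))"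
proof (rule kpsdI)
  fix T assume "set T \<subseteq> factors d"
  then have x: "(T ! a) i \<in> hcarrier H" if "a < length T" "i < d" for a i
    using that nth_mem by blast
  let ?m = "length T" and ?P = "PiE {..<d} (\<lambda>_. {..N})"
  let ?G' = "\<lambda>i a b. \<Sum>n\<le>N. complex_of_real (legwt n) * legpart N n ((T ! a) i) ((T ! b) i)"
  let ?Q = "\<lambda>k a b. \<Prod>i<d. legpart N (k i) ((T ! a) i) ((T ! b) i)"
  have wt0: "0 \<le> legwt n" for n
    using legwt_ge_1[of n] by simp
  have fin: "finite ?P"
    by (intro finite_PiE) auto
  have IP: "I \<subseteq> ?P"
    using I by (force simp: PiE_def Pi_def)
  have "psd ?m (\<lambda>a b. (\<Prod>i<d. hinner H ((T ! a) i) ((T ! b) i)) - (\<Prod>i<d. ?G' i a b))"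
    using x carrier_l2 N wt0
    by (intro psd_prod_diff schur_inner schur_sum schur_cmult schur_legpart psd_inner_legpart) auto
  moreover have "psd ?m (\<lambda>a b. \<Sum>k\<in>?P. complex_of_real ((\<Prod>i<d. legwt (k i)) - (if k \<in> I then 0 else t)) * ?Q k a b)"
  proof (rule psd_sum)
    fix k assume k: "k \<in> ?P"
    have "0 \<le> (\<Prod>i<d. legwt (k i)) - (if k \<in> I then 0 else t)"
      using le[OF k] wt0 by (auto intro: prod_nonneg)
    moreover have "psd ?m (?Q k)"
      using x carrier_l2 by (intro schur_psd schur_prod schur_legpart) auto
    ultimately show "psd ?m (\<lambda>a b. complex_of_real ((\<Prod>i<d. legwt (k i)) - (if k \<in> I then 0 else t)) * ?Q k a b)"
      by (rule psd_cmult)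
  qed
  ultimately have "psd ?m (\<lambda>a b. ((\<Prod>i<d. hinner H ((T ! a) i) ((T ! b) i)) - (\<Prod>i<d. ?G' i a b))
     + (\<Sum>k\<in>?P. complex_of_real ((\<Prod>i<d. legwt (k i)) - (if k \<in> I then 0 else t)) * ?Q k a b))"
    by (rule psd_add)
  then show "psd ?m (\<lambda>a b. tker d (T ! a) (T ! b) - complex_of_real t * ((\<Prod>i<d. ip I01 ((T ! a) i) ((T ! b) i))
    - (\<Sum>k\<in>I. (\<Prod>i<d. lc ((T ! a) i) (k i)) * cnj (\<Prod>i<d. lc ((T ! b) i) (k i)))))"
  proof (rule psd_cong)
    fix a b
    have 1: "(\<Prod>i<d. ?G' i a b) = (\<Sum>k\<in>?P. complex_of_real (\<Prod>i<d. legwt (k i)) * ?Q k a b)"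
      by (subst prod_sum_PiE) (auto simp: prod.distrib)
    have "(\<Prod>i<d. ip I01 ((T ! a) i) ((T ! b) i)) = (\<Prod>i<d. \<Sum>n\<le>N. legpart N n ((T ! a) i) ((T ! b) i))"
      by (simp add: sum_legpart)
    also have "\<dots> = (\<Sum>k\<in>?P. ?Q k a b)"
      by (subst prod_sum_PiE) auto
    also have "\<dots> = (\<Sum>k\<in>?P - I. ?Q k a b) + (\<Sum>k\<in>I. ?Q k a b)"
      using sum.subset_diff[OF IP fin] by blast
    finally have 2: "(\<Prod>i<d. ip I01 ((T ! a) i) ((T ! b) i)) = (\<Sum>k\<in>?P - I. ?Q k a b) + (\<Sum>k\<in>I. ?Q k a b)" .
    have 3: "?Q k a b = (\<Prod>i<d. lc ((T ! a) i) (k i)) * cnj (\<Prod>i<d. lc ((T ! b) i) (k i))" if "k \<in> I" for k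
    proof -
      have "k i < N" if "i < d" for i
        using \<open>k \<in> I\<close> I that by (auto simp: PiE_def Pi_def)
      then show ?thesis
        by (simp add: legpart_def prod.distrib)
    qed
    have 4: "(\<Sum>k\<in>?P. complex_of_real (if k \<in> I then 0 else t) * ?Q k a b)
        = complex_of_real t * (\<Sum>k\<in>?P - I. ?Q k a b)"
      unfolding sum_distrib_left using fin by (intro sum.mono_neutral_cong_right) auto
    show "((\<Prod>i<d. hinner H ((T ! a) i) ((T ! b) i)) - (\<Prod>i<d. ?G' i a b))
     + (\<Sum>k\<in>?P. complex_of_real ((\<Prod>i<d. legwt (k i)) - (if k \<in> I then 0 else t)) * ?Q k a b)
     = tker d (T ! a) (T ! b) - complex_of_real t * ((\<Prod>i<d. ip I01 ((T ! a) i) ((T ! b) i))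
    - (\<Sum>k\<in>I. (\<Prod>i<d. lc ((T ! a) i) (k i)) * cnj (\<Prod>i<d. lc ((T ! b) i) (k i))))"
      unfolding 1 2 tker_def of_real_diff left_diff_distrib sum_subtractf 4
      using 3 by (simp add: algebra_simps)
  qed
qed

lemma tensor_fun_tens: "tensor_fun d R = (\<lambda>x. \<Sum>u\<leftarrow>R. tens d u x)"
  by (simp add: tensor_fun_def tens_def fun_eq_iff)

lemma tensor_fun_l2: "set R \<subseteq> factors d \<Longrightarrow> tensor_fun d R \<in> l2 (cube d)"
  unfolding tensor_fun_tens using carrier_l2 by (intro l2_sum_list tens_l2) auto

lemma basis_l2: "basis d k \<in> l2 (cube d)"
  unfolding basis_def by (intro tens_l2) simp

lemma ip_tensor_fun_basis:
  assumes "set R \<subseteq> factors d"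
  shows "ip (cube d) (tensor_fun d R) (basis d k) = (\<Sum>u\<leftarrow>R. \<Prod>i<d. lc (u i) (k i))"
proof -
  have "ip (cube d) (tensor_fun d R) (basis d k) = (\<Sum>u\<leftarrow>R. ip (cube d) (tens d u) (basis d k))"
    unfolding tensor_fun_tens using assms carrier_l2 by (intro ip_sum_list_left tens_l2 basis_l2) auto
  also have "\<dots> = (\<Sum>u\<leftarrow>R. \<Prod>i<d. lc (u i) (k i))"
    unfolding basis_def lc_def using assms carrier_l2
    by (intro arg_cong[where f = sum_list] map_cong refl ip_tens) auto
  finally show ?thesis .
qed

lemma tensor_truncation:
  assumes N: "3 \<le> N" and I: "I \<subseteq> PiE {..<d} (\<lambda>_. {..<N})" and t: "0 \<le> t"
    and le: "\<And>k. k \<in> PiE {..<d} (\<lambda>_. {..N}) \<Longrightarrow> k \<notin> I \<Longrightarrow> t \<le> (\<Prod>i<d. legwt (k i))"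
    and R: "set R \<subseteq> factors d"
  shows "t * ((nrm (cube d) (tensor_fun d R))\<^sup>2 - (\<Sum>k\<in>I. (cmod (ip (cube d) (tensor_fun d R) (basis d k)))\<^sup>2))
    \<le> Re (tensor_inner d H R R)"
proof -
  have "lform (\<lambda>u v. \<Prod>i<d. ip I01 (u i) (v i)) R R = lform (\<lambda>u v. ip (cube d) (tens d u) (tens d v)) R R"
    unfolding lform_def using R carrier_l2
    by (intro arg_cong[where f = sum_list] map_cong refl ip_tens[symmetric]) auto
  also have "\<dots> = complex_of_real ((nrm (cube d) (tensor_fun d R))\<^sup>2)"
    unfolding ip_self_nrm[symmetric] tensor_fun_tens using R carrier_l2 by (intro lform_ip tens_l2) auto
  finally have 1: "lform (\<lambda>u v. \<Prod>i<d. ip I01 (u i) (v i)) R R = complex_of_real ((nrm (cube d) (tensor_fun d R))\<^sup>2)" .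
  have 2: "lform (\<lambda>u v. (\<Prod>i<d. lc (u i) (k i)) * cnj (\<Prod>i<d. lc (v i) (k i))) R R
      = complex_of_real ((cmod (ip (cube d) (tensor_fun d R) (basis d k)))\<^sup>2)" for k
    unfolding lform_rank1[where c = "\<lambda>u. \<Prod>i<d. lc (u i) (k i)"] ip_tensor_fun_basis[OF R]
    by (rule complex_norm_square[symmetric])
  have "0 \<le> Re (lform (\<lambda>u v. tker d u v - complex_of_real t * ((\<Prod>i<d. ip I01 (u i) (v i))
    - (\<Sum>k\<in>I. (\<Prod>i<d. lc (u i) (k i)) * cnj (\<Prod>i<d. lc (v i) (k i))))) R R)"
    by (rule kpsd_lform[OF kpsd_truncation[OF N I t le] R])
  then show ?thesis
    unfolding lform_diff lform_cmult lform_sum 1 2 tensor_inner_lform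
    by (simp flip: of_real_sum of_real_diff of_real_mult)
qed

end

subsection \<open>The completed tensor power\<close>

lemma tens_upd: "j < d \<Longrightarrow> tens d (g(j := h)) x = h (x j) * (\<Prod>i\<in>{..<d} - {j}. g i (x i))"
  unfolding tens_def by (subst prod.remove[of _ j]) (auto intro!: prod.cong)

lemma nrm_uminus: "nrm M (\<lambda>x. - f x) = nrm M f"
  using nrm_cmult[of M "-1" f] by simp

context sobolev_space
begin

definition dtens :: "nat \<Rightarrow> (nat \<Rightarrow> nat) \<Rightarrow> (nat \<Rightarrow> real \<Rightarrow> complex) \<Rightarrow> (nat \<Rightarrow> real) \<Rightarrow> complex" where
  "dtens d \<alpha> u = tens d (\<lambda>i. D (\<alpha> i) (u i))"

definition dfun :: "nat \<Rightarrow> (nat \<Rightarrow> nat) \<Rightarrow> (nat \<Rightarrow> real \<Rightarrow> complex) list \<Rightarrow> (nat \<Rightarrow> real) \<Rightarrow> complex" where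
  "dfun d \<alpha> R x = (\<Sum>u\<leftarrow>R. dtens d \<alpha> u x)"

abbreviation index_box :: "nat \<Rightarrow> nat \<Rightarrow> (nat \<Rightarrow> nat) set" where
  "index_box d L \<equiv> PiE {..<d} (\<lambda>_. {..<L})"

lemma finite_index_box: "finite (index_box d L)"
  by (intro finite_PiE) auto

lemma index_box_mono: "L \<le> L' \<Longrightarrow> index_box d L \<subseteq> index_box d L'"
  by (force simp: PiE_def Pi_def)

lemma dtens_l2: "u \<in> factors d \<Longrightarrow> dtens d \<alpha> u \<in> l2 (cube d)"
  unfolding dtens_def using D_l2 by (intro tens_l2) auto

lemma dfun_l2: "set R \<subseteq> factors d \<Longrightarrow> dfun d \<alpha> R \<in> l2 (cube d)"
  unfolding dfun_def[abs_def] by (intro l2_sum_list dtens_l2) auto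

text \<open>The tensor inner product as a sum over all mixed derivatives, possibly infinitely many.
  Summation over boxes is used because it factors into partial sums of the one-dimensional
  series.\<close>

lemma tendsto_tker:
  assumes "u \<in> factors d" "v \<in> factors d"
  shows "(\<lambda>L. \<Sum>\<alpha>\<in>index_box d L. ip (cube d) (dtens d \<alpha> u) (dtens d \<alpha> v)) \<longlonglongrightarrow> tker d u v"
proof -
  have "(\<Sum>\<alpha>\<in>index_box d L. ip (cube d) (dtens d \<alpha> u) (dtens d \<alpha> v))
      = (\<Prod>i<d. \<Sum>l<L. ip I01 (D l (u i)) (D l (v i)))" for L
  proof -
    have "(\<Sum>\<alpha>\<in>index_box d L. ip (cube d) (dtens d \<alpha> u) (dtens d \<alpha> v))
        = (\<Sum>\<alpha>\<in>index_box d L. \<Prod>i<d. ip I01 (D (\<alpha> i) (u i)) (D (\<alpha> i) (v i)))"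
      unfolding dtens_def using assms D_l2 by (intro sum.cong refl ip_tens) auto
    also have "\<dots> = (\<Prod>i<d. \<Sum>l<L. ip I01 (D l (u i)) (D l (v i)))"
      by (subst prod_sum_PiE) auto
    finally show ?thesis .
  qed
  moreover have "(\<lambda>L. \<Prod>i<d. \<Sum>l<L. ip I01 (D l (u i)) (D l (v i))) \<longlonglongrightarrow> tker d u v"
    unfolding tker_def using inner_sums assms by (intro tendsto_prod) (auto simp: sums_def)
  ultimately show ?thesis by simp
qed

lemma tendsto_lform_tker:
  assumes "set R \<subseteq> factors d" "set S \<subseteq> factors d"
  shows "(\<lambda>L. \<Sum>\<alpha>\<in>index_box d L. ip (cube d) (dfun d \<alpha> R) (dfun d \<alpha> S)) \<longlonglongrightarrow> lform (tker d) R S"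
proof -
  have "(\<lambda>L. lform (\<lambda>u v. \<Sum>\<alpha>\<in>index_box d L. ip (cube d) (dtens d \<alpha> u) (dtens d \<alpha> v)) R S) \<longlonglongrightarrow> lform (tker d) R S"
    using assms by (intro tendsto_lform tendsto_tker) auto
  moreover have "lform (\<lambda>u v. ip (cube d) (dtens d \<alpha> u) (dtens d \<alpha> v)) R S
      = ip (cube d) (dfun d \<alpha> R) (dfun d \<alpha> S)" for \<alpha>
    unfolding dfun_def[abs_def] using assms by (intro lform_ip dtens_l2) auto
  ultimately show ?thesis
    by (simp add: lform_sum)
qed

lemma tendsto_lform_self:
  assumes R: "set R \<subseteq> factors d"
  shows "(\<lambda>L. \<Sum>\<alpha>\<in>index_box d L. (nrm (cube d) (dfun d \<alpha> R))\<^sup>2) \<longlonglongrightarrow> Re (lform (tker d) R R)"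
    and "Im (lform (tker d) R R) = 0"
proof -
  have lim: "(\<lambda>L. complex_of_real (\<Sum>\<alpha>\<in>index_box d L. (nrm (cube d) (dfun d \<alpha> R))\<^sup>2)) \<longlonglongrightarrow> lform (tker d) R R"
    using tendsto_lform_tker[OF R R] by (simp add: ip_self_nrm)
  show "(\<lambda>L. \<Sum>\<alpha>\<in>index_box d L. (nrm (cube d) (dfun d \<alpha> R))\<^sup>2) \<longlonglongrightarrow> Re (lform (tker d) R R)"
    using tendsto_Re[OF lim] by simp
  show "Im (lform (tker d) R R) = 0"
    using tendsto_Im[OF lim] by (simp add: LIMSEQ_const_iff)
qed

lemma tendsto_ldist2:
  assumes R: "set R \<subseteq> factors d" and S: "set S \<subseteq> factors d"
  shows "(\<lambda>L. \<Sum>\<alpha>\<in>index_box d L. (nrm (cube d) (\<lambda>x. dfun d \<alpha> R x - dfun d \<alpha> S x))\<^sup>2) \<longlonglongrightarrow> ldist2 (tker d) R S"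
proof -
  have "(nrm (cube d) (\<lambda>x. dfun d \<alpha> R x - dfun d \<alpha> S x))\<^sup>2
     = Re (ip (cube d) (dfun d \<alpha> R) (dfun d \<alpha> R) - ip (cube d) (dfun d \<alpha> R) (dfun d \<alpha> S)
      - ip (cube d) (dfun d \<alpha> S) (dfun d \<alpha> R) + ip (cube d) (dfun d \<alpha> S) (dfun d \<alpha> S))" for \<alpha>
    using dfun_l2[OF R] dfun_l2[OF S]
    by (simp add: nrm_square ip_minus_left ip_minus_right l2_minus)
  then have "(\<Sum>\<alpha>\<in>index_box d L. (nrm (cube d) (\<lambda>x. dfun d \<alpha> R x - dfun d \<alpha> S x))\<^sup>2)
     = Re ((\<Sum>\<alpha>\<in>index_box d L. ip (cube d) (dfun d \<alpha> R) (dfun d \<alpha> R)) - (\<Sum>\<alpha>\<in>index_box d L. ip (cube d) (dfun d \<alpha> R) (dfun d \<alpha> S))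
      - (\<Sum>\<alpha>\<in>index_box d L. ip (cube d) (dfun d \<alpha> S) (dfun d \<alpha> R)) + (\<Sum>\<alpha>\<in>index_box d L. ip (cube d) (dfun d \<alpha> S) (dfun d \<alpha> S)))" for L
    by (simp add: sum.distrib sum_subtractf)
  then show ?thesis
    unfolding ldist2_def using R S by (simp only:) (intro tendsto_intros tendsto_lform_tker)
qed

lemma sum_index_box_le_ldist2:
  assumes R: "set R \<subseteq> factors d" and S: "set S \<subseteq> factors d"
  shows "(\<Sum>\<alpha>\<in>index_box d L. (nrm (cube d) (\<lambda>x. dfun d \<alpha> R x - dfun d \<alpha> S x))\<^sup>2) \<le> ldist2 (tker d) R S"
proof (rule incseq_le[OF _ tendsto_ldist2[OF R S]])
  show "incseq (\<lambda>L. \<Sum>\<alpha>\<in>index_box d L. (nrm (cube d) (\<lambda>x. dfun d \<alpha> R x - dfun d \<alpha> S x))\<^sup>2)"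
    by (intro monoI sum_mono2 finite_index_box index_box_mono) auto
qed

lemma nrm_dfun_le_dist:
  assumes R: "set R \<subseteq> factors d" and S: "set S \<subseteq> factors d" and \<alpha>: "\<alpha> \<in> extensional {..<d}"
  shows "nrm (cube d) (\<lambda>x. dfun d \<alpha> R x - dfun d \<alpha> S x) \<le> tensor_dist d H R S"
proof -
  \<comment> \<open>\<open>insert 0\<close> keeps the maximum defined when there are no
    coordinates.\<close>
  define L where "L = Suc (Max (insert 0 (\<alpha> ` {..<d})))"
  have "\<alpha> i < L" if "i < d" for i
    unfolding L_def less_Suc_eq_le using that by (intro Max_ge) auto
  then have "\<alpha> \<in> index_box d L"
    using \<alpha> by (auto simp: PiE_def)
  then have "(nrm (cube d) (\<lambda>x. dfun d \<alpha> R x - dfun d \<alpha> S x))\<^sup>2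
      \<le> (\<Sum>\<alpha>\<in>index_box d L. (nrm (cube d) (\<lambda>x. dfun d \<alpha> R x - dfun d \<alpha> S x))\<^sup>2)"
    by (intro member_le_sum finite_index_box) auto
  also have "\<dots> \<le> ldist2 (tker d) R S"
    by (rule sum_index_box_le_ldist2[OF R S])
  finally show ?thesis
    unfolding tensor_dist_ldist2 by (rule real_le_rsqrt)
qed

text \<open>The factor is a product of signs, or 0 if the derivatives of some order are chosen to be
  zero. Being common to all R, it lets L2 convergence of the tensors pass to their
  derivatives.\<close>

lemma ip_dfun_test:
  assumes \<phi>: "\<And>i. i < d \<Longrightarrow> test_function (\<phi> i)"
  shows "\<exists>c. \<forall>R. set R \<subseteq> factors d \<longrightarrow> ip (cube d) (dfun d \<alpha> R) (tens d (\<lambda>i. rfun (\<phi> i)))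
     = c * ip (cube d) (tensor_fun d R) (tens d (\<lambda>i. rfun ((deriv ^^ \<alpha> i) (\<phi> i))))"
proof -
  have l2: "rfun (\<phi> i) \<in> l2 I01" "rfun ((deriv ^^ l) (\<phi> i)) \<in> l2 I01" if "i < d" for i l
    using rfun_test_l2[OF \<phi>[OF that], of 0] rfun_test_l2[OF \<phi>[OF that], of l] by auto
  have "\<exists>c. \<forall>f\<in>hcarrier H. ip I01 (D (\<alpha> i) f) (rfun (\<phi> i)) = c * ip I01 f (rfun ((deriv ^^ \<alpha> i) (\<phi> i)))"
    if "i < d" for i
    using D_weak[of "\<alpha> i"]
  proof
    assume "\<forall>f\<in>hcarrier H. is_weak_deriv (\<alpha> i) f (D (\<alpha> i) f)"
    then show ?thesis
      using \<phi>[OF that] by (intro exI[of _ "(-1) ^ \<alpha> i"])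
        (simp add: is_weak_deriv_iff flip: mult.assoc power_add mult_2)
  next
    assume "\<forall>f\<in>hcarrier H. D (\<alpha> i) f = (\<lambda>x. 0)"
    then show ?thesis
      by (intro exI[of _ 0]) (simp add: ip_def)
  qed
  then obtain c where c: "\<And>i f. i < d \<Longrightarrow> f \<in> hcarrier H \<Longrightarrow>
      ip I01 (D (\<alpha> i) f) (rfun (\<phi> i)) = c i * ip I01 f (rfun ((deriv ^^ \<alpha> i) (\<phi> i)))"
    by metis
  have "ip (cube d) (dfun d \<alpha> R) (tens d (\<lambda>i. rfun (\<phi> i)))
     = (\<Prod>i<d. c i) * ip (cube d) (tensor_fun d R) (tens d (\<lambda>i. rfun ((deriv ^^ \<alpha> i) (\<phi> i))))"
    if R: "set R \<subseteq> factors d" for R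
  proof -
    have "ip (cube d) (dfun d \<alpha> R) (tens d (\<lambda>i. rfun (\<phi> i)))
        = (\<Sum>u\<leftarrow>R. ip (cube d) (dtens d \<alpha> u) (tens d (\<lambda>i. rfun (\<phi> i))))"
      unfolding dfun_def[abs_def] using R l2 by (intro ip_sum_list_left dtens_l2 tens_l2) auto
    also have "\<dots> = (\<Sum>u\<leftarrow>R. (\<Prod>i<d. c i) * ip (cube d) (tens d u) (tens d (\<lambda>i. rfun ((deriv ^^ \<alpha> i) (\<phi> i)))))"
    proof (intro arg_cong[where f = sum_list] map_cong refl)
      fix u assume "u \<in> set R"
      then have u: "u i \<in> hcarrier H" if "i < d" for i
        using R that by auto
      have "ip (cube d) (dtens d \<alpha> u) (tens d (\<lambda>i. rfun (\<phi> i)))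
          = (\<Prod>i<d. ip I01 (D (\<alpha> i) (u i)) (rfun (\<phi> i)))"
        unfolding dtens_def using u D_l2 l2 by (intro ip_tens) auto
      also have "\<dots> = (\<Prod>i<d. c i * ip I01 (u i) (rfun ((deriv ^^ \<alpha> i) (\<phi> i))))"
        using c u by (intro prod.cong) auto
      also have "\<dots> = (\<Prod>i<d. c i) * ip (cube d) (tens d u) (tens d (\<lambda>i. rfun ((deriv ^^ \<alpha> i) (\<phi> i))))"
        using u carrier_l2 l2 by (subst ip_tens) (auto simp: prod.distrib)
      finally show "ip (cube d) (dtens d \<alpha> u) (tens d (\<lambda>i. rfun (\<phi> i)))
          = (\<Prod>i<d. c i) * ip (cube d) (tens d u) (tens d (\<lambda>i. rfun ((deriv ^^ \<alpha> i) (\<phi> i))))" .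
    qed
    also have "\<dots> = (\<Prod>i<d. c i) * (\<Sum>u\<leftarrow>R. ip (cube d) (tens d u) (tens d (\<lambda>i. rfun ((deriv ^^ \<alpha> i) (\<phi> i)))))"
      by (rule sum_list_const_mult)
    also have "(\<Sum>u\<leftarrow>R. ip (cube d) (tens d u) (tens d (\<lambda>i. rfun ((deriv ^^ \<alpha> i) (\<phi> i)))))
        = ip (cube d) (tensor_fun d R) (tens d (\<lambda>i. rfun ((deriv ^^ \<alpha> i) (\<phi> i))))"
      unfolding tensor_fun_tens using R carrier_l2 l2 by (intro ip_sum_list_left[symmetric] tens_l2) auto
    finally show ?thesis .
  qed
  then show ?thesis by blast
qed

section \<open>Closability of the tensor power\<close>

context
  fixes d :: nat and R :: "nat \<Rightarrow> (nat \<Rightarrow> real \<Rightarrow> complex) list"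
  assumes R: "\<And>k. set (R k) \<subseteq> factors d"
    and Cauchy: "\<And>e. e > 0 \<Longrightarrow> \<exists>N. \<forall>j\<ge>N. \<forall>k\<ge>N. tensor_dist d H (R j) (R k) < e"
    and null: "(\<lambda>k. nrm (cube d) (tensor_fun d (R k))) \<longlonglongrightarrow> 0"
begin

lemma dfun_bounded:
  assumes \<alpha>: "\<alpha> \<in> extensional {..<d}"
  shows "\<exists>B>0. \<forall>k. nrm (cube d) (dfun d \<alpha> (R k)) \<le> B"
proof -
  obtain N where N: "\<And>j k. j \<ge> N \<Longrightarrow> k \<ge> N \<Longrightarrow> tensor_dist d H (R j) (R k) < 1"
    using Cauchy[of 1] by auto
  have l2: "dfun d \<alpha> (R k) \<in> l2 (cube d)" for k
    by (rule dfun_l2[OF R])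
  let ?n = "\<lambda>k. nrm (cube d) (dfun d \<alpha> (R k))"
  have "?n k \<le> ?n N + 1" if "k \<ge> N" for k
    using nrm_diff_le[OF l2[of k] l2[of N]] nrm_dfun_le_dist[OF R[of k] R[of N] \<alpha>] N[OF that order_refl]
    by linarith
  moreover have "?n k \<le> (\<Sum>j<N. ?n j)" if "k < N" for k
    using that by (intro member_le_sum) auto
  moreover have nonneg: "0 \<le> (\<Sum>j<N. ?n j)" "0 \<le> ?n N"
    by (simp_all add: sum_nonneg)
  ultimately have "?n k \<le> (\<Sum>j<N. ?n j) + ?n N + 1" for k
    by (smt (verit) not_le)
  moreover have "(\<Sum>j<N. ?n j) + ?n N + 1 > 0"
    using nonneg by linarith
  ultimately show ?thesis by blast
qed

text \<open>
  Against tensors of test functions all derivatives can be moved onto the test functions. The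
  factors are then replaced by arbitrary square integrable functions one by one.
\<close>

lemma dfun_weakly_null:
  assumes \<alpha>: "\<alpha> \<in> extensional {..<d}" and "j \<le> d"
    and "\<And>i. i < d \<Longrightarrow> g i \<in> l2 I01"
    and "\<And>i. i < d \<Longrightarrow> j \<le> i \<Longrightarrow> \<exists>\<phi>. test_function \<phi> \<and> g i = rfun \<phi>"
  shows "(\<lambda>k. ip (cube d) (dfun d \<alpha> (R k)) (tens d g)) \<longlonglongrightarrow> 0"
  using assms(2-)
\<comment> \<open>j counts the leading coordinates whose factor is already an arbitrary square
  integrable function.\<close>
proof (induction j arbitrary: g)
  case 0
  then have "\<forall>i\<in>{..<d}. \<exists>\<phi>. test_function \<phi> \<and> g i = rfun \<phi>"
    by auto
  from bchoice[OF this] obtain \<phi> where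
    \<phi>: "\<And>i. i < d \<Longrightarrow> test_function (\<phi> i)" "\<And>i. i < d \<Longrightarrow> g i = rfun (\<phi> i)"
    by auto
  have g: "tens d g = tens d (\<lambda>i. rfun (\<phi> i))"
    by (auto simp: tens_def fun_eq_iff \<phi>(2))
  let ?\<psi> = "tens d (\<lambda>i. rfun ((deriv ^^ \<alpha> i) (\<phi> i)))"
  obtain c where c: "\<And>k. ip (cube d) (dfun d \<alpha> (R k)) (tens d g) = c * ip (cube d) (tensor_fun d (R k)) ?\<psi>"
    using ip_dfun_test[of d \<phi> \<alpha>] \<phi>(1) R unfolding g by blast
  have "(\<lambda>k. ip (cube d) (tensor_fun d (R k)) ?\<psi>) \<longlonglongrightarrow> 0"
  proof (rule Lim_null_comparison)
    show "\<forall>\<^sub>F k in sequentially. cmod (ip (cube d) (tensor_fun d (R k)) ?\<psi>)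
        \<le> nrm (cube d) (tensor_fun d (R k)) * nrm (cube d) ?\<psi>"
      using \<phi>(1) by (intro always_eventually allI ip_le tensor_fun_l2 R tens_l2 rfun_test_l2) auto
    show "(\<lambda>k. nrm (cube d) (tensor_fun d (R k)) * nrm (cube d) ?\<psi>) \<longlonglongrightarrow> 0"
      using tendsto_mult_right[OF null] by simp
  qed
  then show ?case
    unfolding c by (rule tendsto_mult_right_zero)
next
  case (Suc j)
  have j: "j < d" using Suc.prems by simp
  have gl2: "g(j := h) \<in> {g. \<forall>i<d. g i \<in> l2 I01}" if "h \<in> l2 I01" for h
    using that Suc.prems by auto
  have tl2: "tens d (g(j := h)) \<in> l2 (cube d)" if "h \<in> l2 I01" for h
    using gl2[OF that] by (intro tens_l2) auto
  let ?X = "\<lambda>h k. ip (cube d) (dfun d \<alpha> (R k)) (tens d (g(j := h)))"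
  have span: "?X h \<longlonglongrightarrow> 0" if "h \<in> test_span" for h
    using that
  proof induction
    case (base \<phi>)
    show ?case
    proof (rule Suc.IH)
      show "\<exists>\<phi>'. test_function \<phi>' \<and> (g(j := rfun \<phi>)) i = rfun \<phi>'" if "i < d" "j \<le> i" for i
        using Suc.prems(3)[of i] base that by (cases "i = j") auto
    qed (use j rfun_test_l2[OF base, of 0] Suc.prems in auto)
  next
    case (lincomb f h a b)
    then have l2: "f \<in> l2 I01" "h \<in> l2 I01"
      using l2_subspace_l2[OF l2_subspace_test_span] by auto
    have E: "tens d (g(j := \<lambda>x. a * f x + b * h x)) = (\<lambda>x. a * tens d (g(j := f)) x + b * tens d (g(j := h)) x)"
      using j by (simp add: tens_upd algebra_simps fun_eq_iff)
    have X: "?X (\<lambda>x. a * f x + b * h x) k = cnj a * ?X f k + cnj b * ?X h k" for k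
      unfolding E using tl2[OF l2(1)] tl2[OF l2(2)] dfun_l2[OF R]
      by (subst ip_add_right) (simp_all add: ip_cmult_right l2_cmult)
    have "(\<lambda>k. cnj a * ?X f k + cnj b * ?X h k) \<longlonglongrightarrow> 0"
      by (intro tendsto_add_zero tendsto_mult_right_zero lincomb.IH)
    then show ?case
      by (simp only: X)
  qed
  obtain B where B: "B > 0" "\<And>k. nrm (cube d) (dfun d \<alpha> (R k)) \<le> B"
    using dfun_bounded[OF \<alpha>] by blast
  define C where "C = 1 + (\<Prod>i\<in>{..<d} - {j}. nrm I01 (g i))"
  have C: "C > 0"
    unfolding C_def by (intro add_pos_nonneg prod_nonneg) auto
  have "?X (g j) \<longlonglongrightarrow> 0"
  proof (rule LIMSEQ_I)
    fix e :: real assume e: "e > 0"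
    have gj: "g j \<in> l2 I01" using Suc.prems j by auto
    then obtain h where h: "h \<in> test_span" "nrm I01 (\<lambda>x. g j x - h x) < e / (2 * B * C)"
      using test_span_dense[OF gj] e B C by (auto simp: l2_closure_def dest: spec[of _ "e / (2 * B * C)"])
    have hl2: "h \<in> l2 I01"
      using h(1) l2_subspace_l2[OF l2_subspace_test_span] by auto
    have diff: "cmod (?X (g j) k - ?X h k) < e / 2" for k
    proof -
      let ?u = "\<lambda>x. g j x - h x"
      have "tens d (g(j := g j)) x - tens d (g(j := h)) x = tens d (g(j := ?u)) x" for x
        using j by (simp only: tens_upd) (simp add: algebra_simps)
      then have "?X (g j) k - ?X h k = ?X ?u k"
        using tl2[OF gj] tl2[OF hl2] dfun_l2[OF R] by (simp only: ip_minus_right[symmetric])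
      also have "cmod \<dots> \<le> nrm (cube d) (dfun d \<alpha> (R k)) * nrm (cube d) (tens d (g(j := ?u)))"
        using gj hl2 by (intro ip_le dfun_l2 R tl2 l2_minus)
      also have "nrm (cube d) (tens d (g(j := ?u))) = (\<Prod>i<d. nrm I01 ((g(j := ?u)) i))"
        using gl2[OF l2_minus[OF gj hl2]] by (intro nrm_tens) auto
      also have "\<dots> = nrm I01 ?u * (\<Prod>i\<in>{..<d} - {j}. nrm I01 (g i))"
        using j by (subst prod.remove[of _ j]) (auto intro!: prod.cong)
      also have "nrm (cube d) (dfun d \<alpha> (R k)) * \<dots> \<le> B * (nrm I01 ?u * C)"
        unfolding C_def using B by (intro mult_mono mult_nonneg_nonneg prod_nonneg) auto
      also have "\<dots> < B * (e / (2 * B * C) * C)"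
        using h(2) B C by (intro mult_strict_left_mono mult_strict_right_mono) auto
      also have "\<dots> = e / 2"
        using B C by simp
      finally show ?thesis .
    qed
    obtain N where "\<And>k. k \<ge> N \<Longrightarrow> cmod (?X h k - 0) < e / 2"
      using LIMSEQ_D[OF span[OF h(1)], of "e / 2"] e by auto
    then have "cmod (?X (g j) k - 0) < e" if "k \<ge> N" for k
      using diff[of k] that norm_triangle_ineq[of "?X (g j) k - ?X h k" "?X h k"] by fastforce
    then show "\<exists>N. \<forall>k\<ge>N. cmod (?X (g j) k - 0) < e" by blast
  qed
  then show ?case by simp
qed

text \<open>A Cauchy sequence that is weakly null is null: |f_k|^2 is the pairing of f_k with f_k -
  f_M, small by the Cauchy property, plus its pairing with f_M. The latter tends to 0 for fixed M,
  because f_M is a finite sum of tensors.\<close>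

lemma dfun_null:
  assumes \<alpha>: "\<alpha> \<in> extensional {..<d}"
  shows "(\<lambda>k. nrm (cube d) (dfun d \<alpha> (R k))) \<longlonglongrightarrow> 0"
proof -
  obtain B where B: "B > 0" "\<And>k. nrm (cube d) (dfun d \<alpha> (R k)) \<le> B"
    using dfun_bounded[OF \<alpha>] by blast
  have "(\<lambda>k. (nrm (cube d) (dfun d \<alpha> (R k)))\<^sup>2) \<longlonglongrightarrow> 0"
  proof (rule LIMSEQ_I)
    fix e :: real assume e: "e > 0"
    obtain M where M: "\<And>j k. j \<ge> M \<Longrightarrow> k \<ge> M \<Longrightarrow> tensor_dist d H (R j) (R k) < e / (2 * B)"
      using Cauchy[of "e / (2 * B)"] e B by auto
    have "(\<lambda>k. \<Sum>u\<leftarrow>R M. ip (cube d) (dfun d \<alpha> (R k)) (dtens d \<alpha> u)) \<longlonglongrightarrow> (\<Sum>u\<leftarrow>R M. 0)"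
    proof (rule tendsto_sum_list)
      fix u assume "u \<in> set (R M)"
      then have "u \<in> factors d" using R by auto
      then show "(\<lambda>k. ip (cube d) (dfun d \<alpha> (R k)) (dtens d \<alpha> u)) \<longlonglongrightarrow> 0"
        unfolding dtens_def using D_l2 by (intro dfun_weakly_null[OF \<alpha> order_refl]) auto
    qed
    moreover have "ip (cube d) (dfun d \<alpha> (R k)) (dfun d \<alpha> (R M))
        = (\<Sum>u\<leftarrow>R M. ip (cube d) (dfun d \<alpha> (R k)) (dtens d \<alpha> u))" for k
      unfolding dfun_def[of d \<alpha> "R M", abs_def] using R[of M] by (intro ip_sum_list_right dtens_l2 dfun_l2 R) auto
    ultimately have "(\<lambda>k. ip (cube d) (dfun d \<alpha> (R k)) (dfun d \<alpha> (R M))) \<longlonglongrightarrow> 0"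
      by simp
    then obtain N where N: "\<And>k. k \<ge> N \<Longrightarrow> cmod (ip (cube d) (dfun d \<alpha> (R k)) (dfun d \<alpha> (R M)) - 0) < e / 2"
      using LIMSEQ_D[of _ 0 "e / 2"] e by (metis half_gt_zero)
    have "norm ((nrm (cube d) (dfun d \<alpha> (R k)))\<^sup>2 - 0) < e" if k: "k \<ge> max M N" for k
    proof -
      let ?f = "dfun d \<alpha> (R k)" and ?g = "dfun d \<alpha> (R M)"
      have l2: "?f \<in> l2 (cube d)" "?g \<in> l2 (cube d)"
        using dfun_l2[OF R] by auto
      have "(nrm (cube d) ?f)\<^sup>2 = Re (ip (cube d) ?f (\<lambda>x. ?f x - ?g x)) + Re (ip (cube d) ?f ?g)"
        using l2 by (simp add: nrm_square ip_minus_right)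
      also have "\<dots> \<le> cmod (ip (cube d) ?f (\<lambda>x. ?f x - ?g x)) + cmod (ip (cube d) ?f ?g)"
        by (intro add_mono complex_Re_le_cmod)
      also have "cmod (ip (cube d) ?f (\<lambda>x. ?f x - ?g x)) \<le> nrm (cube d) ?f * nrm (cube d) (\<lambda>x. ?f x - ?g x)"
        using l2 by (intro ip_le l2_minus)
      also have "\<dots> \<le> B * (e / (2 * B))"
        using B nrm_dfun_le_dist[OF R R \<alpha>, of k M] M[of k M] k
        by (intro mult_mono) auto
      also have "\<dots> = e / 2"
        using B by simp
      finally show ?thesis
        using N[of k] k by simp
    qed
    then show "\<exists>N. \<forall>k\<ge>N. norm ((nrm (cube d) (dfun d \<alpha> (R k)))\<^sup>2 - 0) < e" by blast
  qed
  from tendsto_real_sqrt[OF this] show ?thesis by simp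
qed

text \<open>In the Cauchy estimate over a finite box of derivatives, the second index goes to
  infinity first; its terms vanish by \<open>dfun_null\<close>, and the bound that remains is
  independent of the box. Afterwards the box is exhausted.\<close>

lemma lform_null: "(\<lambda>k. Re (lform (tker d) (R k) (R k))) \<longlonglongrightarrow> 0"
proof (rule LIMSEQ_I)
  fix e :: real assume e: "e > 0"
  obtain M where M: "\<And>j k. j \<ge> M \<Longrightarrow> k \<ge> M \<Longrightarrow> tensor_dist d H (R j) (R k) < sqrt (e / 2)"
    using Cauchy[of "sqrt (e / 2)"] e by auto
  have "norm (Re (lform (tker d) (R k) (R k)) - 0) < e" if k: "k \<ge> M" for k
  proof -
    have "(\<Sum>\<alpha>\<in>index_box d L. (nrm (cube d) (dfun d \<alpha> (R k)))\<^sup>2) \<le> e / 2" for L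
    proof (rule LIMSEQ_le_const2)
      show "(\<lambda>j. \<Sum>\<alpha>\<in>index_box d L. (nrm (cube d) (\<lambda>x. dfun d \<alpha> (R k) x - dfun d \<alpha> (R j) x))\<^sup>2)
          \<longlonglongrightarrow> (\<Sum>\<alpha>\<in>index_box d L. (nrm (cube d) (dfun d \<alpha> (R k)))\<^sup>2)"
      proof (intro tendsto_sum tendsto_power)
        fix \<alpha> assume "\<alpha> \<in> index_box d L"
        then have \<alpha>: "\<alpha> \<in> extensional {..<d}" by (auto simp: PiE_def)
        have l2: "dfun d \<alpha> (R j) \<in> l2 (cube d)" for j
          by (intro dfun_l2 R)
        show "(\<lambda>j. nrm (cube d) (\<lambda>x. dfun d \<alpha> (R k) x - dfun d \<alpha> (R j) x)) \<longlonglongrightarrow> nrm (cube d) (dfun d \<alpha> (R k))"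
          by (rule tendsto_nrm) (use l2 dfun_null[OF \<alpha>] in \<open>auto intro: l2_minus simp: nrm_uminus\<close>)
      qed
      have "(\<Sum>\<alpha>\<in>index_box d L. (nrm (cube d) (\<lambda>x. dfun d \<alpha> (R k) x - dfun d \<alpha> (R j) x))\<^sup>2) \<le> e / 2"
        if "j \<ge> M" for j
      proof -
        have "sqrt (ldist2 (tker d) (R k) (R j)) < sqrt (e / 2)"
          using M[OF k that] by (simp add: tensor_dist_ldist2)
        then show ?thesis
          using sum_index_box_le_ldist2[OF R[of k] R[of j], of L] by simp
      qed
      then show "\<exists>N. \<forall>j\<ge>N. (\<Sum>\<alpha>\<in>index_box d L. (nrm (cube d) (\<lambda>x. dfun d \<alpha> (R k) x - dfun d \<alpha> (R j) x))\<^sup>2) \<le> e / 2"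
        by blast
    qed
    then have "Re (lform (tker d) (R k) (R k)) \<le> e / 2"
      by (intro LIMSEQ_le_const2[OF tendsto_lform_self(1)[OF R]]) auto
    moreover have "0 \<le> Re (lform (tker d) (R k) (R k))"
      by (rule kpsd_lform[OF kpsd_tker R])
    ultimately show ?thesis
      using e by simp
  qed
  then show "\<exists>N. \<forall>k\<ge>N. norm (Re (lform (tker d) (R k) (R k)) - 0) < e" by blast
qed

end

lemma tensor_rep_represents:
  assumes "f \<in> hcarrier (tensor_power d H)"
  shows "tensor_represents d H (tensor_rep d H f) f"
  using assms someI_ex[of "\<lambda>R. tensor_represents d H R f"]
  by (simp add: tensor_rep_def tensor_power_def)

lemma tensor_power_l2: "f \<in> hcarrier (tensor_power d H) \<Longrightarrow> f \<in> l2 (cube d)"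
  by (simp add: tensor_power_def)

text \<open>The norm is defined through \<open>lim\<close>, which has a meaning only after
  convergence is known. The reverse triangle inequality makes the norms along the chosen sequence
  Cauchy.\<close>

lemma tensor_norm_tendsto:
  assumes f: "f \<in> hcarrier (tensor_power d H)"
  shows "(\<lambda>k. Re (tensor_inner d H (tensor_rep d H f k) (tensor_rep d H f k))) \<longlonglongrightarrow> (hnorm (tensor_power d H) f)\<^sup>2"
    and "0 \<le> hnorm (tensor_power d H) f"
proof -
  let ?R = "tensor_rep d H f"
  define r where "r k = Re (lform (tker d) (?R k) (?R k))" for k
  have R: "set (?R k) \<subseteq> factors d" for k
    using tensor_rep_represents[OF f] by (auto simp: tensor_represents_def tensors_iff)
  have r0: "0 \<le> r k" for k
    unfolding r_def by (rule kpsd_lform[OF kpsd_tker R])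
  have "Cauchy (\<lambda>k. sqrt (r k))"
  proof (rule metric_CauchyI)
    fix e :: real assume "e > 0"
    then obtain N where N: "\<And>j k. j \<ge> N \<Longrightarrow> k \<ge> N \<Longrightarrow> tensor_dist d H (?R j) (?R k) < e"
      using tensor_rep_represents[OF f] unfolding tensor_represents_def by blast
    then have "dist (sqrt (r j)) (sqrt (r k)) < e" if "j \<ge> N" "k \<ge> N" for j k
      using lform_sqrt_diff[OF kpsd_tker R R, of j k] N[OF that]
      by (simp add: r_def dist_real_def tensor_dist_ldist2)
    then show "\<exists>M. \<forall>m\<ge>M. \<forall>n\<ge>M. dist (sqrt (r m)) (sqrt (r n)) < e" by blast
  qed
  then obtain s where s: "(\<lambda>k. sqrt (r k)) \<longlonglongrightarrow> s"
    using Cauchy_convergent_iff convergent_def by blast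
  have lim: "r \<longlonglongrightarrow> s\<^sup>2"
    using tendsto_power[OF s, of 2] r0 by simp
  \<comment> \<open>The limit in the definition is complex, so the vanishing imaginary part is
    needed as well.\<close>
  have "lform (tker d) (?R k) (?R k) = complex_of_real (r k)" for k
    using tendsto_lform_self(2)[OF R] by (simp add: r_def complex_eq_iff)
  then have "hinner (tensor_power d H) f f = lim (\<lambda>k. complex_of_real (r k))"
    by (simp add: tensor_power_def tensor_inner_lform)
  also have "\<dots> = complex_of_real (s\<^sup>2)"
    using tendsto_of_real[OF lim] by (rule limI)
  finally have "(hnorm (tensor_power d H) f)\<^sup>2 = s\<^sup>2" "0 \<le> hnorm (tensor_power d H) f"
    by (simp_all add: hnorm_def)
  then show "(\<lambda>k. Re (tensor_inner d H (tensor_rep d H f k) (tensor_rep d H f k))) \<longlonglongrightarrow> (hnorm (tensor_power d H) f)\<^sup>2"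
      "0 \<le> hnorm (tensor_power d H) f"
    using lim by (simp_all add: tensor_inner_lform r_def[abs_def])
qed

lemma zero_in_tensor_power: "(\<lambda>x. 0) \<in> hcarrier (tensor_power d H)"
proof -
  have "tensor_represents d H (\<lambda>_. []) (\<lambda>x. 0)"
    by (simp add: tensor_represents_def tensors_def tensor_dist_def tensor_inner_def tensor_fun_def)
  then show ?thesis
    by (auto simp: tensor_power_def)
qed

text \<open>
  Since the norm is defined via an arbitrary representing sequence, this is the closability of the
  tensor power. Without it, the set in \<open>operator_norm\<close> might be empty and its supremum meaningless.
\<close>

lemma hnorm_zero: "hnorm (tensor_power d H) (\<lambda>x. 0) = 0"
proof -
  let ?R = "tensor_rep d H (\<lambda>x. 0)"
  have rep: "tensor_represents d H ?R (\<lambda>x. 0)"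
    by (rule tensor_rep_represents[OF zero_in_tensor_power])
  have "(\<lambda>k. Re (lform (tker d) (?R k) (?R k))) \<longlonglongrightarrow> 0"
    by (rule lform_null) (use rep in \<open>auto simp: tensor_represents_def tensors_iff\<close>)
  moreover have "(\<lambda>k. Re (lform (tker d) (?R k) (?R k))) \<longlonglongrightarrow> (hnorm (tensor_power d H) (\<lambda>x. 0))\<^sup>2"
    using tensor_norm_tendsto(1)[OF zero_in_tensor_power] by (simp add: tensor_inner_lform)
  ultimately show ?thesis
    using LIMSEQ_unique by fastforce
qed

lemma truncation_error:
  assumes "3 \<le> N" "I \<subseteq> PiE {..<d} (\<lambda>_. {..<N})" "0 \<le> t"
    and "\<And>k. k \<in> PiE {..<d} (\<lambda>_. {..N}) \<Longrightarrow> k \<notin> I \<Longrightarrow> t \<le> (\<Prod>i<d. legwt (k i))"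
    and f: "f \<in> hcarrier (tensor_power d H)"
  shows "t * ((nrm (cube d) f)\<^sup>2 - (\<Sum>k\<in>I. (cmod (ip (cube d) f (basis d k)))\<^sup>2)) \<le> (hnorm (tensor_power d H) f)\<^sup>2"
proof (rule LIMSEQ_le[OF _ tensor_norm_tendsto(1)[OF f]])
  let ?R = "tensor_rep d H f"
  have R: "set (?R k) \<subseteq> factors d" for k
    using tensor_rep_represents[OF f] by (auto simp: tensor_represents_def tensors_iff)
  have conv: "(\<lambda>k. nrm (cube d) (\<lambda>x. tensor_fun d (?R k) x - f x)) \<longlonglongrightarrow> 0"
    using tensor_rep_represents[OF f] by (auto simp: tensor_represents_def)
  show "(\<lambda>k. t * ((nrm (cube d) (tensor_fun d (?R k)))\<^sup>2
        - (\<Sum>i\<in>I. (cmod (ip (cube d) (tensor_fun d (?R k)) (basis d i)))\<^sup>2)))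
      \<longlonglongrightarrow> t * ((nrm (cube d) f)\<^sup>2 - (\<Sum>k\<in>I. (cmod (ip (cube d) f (basis d k)))\<^sup>2))"
    using tensor_fun_l2[OF R] tensor_power_l2[OF f] basis_l2
    by (intro tendsto_intros tendsto_nrm[OF _ _ conv] tendsto_ip[OF _ _ _ conv]) auto
  show "\<exists>M. \<forall>k\<ge>M. t * ((nrm (cube d) (tensor_fun d (?R k)))\<^sup>2
        - (\<Sum>i\<in>I. (cmod (ip (cube d) (tensor_fun d (?R k)) (basis d i)))\<^sup>2))
      \<le> Re (tensor_inner d H (?R k) (?R k))"
    using tensor_truncation[OF assms(1-4) R] by blast
qed

end

section \<open>The truncation operator and the approximation number\<close>

context sobolev_space
begin

lemma ip_basis:
  assumes "k \<in> extensional {..<d}" "k' \<in> extensional {..<d}"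
  shows "ip (cube d) (basis d k) (basis d k') = (if k = k' then 1 else 0)"
proof -
  have "ip (cube d) (basis d k) (basis d k') = (\<Prod>i<d. if k i = k' i then 1 else 0)"
    unfolding basis_def by (subst ip_tens) (simp_all add: ip_leg)
  also have "\<dots> = (if k = k' then 1 else 0)"
  proof (cases "k = k'")
    case False
    then obtain i where "i < d" "k i \<noteq> k' i"
      using extensionalityI[OF assms] by blast
    then show ?thesis
      using False by (auto simp: prod_zero_iff)
  qed simp
  finally show ?thesis .
qed

lemma approx_number_tensor_power_le:
  assumes \<tau>: "0 < \<tau>" and N: "3 \<le> N" and I: "I \<subseteq> index_box d N" and card: "card I < n"
    and le: "\<And>k. k \<in> PiE {..<d} (\<lambda>_. {..N}) \<Longrightarrow> k \<notin> I \<Longrightarrow> 1 / \<tau>\<^sup>2 \<le> (\<Prod>i<d. legwt (k i))"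
  shows "approx_number (tensor_power d H) (L2 (cube d)) (\<lambda>f. f) n \<le> \<tau>"
proof -
  let ?X = "tensor_power d H" and ?Y = "L2 (cube d)"
  define A where "A f x = (\<Sum>k\<in>I. ip (cube d) f (basis d k) * basis d k x)" for f x
  have fin: "finite I"
    using I finite_index_box finite_subset by blast
  have on: "ip (cube d) (basis d k) (basis d k') = (if k = k' then 1 else 0)" if "k \<in> I" "k' \<in> I" for k k'
    using that I by (intro ip_basis) (auto simp: PiE_def)
  have A_l2: "A f \<in> l2 (cube d)" for f
    unfolding A_def[abs_def] by (intro l2_lincomb basis_l2)
  have hnorm0: "0 \<le> hnorm ?X f" if "f \<in> hcarrier ?X" for f
    using tensor_norm_tendsto(2)[OF that] .
  \<comment> \<open>Truncation to the empty set with t = 1: every product of weights is at least 1,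
    so the embedding is a contraction.\<close>
  have l2_le: "nrm (cube d) f \<le> hnorm ?X f" if "f \<in> hcarrier ?X" for f
  proof (rule power2_le_imp_le)
    have "1 \<le> (\<Prod>i<d. legwt (k i))" for k
      by (intro prod_ge_1) (simp add: legwt_ge_1)
    then show "(nrm (cube d) f)\<^sup>2 \<le> (hnorm ?X f)\<^sup>2"
      using truncation_error[of 3 "{}" d 1 f] that by simp
  qed (rule hnorm0[OF that])
  have A_le: "nrm (cube d) (A f) \<le> nrm (cube d) f" if "f \<in> l2 (cube d)" for f
  proof (rule power2_le_imp_le)
    have "ip (cube d) (A f) (A f)
        = (\<Sum>k\<in>I. ip (cube d) f (basis d k) * cnj (ip (cube d) f (basis d k)))"
      unfolding A_def[abs_def] using fin basis_l2 on by (intro ip_sum_orthonormal)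
    then have "(nrm (cube d) (A f))\<^sup>2 = (\<Sum>k\<in>I. (cmod (ip (cube d) f (basis d k)))\<^sup>2)"
      by (simp add: nrm_square flip: complex_norm_square)
    also have "\<dots> \<le> (nrm (cube d) f)\<^sup>2"
      using fin basis_l2 on that by (intro bessel)
    finally show "(nrm (cube d) (A f))\<^sup>2 \<le> (nrm (cube d) f)\<^sup>2" .
  qed simp
  have A_error: "nrm (cube d) (\<lambda>x. f x - A f x) \<le> \<tau> * hnorm ?X f" if f: "f \<in> hcarrier ?X" for f
  proof (rule power2_le_imp_le)
    have "(nrm (cube d) (\<lambda>x. f x - A f x))\<^sup>2
        = (nrm (cube d) f)\<^sup>2 - (\<Sum>k\<in>I. (cmod (ip (cube d) f (basis d k)))\<^sup>2)"
      unfolding A_def using fin basis_l2 on tensor_power_l2[OF f] by (intro nrm_residual)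
    moreover have "1 / \<tau>\<^sup>2 * ((nrm (cube d) f)\<^sup>2 - (\<Sum>k\<in>I. (cmod (ip (cube d) f (basis d k)))\<^sup>2)) \<le> (hnorm ?X f)\<^sup>2"
      using N I le f by (intro truncation_error) auto
    ultimately show "(nrm (cube d) (\<lambda>x. f x - A f x))\<^sup>2 \<le> (\<tau> * hnorm ?X f)\<^sup>2"
      using \<tau> by (simp add: power_mult_distrib field_simps)
  qed (use \<tau> hnorm0[OF f] in simp)

  have "bounded_operator ?X ?Y A"
    unfolding bounded_operator_def
  proof (intro conjI ballI allI)
    fix f g a b assume "f \<in> hcarrier ?X" "g \<in> hcarrier ?X"
    then have "f \<in> l2 (cube d)" "g \<in> l2 (cube d)"
      by (simp_all add: tensor_power_l2)
    then have "ip (cube d) (\<lambda>x. a * f x + b * g x) (basis d k)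
        = a * ip (cube d) f (basis d k) + b * ip (cube d) g (basis d k)" for k
      by (simp add: ip_add_left ip_cmult_left l2_cmult basis_l2)
    then have "A (\<lambda>x. a * f x + b * g x) y = a * A f y + b * A g y" for y
      by (simp add: A_def distrib_right sum.distrib sum_distrib_left mult.assoc)
    then show "heq ?Y (A (\<lambda>x. a * f x + b * g x)) (\<lambda>y. a * A f y + b * A g y)"
      by (simp add: heq_def)
  next
    show "\<exists>C. \<forall>f\<in>hcarrier ?X. nrm (cube d) (A f) \<le> C * hnorm ?X f"
      using A_le[OF tensor_power_l2] l2_le by (intro exI[of _ 1]) (auto intro: order_trans)
  qed (rule A_l2)
  moreover have "rank_less ?X ?Y A n"
    unfolding rank_less_def
  proof (intro exI[of _ "basis d ` I"] conjI ballI)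
    show "card (basis d ` I) < n"
      using card_image_le[OF fin, of "basis d"] card by simp
    fix f
    \<comment> \<open>Indices with the same basis function are grouped, since the span is formed
      over the image set.\<close>
    define c where "c b = (\<Sum>k\<in>{k \<in> I. basis d k = b}. ip (cube d) f (basis d k))" for b
    have "A f y = (\<Sum>b\<in>basis d ` I. c b * b y)" for y
    proof -
      have "A f y = (\<Sum>b\<in>basis d ` I. \<Sum>k\<in>{k \<in> I. basis d k = b}. ip (cube d) f (basis d k) * basis d k y)"
        unfolding A_def by (rule sum.image_gen[OF fin])
      also have "\<dots> = (\<Sum>b\<in>basis d ` I. c b * b y)"
        unfolding c_def sum_distrib_right by (intro sum.cong) auto
      finally show ?thesis .
    qed
    then show "\<exists>c. heq ?Y (A f) (\<lambda>y. \<Sum>b\<in>basis d ` I. c b * b y)"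
      by (intro exI[of _ c]) (simp add: heq_def)
  qed (use fin basis_l2 in auto)
  moreover have "operator_norm ?X ?Y (\<lambda>f y. f y - A f y) \<le> \<tau>"
    unfolding operator_norm_def
  proof (rule cSup_least)
    show "{nrm (cube d) (\<lambda>y. f y - A f y) |f. f \<in> hcarrier ?X \<and> hnorm ?X f \<le> 1} \<noteq> {}"
      using zero_in_tensor_power[of d] hnorm_zero[of d] by auto
    fix z assume "z \<in> {nrm (cube d) (\<lambda>y. f y - A f y) |f. f \<in> hcarrier ?X \<and> hnorm ?X f \<le> 1}"
    then obtain f where f: "z = nrm (cube d) (\<lambda>y. f y - A f y)" "f \<in> hcarrier ?X" "hnorm ?X f \<le> 1"
      by auto
    have "z \<le> \<tau> * hnorm ?X f"
      unfolding f(1) by (rule A_error[OF f(2)])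
    also have "\<dots> \<le> \<tau> * 1"
      using \<tau> f(3) by (intro mult_left_mono) auto
    finally show "z \<le> \<tau>" by simp
  qed
  \<comment> \<open>An infimum of reals says nothing without a lower bound. Each operator norm is
    the supremum of a bounded set containing the value at the zero function, and hence
    nonnegative.\<close>
  moreover have "bdd_below {operator_norm ?X ?Y (\<lambda>f y. f y - B f y) |B. bounded_operator ?X ?Y B \<and> rank_less ?X ?Y B n}"
  proof (rule bdd_belowI[of _ 0])
    fix z assume "z \<in> {operator_norm ?X ?Y (\<lambda>f y. f y - B f y) |B. bounded_operator ?X ?Y B \<and> rank_less ?X ?Y B n}"
    then obtain B where z: "z = operator_norm ?X ?Y (\<lambda>f y. f y - B f y)" and B: "bounded_operator ?X ?Y B"
      by auto
    obtain C where C: "\<And>f. f \<in> hcarrier ?X \<Longrightarrow> nrm (cube d) (B f) \<le> C * hnorm ?X f"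
      and Bl2: "\<And>f. f \<in> hcarrier ?X \<Longrightarrow> B f \<in> l2 (cube d)"
      using B unfolding bounded_operator_def by blast
    have "bdd_above {nrm (cube d) (\<lambda>y. f y - B f y) |f. f \<in> hcarrier ?X \<and> hnorm ?X f \<le> 1}"
    proof (rule bdd_aboveI[of _ "1 + \<bar>C\<bar>"])
      fix w assume "w \<in> {nrm (cube d) (\<lambda>y. f y - B f y) |f. f \<in> hcarrier ?X \<and> hnorm ?X f \<le> 1}"
      then obtain f where f: "w = nrm (cube d) (\<lambda>y. f y - B f y)" "f \<in> hcarrier ?X" "hnorm ?X f \<le> 1"
        by auto
      have "w \<le> nrm (cube d) f + nrm (cube d) (B f)"
        unfolding f(1) using f(2) by (intro nrm_minus_le tensor_power_l2 Bl2)
      moreover have "C * hnorm ?X f \<le> \<bar>C\<bar> * 1"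
        using f hnorm0[OF f(2)] by (intro mult_mono) auto
      ultimately show "w \<le> 1 + \<bar>C\<bar>"
        using l2_le[OF f(2)] C[OF f(2)] f(3) by linarith
    qed
    then have "nrm (cube d) (\<lambda>y. 0 - B (\<lambda>x. 0) y) \<le> z"
      unfolding z operator_norm_def
      by (intro cSup_upper CollectI exI[of _ "\<lambda>x. 0"]) (simp_all add: zero_in_tensor_power hnorm_zero)
    then show "0 \<le> z"
      using nrm_nonneg order_trans by blast
  qed
  ultimately show ?thesis
    unfolding approx_number_def by (intro cInf_lower2) auto
qed

end

subsection \<open>Sobolev spaces of finite and infinite smoothness\<close>

lemma ip_zero_left [simp]: "ip M (\<lambda>x. 0) g = 0"
  by (simp add: ip_def)

lemma sobolev_space_fin:
  assumes s: "2 \<le> s"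
  shows "sobolev_space (sobolev_fin s) (\<lambda>l f. if l \<le> s then weak_deriv l f else (\<lambda>x. 0))"
proof -
  have weak: "weak_deriv l f \<in> l2 I01" "is_weak_deriv l f (weak_deriv l f)"
    if f: "f \<in> hcarrier (sobolev_fin s)" and l: "l \<le> s" for f l
  proof -
    have "\<exists>g. g \<in> l2 I01 \<and> is_weak_deriv l f g"
    proof (cases "l = 0")
      case True
      then show ?thesis
        using f by (intro exI[of _ f]) (simp add: sobolev_fin_def is_weak_deriv_def)
    next
      case False
      then show ?thesis
        using f l by (auto simp: sobolev_fin_def)
    qed
    from someI_ex[OF this] show "weak_deriv l f \<in> l2 I01" "is_weak_deriv l f (weak_deriv l f)"
      by (simp_all add: weak_deriv_def)
  qed
  show ?thesis
  proof
    fix f l assume f: "f \<in> hcarrier (sobolev_fin s)"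
    show "f \<in> l2 I01"
      using f by (simp add: sobolev_fin_def)
    show "(if l \<le> s then weak_deriv l f else (\<lambda>x. 0)) \<in> l2 I01"
      using weak[OF f] by simp
    show "is_weak_deriv l f (if l \<le> s then weak_deriv l f else (\<lambda>x. 0))" if "l \<le> 2"
      using weak[OF f] that s by simp
    show "summable (\<lambda>l. (nrm I01 (if l \<le> s then weak_deriv l f else (\<lambda>x. 0)))\<^sup>2)"
      by (rule summable_finite[of "{..s}"]) auto
    fix g
    have "(\<Sum>l. ip I01 (if l \<le> s then weak_deriv l f else (\<lambda>x. 0)) (if l \<le> s then weak_deriv l g else (\<lambda>x. 0)))
        = (\<Sum>l\<le>s. ip I01 (if l \<le> s then weak_deriv l f else (\<lambda>x. 0)) (if l \<le> s then weak_deriv l g else (\<lambda>x. 0)))"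
      by (rule suminf_finite) auto
    then show "hinner (sobolev_fin s) f g
        = (\<Sum>l. ip I01 (if l \<le> s then weak_deriv l f else (\<lambda>x. 0)) (if l \<le> s then weak_deriv l g else (\<lambda>x. 0)))"
      by (simp add: sobolev_fin_def)
  next
    fix l
    show "(\<forall>f\<in>hcarrier (sobolev_fin s). is_weak_deriv l f (if l \<le> s then weak_deriv l f else (\<lambda>x. 0))) \<or>
        (\<forall>f\<in>hcarrier (sobolev_fin s). (if l \<le> s then weak_deriv l f else (\<lambda>x. 0)) = (\<lambda>x. 0))"
      using weak(2) by simp
  qed
qed

lemma smooth_interval_has_deriv:
  assumes "smooth_interval f" "x \<in> {0..1}"
  shows "(iterated_deriv l f has_vector_derivative iterated_deriv (Suc l) f x) (at x within {0..1})"
  using assms unfolding smooth_interval_def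
  by (auto simp: iterated_deriv_def vector_derivative_works[symmetric])

lemma smooth_interval_continuous: "smooth_interval f \<Longrightarrow> continuous_on {0..1} (iterated_deriv l f)"
  unfolding smooth_interval_def continuous_on_eq_continuous_within
  by (auto intro: differentiable_imp_continuous_within)

lemma smooth_interval_is_weak_deriv:
  assumes f: "smooth_interval f"
  shows "is_weak_deriv l f (iterated_deriv l f)"
proof (induction l)
  case 0
  then show ?case by (simp add: is_weak_deriv_def iterated_deriv_def)
next
  case (Suc l)
  show ?case
    unfolding is_weak_deriv_iff
  proof (intro allI impI)
    fix \<phi> assume \<phi>: "test_function \<phi>"
    let ?g = "iterated_deriv l f" and ?h = "iterated_deriv (Suc l) f"
    have int: "integrable I01 (\<lambda>x. ?g x * complex_of_real (deriv \<phi> x))" "integrable I01 (\<lambda>x. ?h x * complex_of_real (\<phi> x))"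
      using smooth_interval_continuous[OF f] test_function_continuous[OF \<phi>, of _ 0] test_function_continuous[OF \<phi>, of _ 1]
      by (auto intro!: integrable_I01_continuous continuous_intros)
    have "\<phi> 0 = 0" "\<phi> 1 = 0"
      using \<phi> by (auto simp: test_function_def)
    moreover have "(\<integral>x. ?g x * complex_of_real (deriv \<phi> x) + ?h x * complex_of_real (\<phi> x) \<partial>I01)
        = ?g 1 * complex_of_real (\<phi> 1) - ?g 0 * complex_of_real (\<phi> 0)"
    proof (rule integral_I01_FTC[where F = "\<lambda>x. ?g x * complex_of_real (\<phi> x)"])
      fix x :: real assume "x \<in> {0..1}"
      then show "((\<lambda>x. ?g x * complex_of_real (\<phi> x)) has_vector_derivative
          ?g x * complex_of_real (deriv \<phi> x) + ?h x * complex_of_real (\<phi> x)) (at x within {0..1})"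
        using test_function_DERIV[OF \<phi>, of 0 x]
        by (intro has_vector_derivative_mult has_vector_derivative_of_real smooth_interval_has_deriv[OF f])
           (auto intro: has_field_derivative_at_within)
    next
      show "continuous_on {0..1} (\<lambda>x. ?g x * complex_of_real (deriv \<phi> x) + ?h x * complex_of_real (\<phi> x))"
        using smooth_interval_continuous[OF f] test_function_continuous[OF \<phi>, of _ 0] test_function_continuous[OF \<phi>, of _ 1]
        by (auto intro!: continuous_intros)
    qed
    ultimately have parts: "ip I01 ?g (rfun (deriv \<phi>)) = - ip I01 ?h (rfun \<phi>)"
      using int by (simp add: ip_rfun add_eq_0_iff2)
    \<comment> \<open>The additional derivative is split off next to the test function, so that the
      hypothesis for l applies to its derivative.\<close>
    have "ip I01 f (rfun ((deriv ^^ Suc l) \<phi>)) = ip I01 f (rfun ((deriv ^^ l) (deriv \<phi>)))"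
      by (simp add: funpow_Suc_right del: funpow.simps)
    also have "\<dots> = (-1) ^ l * ip I01 ?g (rfun (deriv \<phi>))"
      using Suc test_function_deriv[OF \<phi>] by (simp add: is_weak_deriv_iff)
    finally show "ip I01 f (rfun ((deriv ^^ Suc l) \<phi>)) = (-1) ^ Suc l * ip I01 ?h (rfun \<phi>)"
      by (simp add: parts)
  qed
qed

lemma sobolev_space_inf: "sobolev_space sobolev_inf iterated_deriv"
proof
  fix f l assume f: "f \<in> hcarrier sobolev_inf"
  then have smooth: "smooth_interval f"
    by (simp add: sobolev_inf_def)
  show l2: "iterated_deriv l f \<in> l2 I01" for l
    by (intro l2_I01_continuous smooth_interval_continuous smooth)
  show "f \<in> l2 I01"
    using l2[of 0] by (simp add: iterated_deriv_def)
  show "is_weak_deriv l f (iterated_deriv l f)"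
    by (rule smooth_interval_is_weak_deriv[OF smooth])
  show "summable (\<lambda>l. (nrm I01 (iterated_deriv l f))\<^sup>2)"
    using f by (simp add: sobolev_inf_def)
  show "hinner sobolev_inf f g = (\<Sum>l. ip I01 (iterated_deriv l f) (iterated_deriv l g))" for g
    by (simp add: sobolev_inf_def)
next
  fix l
  show "(\<forall>f\<in>hcarrier sobolev_inf. is_weak_deriv l f (iterated_deriv l f)) \<or>
      (\<forall>f\<in>hcarrier sobolev_inf. iterated_deriv l f = (\<lambda>x. 0))"
    by (auto simp: sobolev_inf_def intro: smooth_interval_is_weak_deriv)
qed

subsection \<open>Counting\<close>

text \<open>Everything except the constant term adds up to at most (2/3) / d, so the d-th power is
  below exp (2/3), and 2/3 \<le> ln 2.\<close>

lemma legwt_powr_sum_le: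
  assumes d: "d \<ge> 1" and N: "3 \<le> N"
  shows "(\<Sum>n<N. legwt n powr - ((2 + ln (real d)) / 2.5606)) ^ d \<le> 2"
proof -
  define q where "q = (2 + ln (real d)) / 2.5606"
  define a where "a = exp (- 2) / real d"
  have lnd: "0 \<le> ln (real d)" using d by simp
  then have q: "1 / 2 \<le> q" by (simp add: q_def)
  have a0: "0 < a" using d by (simp add: a_def)
  have lam: "lam powr - q = a"
  proof -
    have "lam powr - q = exp (- q * 2.5606)"
      by (simp add: lam_def powr_def)
    also have "- q * 2.5606 = - 2 - ln (real d)"
      by (simp add: q_def field_simps)
    also have "exp (- 2 - ln (real d)) = a"
      using d by (simp add: a_def exp_diff)
    finally show ?thesis .
  qed
  \<comment> \<open>For the weights from 2 on, the part beyond \<open>lam\<close> is at least 1, so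
    q \<ge> 1/2 allows its power to be replaced by an inverse square root. The number 232/25 is sqrt
    86 rounded up.\<close>
  define b where "b n = (if n = 0 then 1 else if n = 1 then a else if n = 2 then a / 2
      else 232 / 25 * a / ((real n - 1) * (real n + 2)))" for n
  have le_b: "legwt n powr - q \<le> b n" for n
  proof -
    have pow: "(lam * r) powr - q \<le> a / sqrt r" if "1 \<le> r" for r
    proof -
      have "(lam * r) powr - q = a * r powr - q"
        using that by (simp add: powr_mult lam lam_def flip: lam)
      also have "r powr - q \<le> r powr - (1 / 2)"
        using q that by (intro powr_mono) auto
      also have "r powr - (1 / 2) = 1 / sqrt r"
        using that by (simp add: powr_minus powr_half_sqrt inverse_eq_divide)
      finally show ?thesis
        using a0 by simp
    qed
    consider "n = 0" | "n = 1" | "n = 2" | "n \<ge> 3" by linarith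
    then show ?thesis
    proof cases
      case 3
      then show ?thesis
        using pow[of 4] by (simp add: legwt_def b_def mult.commute)
    next
      case 4
      define z where "z = (real n - 1) * (real n + 2)"
      have z: "10 \<le> z"
        unfolding z_def using 4 mult_mono[of 2 "real n - 1" 5 "real n + 2"] by simp
      have "10\<^sup>2 \<le> z\<^sup>2"
        using z by (intro power_mono) auto
      then have "(lam * (z\<^sup>2 / 86)) powr - q \<le> a / sqrt (z\<^sup>2 / 86)"
        by (intro pow) simp
      also have "a / sqrt (z\<^sup>2 / 86) = sqrt 86 * a / z"
        using z by (simp add: real_sqrt_divide)
      also have "\<dots> \<le> 232 / 25 * a / z"
      proof -
        have "sqrt 86 \<le> sqrt ((232 / 25)\<^sup>2)"
          by (intro real_sqrt_le_mono) (simp add: power2_eq_square)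
        then have "sqrt 86 \<le> 232 / 25" by simp
        then show ?thesis
          using a0 z by (intro divide_right_mono mult_right_mono) auto
      qed
      finally show ?thesis
        using 4 by (simp add: legwt_def b_def z_def)
    qed (simp_all add: legwt_def b_def lam)
  qed
  \<comment> \<open>1 / ((n - 1) (n + 2)) is a third of 1 / (n - 1) - 1 / (n + 2). The sum
    telescopes with step three and leaves three boundary terms; those at N = 3 are 1/2 + 1/3 + 1/4 =
    13/12.\<close>
  have "(\<Sum>n<N. b n) \<le> 1 + 3 / 2 * a
      + 232 / 25 * a / 3 * (13 / 12 - (1 / (real N - 1) + 1 / real N + 1 / (real N + 1)))"
    using N
  proof (induction N rule: dec_induct)
    case base
    then show ?case by (simp add: eval_nat_numeral b_def)
  next
    case (step m)
    then have m: "real m \<ge> 3" by simp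
    have bm: "b m = 232 / 25 * a / 3 * (1 / (real m - 1) - 1 / (real m + 2))"
    proof -
      have "1 / (real m - 1) - 1 / (real m + 2) = 3 / ((real m - 1) * (real m + 2))"
        using m by (simp add: field_simps)
      then show ?thesis
        using step m by (simp only: b_def) simp
    qed
    have "(\<Sum>n<Suc m. b n) \<le> 1 + 3 / 2 * a
      + 232 / 25 * a / 3 * (13 / 12 - (1 / (real m - 1) + 1 / real m + 1 / (real m + 1)))
      + 232 / 25 * a / 3 * (1 / (real m - 1) - 1 / (real m + 2))"
      unfolding sum.lessThan_Suc bm by (rule add_right_mono[OF step.IH])
    also have "\<dots> = 1 + 3 / 2 * a
      + 232 / 25 * a / 3 * (13 / 12 - (1 / (real (Suc m) - 1) + 1 / real (Suc m) + 1 / (real (Suc m) + 1)))"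
    proof -
      have "y + x * (13 / 12 - (u + v + w)) + x * (u - z) = y + x * (13 / 12 - (v + w + z))"
        for x y u v w z :: real
        by (simp add: algebra_simps)
      then show ?thesis
        by (simp only:) (simp add: add.commute)
    qed
    finally show ?case .
  qed
  also have "\<dots> \<le> 1 + 3 / 2 * a + 232 / 25 * a / 3 * (13 / 12)"
  proof -
    have "0 \<le> 1 / (real N - 1) + 1 / real N + 1 / (real N + 1)"
      using N by (intro add_nonneg_nonneg) auto
    then show ?thesis
      using a0 by (intro add_mono mult_left_mono) auto
  qed
  also have "\<dots> \<le> 1 + 243 / 50 * a"
    using a0 by simp
  finally have "(\<Sum>n<N. b n) \<le> 1 + (2 / 3) / real d"
  proof -
    \<comment> \<open>Little slack is left here: 243/50 rounds up 3/2 + 232/75 * 13/12, and 4.86 /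
      7.3 is just below 2/3.\<close>
    have "exp 1 \<ge> (2.718 :: real)"
      using e_approx_32 by (simp add: abs_if split: if_split_asm)
    then have "(2.718 :: real)\<^sup>2 \<le> exp 1 ^ 2"
      by (intro power_mono) auto
    then have "7.3 \<le> exp (2 :: real)"
      by (simp add: power2_eq_square flip: exp_add)
    then have "243 / 50 * exp (- 2 :: real) \<le> 2 / 3"
      by (simp add: exp_minus field_simps)
    then have "243 / 50 * a \<le> (2 / 3) / real d"
      unfolding a_def using d by (simp add: field_simps)
    moreover assume "(\<Sum>n<N. b n) \<le> 1 + 243 / 50 * a"
    ultimately show ?thesis by linarith
  qed
  moreover have "(\<Sum>n<N. legwt n powr - q) \<le> (\<Sum>n<N. b n)"
    by (intro sum_mono le_b)
  ultimately have "(\<Sum>n<N. legwt n powr - q) \<le> 1 + (2 / 3) / real d"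
    by linarith
  then have "(\<Sum>n<N. legwt n powr - q) ^ d \<le> (1 + (2 / 3) / real d) ^ d"
    by (intro power_mono sum_nonneg) auto
  also have "\<dots> \<le> exp (2 / 3)"
    using d by (intro exp_ge_one_plus_x_over_n_power_n) auto
  also have "\<dots> \<le> exp (ln 2)"
    using ln2_ge_two_thirds by (simp only: exp_le_cancel_iff)
  finally show ?thesis
    by (simp add: q_def)
qed

text \<open>Markov's inequality for the counting measure.\<close>

lemma card_legwt_less:
  assumes d: "d \<ge> 1" and n: "n \<ge> 1" and N: "3 \<le> N"
    and \<tau>: "\<tau> = (2 / real n) powr (1.2803 / (2 + ln (real d)))"
  shows "card {k \<in> PiE {..<d} (\<lambda>_. {..<N}). (\<Prod>i<d. legwt (k i)) < 1 / \<tau>\<^sup>2} < n" (is "card ?I < n")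
\<comment> \<open>The strict comparison of sums below requires a nonempty index set.\<close>
proof (cases "?I = {}")
  case True
  show ?thesis unfolding True using n by simp
next
  case False
  define q where "q = (2 + ln (real d)) / 2.5606"
  have lnd: "0 \<le> ln (real d)" using d by simp
  then have q: "q > 0" by (simp add: q_def)
  have \<tau>0: "\<tau> > 0" using n by (simp add: \<tau>)
  have wt: "legwt i > 0" for i
    using legwt_ge_1[of i] by simp
  have fin: "finite (PiE {..<d} (\<lambda>_. {..<N}))"
    by (intro finite_PiE) auto
  have prod_powr: "(\<Prod>i<d. legwt (k i) powr - q) = (\<Prod>i<d. legwt (k i)) powr - q" for k
    using wt by (subst prod_powr_distrib) (auto intro: less_imp_le)
  have T: "(1 / \<tau>\<^sup>2) powr q = real n / 2"
  proof -
    have "1.2803 / (2 + ln (real d)) * (2 * q) = 1"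
      using lnd by (simp add: q_def field_simps)
    then have "\<tau> powr (2 * q) = (2 / real n) powr 1"
      by (simp only: \<tau> powr_powr)
    then have "(\<tau>\<^sup>2) powr q = 2 / real n"
      using \<tau>0 n by (simp add: powr_powr flip: powr_numeral)
    then show ?thesis
      using \<tau>0 by (simp add: powr_divide)
  qed
  have "real (card ?I) = (\<Sum>k\<in>?I. 1)"
    by simp
  \<comment> \<open>Strictness comes from the strict inequality defining the index set and is passed
    on to the cardinality; the rank has to be less than n, not just at most n.\<close>
  also have "\<dots> < (\<Sum>k\<in>?I. (1 / \<tau>\<^sup>2) powr q * (\<Prod>i<d. legwt (k i) powr - q))"
  proof (rule sum_strict_mono)
    fix k assume "k \<in> ?I"
    then have k: "(\<Prod>i<d. legwt (k i)) < 1 / \<tau>\<^sup>2" by simp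
    have pos: "0 < (\<Prod>i<d. legwt (k i))"
      using wt by (intro prod_pos) auto
    have "(\<Prod>i<d. legwt (k i)) powr q < (1 / \<tau>\<^sup>2) powr q"
      using k pos q by (intro powr_less_mono2) auto
    moreover have gt: "0 < (\<Prod>i<d. legwt (k i)) powr q"
      using pos by (metis powr_gt_zero less_irrefl)
    ultimately show "1 < (1 / \<tau>\<^sup>2) powr q * (\<Prod>i<d. legwt (k i) powr - q)"
      unfolding prod_powr unfolding powr_minus
      by (simp only: divide_inverse[symmetric] pos_less_divide_eq[OF gt] mult_1_left)
  qed (use False fin in auto)
  also have "\<dots> \<le> (\<Sum>k\<in>PiE {..<d} (\<lambda>_. {..<N}). (1 / \<tau>\<^sup>2) powr q * (\<Prod>i<d. legwt (k i) powr - q))"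
  proof (rule sum_mono2[OF fin])
    show "?I \<subseteq> PiE {..<d} (\<lambda>_. {..<N})"
      by blast
    show "0 \<le> (1 / \<tau>\<^sup>2) powr q * (\<Prod>i<d. legwt (k i) powr - q)" for k
      by (intro mult_nonneg_nonneg prod_nonneg powr_ge_zero ballI)
  qed
  also have "\<dots> = (1 / \<tau>\<^sup>2) powr q * (\<Sum>m<N. legwt m powr - q) ^ d"
  proof -
    have "(\<Prod>i<d. \<Sum>m<N. legwt m powr - q) = (\<Sum>k\<in>PiE {..<d} (\<lambda>_. {..<N}). \<Prod>i<d. legwt (k i) powr - q)"
      by (rule prod_sum_PiE) auto
    then show ?thesis
      by (simp add: sum_distrib_left)
  qed
  also have "\<dots> \<le> real n / 2 * 2"
    unfolding T using legwt_powr_sum_le[OF d N, folded q_def] by (rule mult_left_mono) simp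
  finally show ?thesis by simp
qed

theorem corollary8:
  fixes d n :: nat and s :: enat
  assumes "d \<ge> 1" and "s \<ge> 2" and "n \<ge> 1"
  shows "approx_number (sobolev_mix s d) (L2 (unit_cube d)) (\<lambda>f. f) n
           \<le> (2 / real n) powr (1.2803 / (2 + ln (real d)))"
proof -
  define \<tau> where "\<tau> = (2 / real n) powr (1.2803 / (2 + ln (real d)))"
  have \<tau>: "0 < \<tau>" using \<open>n \<ge> 1\<close> by (simp add: \<tau>_def)
  obtain D where D: "sobolev_space (sobolev s) D"
  proof (cases s)
    case (enat k)
    then have "2 \<le> k"
      using \<open>s \<ge> 2\<close> by (simp add: numeral_eq_enat)
    with enat that sobolev_space_fin show ?thesis
      by (auto simp: sobolev_def)
  next
    case infinity
    with that sobolev_space_inf show ?thesis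
      by (auto simp: sobolev_def)
  qed
  interpret sobolev_space "sobolev s" D by (rule D)
  \<comment> \<open>As all weights are at least 1, a multi-index with a single entry N already has a
    product of at least 1 / \<tau>^2. So the lumped remainder never has to be kept.\<close>
  obtain N where N: "3 \<le> N" "1 / \<tau>\<^sup>2 \<le> legwt N"
    using legwt_unbounded by blast
  let ?I = "{k \<in> index_box d N. (\<Prod>i<d. legwt (k i)) < 1 / \<tau>\<^sup>2}"
  have "approx_number (tensor_power d (sobolev s)) (L2 (cube d)) (\<lambda>f. f) n \<le> \<tau>"
  proof (rule approx_number_tensor_power_le[OF \<tau> N(1)])
    show "card ?I < n"
      by (rule card_legwt_less[OF \<open>d \<ge> 1\<close> \<open>n \<ge> 1\<close> N(1) \<tau>_def])
    fix k assume k: "k \<in> PiE {..<d} (\<lambda>_. {..N})" "k \<notin> ?I"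
    show "1 / \<tau>\<^sup>2 \<le> (\<Prod>i<d. legwt (k i))"
    proof (cases "k \<in> index_box d N")
      case True
      with k show ?thesis by simp
    next
      case False
      then obtain i where i: "i < d" "\<not> k i < N"
        using k(1) by (auto simp: PiE_iff)
      moreover have "k i \<le> N"
        using PiE_mem[OF k(1), of i] i(1) by simp
      ultimately have i: "i < d" "k i = N"
        by simp_all
      have "legwt (k i) * 1 \<le> legwt (k i) * (\<Prod>j\<in>{..<d} - {i}. legwt (k j))"
        using legwt_ge_1 order_trans[OF zero_le_one legwt_ge_1] by (intro mult_left_mono prod_ge_1) auto
      also have "\<dots> = (\<Prod>j<d. legwt (k j))"
        using i by (subst prod.remove[of _ i]) auto
      finally show ?thesis
        using N(2) i by simp
    qed
  qed auto
  then show ?thesis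
    by (simp add: sobolev_mix_def \<tau>_def)
qed

end
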